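(* If $L\subset\mathbb{C}^3$ is a connected special Lagrangian submanifold whose fundamental cubic has $\mathbb{Z}_3$-symmetry (that is, has stabilizer isomorphic to $\mathbb{Z}_3$) at each point of a dense open subset of $L$, then $L$ contains a dense open set $L^*$ such that every point of $L^*$ has an open neighborhood in $L$ that is an open subset of one of the special Lagrangian $3$-folds $$L_\Sigma=\bigl\{\,(s+i\,t)\,\mathbf{u}\ \bigm|\ \mathbf{u}\in\Sigma,\ t^3-3s^2t=c\,\bigr\},$$ where $s,t$ are real, $c$ is a real constant and $\Sigma\subset S^5\subset\mathbb{C}^3$ is a surface such that the cone on $\Sigma$ is special Lagrangian.
   Context: On $\mathbb{C}^3$ use the standard structure $\omega=\frac{i}{2}\sum_k dz_k\wedge d\bar z_k$, $\Upsilon=dz_1\wedge dz_2\wedge dz_3$, the flat metric $g=\sum_k|dz_k|^2$ and the complex structure $J$ (multiplication by $i$). A $3$-dimensional submanifold $L\subset\mathbb{C}^3$ is special Lagrangian if $\omega$ and $\operatorname{Im}\Upsilon$ pull back to $0$ on $L$; it is oriented so that $\operatorname{Re}\Upsilon$ is a positive volume form. The fundamental cubic $C$ of $L$ is the symmetric cubic form on $L$ given by $C_x(a,b,c)=g(\mathrm{II}_x(a,b),Jc)$ for $a,b,c\in T_xL$, where $\mathrm{II}$ is the second fundamental form of $L$. It is totally symmetric and traceless with respect to the induced metric. The group $SO(T_xL)\cong SO(3)$ acts on such cubics by pullback, and the stabilizer of $C_x$ is the subgroup fixing $C_x$.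
   Formalization: The neighborhoods are shown to be open subsets of translates v + L_Σ, with v in C^3 depending on the point; with L_Σ centred at the origin the claim is false, since a translate of an L_Σ with Z_3-symmetry meets the hypotheses but is not locally an L_Σ centred at the origin. *)

theory Defs
  imports "HOL-Analysis.Analysis" "HOL-Algebra.Bij" "HOL-Algebra.Elementary_Groups"
begin

subsection \<open>Smooth maps and embedded submanifolds of a Euclidean space\<close>

text \<open>These are meant for open domains, where
  continuity of the iterated directional derivatives is the usual \<open>C\<^sup>k\<close> condition.\<close>

primrec Ck_on :: "nat \<Rightarrow> 'a::euclidean_space set \<Rightarrow> ('a \<Rightarrow> 'b::euclidean_space) \<Rightarrow> bool" where
  "Ck_on 0 S f \<longleftrightarrow> continuous_on S f"
| "Ck_on (Suc k) S f \<longleftrightarrow> (\<forall>x\<in>S. f differentiable (at x)) \<and>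
     (\<forall>v. Ck_on k S (\<lambda>x. frechet_derivative f (at x) v))"

definition smooth_on :: "'a::euclidean_space set \<Rightarrow> ('a \<Rightarrow> 'b::euclidean_space) \<Rightarrow> bool" where
  "smooth_on S f \<longleftrightarrow> (\<forall>k. Ck_on k S f)"

text \<open>Embedded submanifolds without boundary, described by slice charts. The model space is a
  linear subspace of the ambient space, so that the dimension \<open>k\<close> is a number and not a type.\<close>

definition smooth_submanifold :: "nat \<Rightarrow> 'a::euclidean_space set \<Rightarrow> bool" where
  "smooth_submanifold k M \<longleftrightarrow>
     (\<forall>p\<in>M. \<exists>(U :: 'a set) (V :: 'a set) \<phi> \<psi> S. open U \<and> p \<in> U \<and> open V \<and> homeomorphism U V \<phi> \<psi> \<and>
        smooth_on U \<phi> \<and> smooth_on V \<psi> \<and> subspace S \<and> dim S = k \<and>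
        \<phi> ` (U \<inter> M) = V \<inter> S)"

definition tangent_space :: "'a::euclidean_space set \<Rightarrow> 'a \<Rightarrow> 'a set" where
  "tangent_space M p =
     {v. \<exists>\<epsilon>>0. \<exists>\<gamma>::real \<Rightarrow> 'a. smooth_on {-\<epsilon><..<\<epsilon>} \<gamma> \<and> \<gamma> ` {-\<epsilon><..<\<epsilon>} \<subseteq> M \<and>
          \<gamma> 0 = p \<and> (\<gamma> has_vector_derivative v) (at 0)}"

text \<open>\<open>II\<^sub>x(a,b)\<close> is the normal component of \<open>D\<^sub>a B\<close>, where \<open>D\<close> is the flat connection of the
  ambient space and \<open>B\<close> is any smooth extension of \<open>b\<close> near \<open>x\<close> that is tangent to \<open>M\<close> along \<open>M\<close>.
  The description determines the value for a smooth submanifold \<open>M\<close>, a point \<open>x\<close> of \<open>M\<close> and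
  tangent vectors \<open>a\<close>, \<open>b\<close> at \<open>x\<close>; otherwise the value is irrelevant.\<close>

definition second_fundamental_form ::
    "'a::euclidean_space set \<Rightarrow> 'a \<Rightarrow> 'a \<Rightarrow> 'a \<Rightarrow> 'a" where
  "second_fundamental_form M x a b =
     (THE n. \<exists>U B. open U \<and> x \<in> U \<and> smooth_on U B \<and>
        (\<forall>y\<in>U \<inter> M. B y \<in> tangent_space M y) \<and> B x = b \<and>
        n \<in> orthogonal_comp (tangent_space M x) \<and>
        frechet_derivative B (at x) a - n \<in> tangent_space M x)"

subsection \<open>The standard structure of \<open>\<complex>\<^sup>3\<close>\<close>

text \<open>The metric \<open>g\<close> is the inner product of \<^typ>\<open>complex ^ 3\<close> as a real Euclidean space.\<close>

definition J :: "complex ^ 3 \<Rightarrow> complex ^ 3" where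
  "J v = \<i> *s v"

text \<open>\<open>(i/2) \<Sum>\<^sub>k dz\<^sub>k \<and> d(cnj z\<^sub>k)\<close>, with \<open>(\<alpha> \<and> \<beta>)(a,b) = \<alpha>(a) \<beta>(b) - \<alpha>(b) \<beta>(a)\<close>. This is a real
  number, and \<^const>\<open>Re\<close> only adjusts the type.\<close>

definition kaehler_form :: "complex ^ 3 \<Rightarrow> complex ^ 3 \<Rightarrow> real" where
  "kaehler_form a b = Re (\<i> / 2 * (\<Sum>k\<in>UNIV. a $ k * cnj (b $ k) - b $ k * cnj (a $ k)))"

text \<open>\<open>dz\<^sub>1 \<and> dz\<^sub>2 \<and> dz\<^sub>3\<close>\<close>

definition Upsilon :: "complex ^ 3 \<Rightarrow> complex ^ 3 \<Rightarrow> complex ^ 3 \<Rightarrow> complex" where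
  "Upsilon a b c = det (vector [a, b, c] :: complex ^ 3 ^ 3)"

subsection \<open>Special Lagrangian submanifolds and their fundamental cubic\<close>

definition special_lagrangian :: "(complex ^ 3) set \<Rightarrow> bool" where
  "special_lagrangian L \<longleftrightarrow> smooth_submanifold 3 L \<and>
     (\<forall>x\<in>L. \<forall>a\<in>tangent_space L x. \<forall>b\<in>tangent_space L x. kaehler_form a b = 0) \<and>
     (\<forall>x\<in>L. \<forall>a\<in>tangent_space L x. \<forall>b\<in>tangent_space L x. \<forall>c\<in>tangent_space L x.
        Im (Upsilon a b c) = 0)"

definition fundamental_cubic ::
    "(complex ^ 3) set \<Rightarrow> complex ^ 3 \<Rightarrow> complex ^ 3 \<Rightarrow> complex ^ 3 \<Rightarrow> complex ^ 3 \<Rightarrow> real" where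
  "fundamental_cubic L x a b c = second_fundamental_form L x a b \<bullet> J c"

text \<open>\<open>SO(T)\<close> for a three-dimensional subspace \<open>T\<close>. Elements are extensional functions on \<open>T\<close>, as in
  \<^const>\<open>BijGroup\<close>; the determinant of an endomorphism of \<open>T\<close> is that of its matrix with respect to
  an orthonormal basis (any one gives the same value). It does not depend on an orientation of
  \<open>T\<close>.\<close>

definition orthonormal_basis :: "'a::euclidean_space set \<Rightarrow> (3 \<Rightarrow> 'a) \<Rightarrow> bool" where
  "orthonormal_basis T e \<longleftrightarrow> span (range e) = T \<and> (\<forall>i j. e i \<bullet> e j = (if i = j then 1 else 0))"

definition special_orthogonal :: "'a::euclidean_space set \<Rightarrow> ('a \<Rightarrow> 'a) set" where
  "special_orthogonal T =
     {A \<in> Bij T. (\<forall>a\<in>T. \<forall>b\<in>T. A (a + b) = A a + A b) \<and> (\<forall>r. \<forall>a\<in>T. A (r *\<^sub>R a) = r *\<^sub>R A a) \<and>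
        (\<forall>a\<in>T. \<forall>b\<in>T. A a \<bullet> A b = a \<bullet> b) \<and>
        (\<forall>e. orthonormal_basis T e \<longrightarrow> det (\<chi> i j. e i \<bullet> A (e j) :: real ^ 3 ^ 3) = 1)}"

definition cubic_stabilizer ::
    "'a::euclidean_space set \<Rightarrow> ('a \<Rightarrow> 'a \<Rightarrow> 'a \<Rightarrow> real) \<Rightarrow> ('a \<Rightarrow> 'a) monoid" where
  "cubic_stabilizer T C = (BijGroup T)
     \<lparr>carrier := {A \<in> special_orthogonal T. \<forall>a\<in>T. \<forall>b\<in>T. \<forall>c\<in>T. C (A a) (A b) (A c) = C a b c}\<rparr>"

definition has_Z3_symmetry :: "(complex ^ 3) set \<Rightarrow> complex ^ 3 \<Rightarrow> bool" where
  "has_Z3_symmetry L x \<longleftrightarrow>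
     cubic_stabilizer (tangent_space L x) (fundamental_cubic L x) \<cong> integer_mod_group 3"

subsection \<open>The special Lagrangian 3-folds built from a surface in the sphere\<close>

text \<open>The cone is taken without its vertex, where it is singular in general.\<close>

definition cone_on :: "(complex ^ 3) set \<Rightarrow> (complex ^ 3) set" where
  "cone_on \<Sigma> = {r *\<^sub>R u | r u. 0 < r \<and> u \<in> \<Sigma>}"

definition sl_cone_link :: "(complex ^ 3) set \<Rightarrow> bool" where
  "sl_cone_link \<Sigma> \<longleftrightarrow> \<Sigma> \<subseteq> sphere 0 1 \<and> smooth_submanifold 2 \<Sigma> \<and> special_lagrangian (cone_on \<Sigma>)"

definition L_of :: "(complex ^ 3) set \<Rightarrow> real \<Rightarrow> (complex ^ 3) set" where
  "L_of \<Sigma> c = {Complex s t *s u | s t u. u \<in> \<Sigma> \<and> t ^ 3 - 3 * s\<^sup>2 * t = c}"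

definition dense_open_in :: "'a::topological_space set \<Rightarrow> 'a set \<Rightarrow> bool" where
  "dense_open_in D L \<longleftrightarrow> openin (top_of_set L) D \<and> L \<subseteq> closure D"

end

theory Submission
  imports Defs
begin

text \<open>
  A rotation of order three in the stabilizer has an axis \<open>e\<^sub>1\<close>, and the cubic is
  \<open>r (2 x\<^sub>1\<^sup>3 - 3 x\<^sub>1 x\<^sub>2\<^sup>2 - 3 x\<^sub>1 x\<^sub>3\<^sup>2) + s (x\<^sub>2\<^sup>3 - 3 x\<^sub>2 x\<^sub>3\<^sup>2)\<close> in a suitable orthonormal
  basis. Here \<open>r \<noteq> 0\<close> and \<open>s\<^sup>2 \<noteq> 2 r\<^sup>2\<close>, since otherwise the stabilizer contains a half turn. Under these
  conditions a polynomial covariant vector of the cubic is a nonzero multiple of \<open>e\<^sub>1\<close>, so the axis extends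
  to a smooth unit vector field \<open>E\<close>. The symmetry of the second derivatives of \<open>E\<close> forces
  \<open>D\<^sub>v E = \<zeta> v\<close> for tangent vectors \<open>v\<close> orthogonal to \<open>E\<close> and \<open>D\<^sub>E E = 2 i r E\<close>, with
  \<open>\<zeta> = t - i r\<close> and \<open>t\<close> real; using it once more, the derivative of \<open>\<zeta>\<close> vanishes orthogonally to \<open>E\<close> and
  is \<open>(2 i r - \<zeta>) \<zeta>\<close> along \<open>E\<close>. Hence \<open>x - \<zeta>\<^sup>-\<^sup>1 E\<close> is a constant \<open>v\<close>. With \<open>z\<^sup>3 = 1 / (\<bar>\<zeta>\<bar>\<^sup>2 \<zeta>)\<close> the
  imaginary part of \<open>z\<^sup>3\<close> is constant, the unit vector \<open>u = (x - v) / z\<close> is constant along the integral curves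
  of \<open>E\<close>, and its values form a Legendrian surface, which is the link \<open>\<Sigma>\<close>.
\<close>

text \<open>The obstacle is smoothness. Adapted bases, and with them \<open>r\<close>,
  \<open>s\<close> and the axis, are first chosen point by point. The proof therefore extracts only
  three quantities, each by a formula that is smooth along a smooth orthonormal frame:
  \<open>E\<close> by contracting the cubic, \<open>r\<close> as half the value of the cubic on
  \<open>E\<close>, and the real part of \<zeta> as half a trace. This is enough because the cubic
  with \<open>E\<close> in one slot does not involve \<open>s\<close>. The covariant vector has the
  length factor \<open>4 r (2 r^2 - s^2)\<close>, which vanishes just where the normal form has a
  half turn; \<open>s^2 = 2 r^2\<close> is the tetrahedral cubic, a multiple of the product of three
  orthonormal coordinates. Connections and structure equations are replaced by derivatives in the
  ambient space along a parametrization, with symmetry of second derivatives as the integrability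
  condition. The models have their vertex at the origin, while the hypotheses are invariant under
  translations; hence the vector \<open>v\<close> in the conclusion. The constant \<open>c\<close>
  is nonzero because \<open>r\<close> is.\<close>

abbreviation D :: "('a::real_normed_vector \<Rightarrow> 'b::real_normed_vector) \<Rightarrow> 'a \<Rightarrow> 'a \<Rightarrow> 'b" where
  "D f x \<equiv> frechet_derivative f (at x)"

subsection \<open>Calculus of smooth maps\<close>

text \<open>Openness of \<open>S\<close> matters: the derivative at a point of \<open>S\<close> then
  depends only on values in \<open>S\<close>, so formulas valid on \<open>S\<close> alone may be
  substituted in smoothness arguments.\<close>

lemma Ck_on_cong:
  assumes "open S" "\<And>x. x \<in> S \<Longrightarrow> f x = g x" "Ck_on k S f"
  shows "Ck_on k S g"
  using assms
proof (induction k arbitrary: f g)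
  case 0
  then show ?case by (simp cong: continuous_on_cong)
next
  case (Suc k)
  have d: "(g has_derivative D f x) (at x)" if "x \<in> S" for x
    using Suc.prems that
    by (metis Ck_on.simps(2) frechet_derivative_works has_derivative_transform_within_open)
  moreover have "Ck_on k S (\<lambda>x. D g x v)" for v
    using Suc.IH[of "\<lambda>x. D f x v" "\<lambda>x. D g x v"] Suc.prems d frechet_derivative_at by fastforce
  ultimately show ?case
    by (auto simp: differentiable_def)
qed

lemma Ck_on_SucI:
  assumes "open S" "\<And>x. x \<in> S \<Longrightarrow> (f has_derivative f' x) (at x)"
    "\<And>v. Ck_on k S (\<lambda>x. f' x v)"
  shows "Ck_on (Suc k) S f"
  using assms Ck_on_cong[OF assms(1), of "\<lambda>x. f' x _" "\<lambda>x. D f x _" k]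
  by (fastforce simp: differentiable_def dest: frechet_derivative_at)

lemma Ck_on_Suc_imp: "Ck_on (Suc k) S f \<Longrightarrow> Ck_on k S f"
proof (induction k arbitrary: f)
  case 0
  then show ?case
    by (simp add: continuous_at_imp_continuous_on differentiable_imp_continuous_within)
qed auto

lemma Ck_on_mono: "Ck_on k S f \<Longrightarrow> T \<subseteq> S \<Longrightarrow> Ck_on k T f"
  by (induction k arbitrary: f) (auto intro: continuous_on_subset)

lemma Ck_on_has_derivative: "Ck_on (Suc k) S f \<Longrightarrow> x \<in> S \<Longrightarrow> (f has_derivative D f x) (at x)"
  by (simp add: frechet_derivative_works)

lemma Ck_on_const: "Ck_on k S (\<lambda>x. c)"
  by (induction k arbitrary: c) auto

lemma Ck_on_linear:
  assumes "bounded_linear f" shows "Ck_on k S f"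
proof (cases k)
  case 0
  then show ?thesis using assms by (simp add: linear_continuous_on)
next
  case (Suc k)
  have "(f has_derivative f) (at x)" for x
    using assms bounded_linear_imp_has_derivative by blast
  then have "D f x = f" "f differentiable (at x)" for x
    by (metis frechet_derivative_at, metis differentiable_def)
  then show ?thesis using Suc by (simp add: Ck_on_const)
qed

lemma Ck_on_add:
  assumes "open S" "Ck_on k S f" "Ck_on k S g"
  shows "Ck_on k S (\<lambda>x. f x + g x)"
  using assms(2,3)
proof (induction k arbitrary: f g)
  case 0
  then show ?case by (simp add: continuous_on_add)
next
  case (Suc k)
  show ?case
    by (rule Ck_on_SucI[OF assms(1) has_derivative_add[OF Ck_on_has_derivative[OF Suc.prems(1)]
        Ck_on_has_derivative[OF Suc.prems(2)]]]) (use Suc in auto)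
qed

text \<open>One product rule serves scalar, inner, complex and Hermitian products. Both summands of
  the derivative are again products of maps of class \<open>k\<close>, which closes the
  induction.\<close>

lemma Ck_on_bilinear:
  assumes "bounded_bilinear m" "open S" "Ck_on k S f" "Ck_on k S g"
  shows "Ck_on k S (\<lambda>x. m (f x) (g x))"
  using assms(3,4)
proof (induction k arbitrary: f g)
  case 0
  then show ?case using assms(1) by (simp add: bounded_bilinear.continuous_on)
next
  case (Suc k)
  have f: "Ck_on k S f" and g: "Ck_on k S g"
    using Suc.prems Ck_on_Suc_imp by blast+
  show ?case
  proof (rule Ck_on_SucI[OF assms(2) bounded_bilinear.FDERIV[OF assms(1)
          Ck_on_has_derivative[OF Suc.prems(1)] Ck_on_has_derivative[OF Suc.prems(2)]]])
    fix v show "Ck_on k S (\<lambda>x. m (f x) (D g x v) + m (D f x v) (g x))"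
      by (rule Ck_on_add[OF assms(2)]) (use Suc f g in auto)
  qed
qed

lemma smooth_on_cong:
  "open S \<Longrightarrow> (\<And>x. x \<in> S \<Longrightarrow> f x = g x) \<Longrightarrow> smooth_on S f \<Longrightarrow> smooth_on S g"
  using Ck_on_cong smooth_on_def by metis

lemma smooth_on_mono: "smooth_on S f \<Longrightarrow> T \<subseteq> S \<Longrightarrow> smooth_on T f"
  unfolding smooth_on_def using Ck_on_mono by blast

lemma smooth_on_continuous: "smooth_on S f \<Longrightarrow> continuous_on S f"
  using Ck_on.simps(1) smooth_on_def by blast

lemma smooth_on_has_derivative: "smooth_on S f \<Longrightarrow> x \<in> S \<Longrightarrow> (f has_derivative D f x) (at x)"
  using Ck_on_has_derivative smooth_on_def by blast

lemma smooth_on_deriv: "smooth_on S f \<Longrightarrow> smooth_on S (\<lambda>x. D f x v)"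
  unfolding smooth_on_def using Ck_on.simps(2) by blast

lemma smooth_on_const [intro, simp]: "smooth_on S (\<lambda>x. c)"
  by (simp add: Ck_on_const smooth_on_def)

lemma smooth_on_linear: "bounded_linear f \<Longrightarrow> smooth_on S f"
  by (simp add: Ck_on_linear smooth_on_def)

lemma smooth_on_id [intro, simp]: "smooth_on S (\<lambda>x. x)"
  by (simp add: bounded_linear_ident smooth_on_linear)

lemma smooth_on_bilinear:
  "bounded_bilinear m \<Longrightarrow> open S \<Longrightarrow> smooth_on S f \<Longrightarrow> smooth_on S g \<Longrightarrow>
    smooth_on S (\<lambda>x. m (f x) (g x))"
  by (simp add: Ck_on_bilinear smooth_on_def)

lemma smooth_on_scaleR:
  "open S \<Longrightarrow> smooth_on S f \<Longrightarrow> smooth_on S g \<Longrightarrow> smooth_on S (\<lambda>x. f x *\<^sub>R g x)"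
  by (rule smooth_on_bilinear[OF bounded_bilinear_scaleR])

lemma Ck_on_scaleR:
  "open S \<Longrightarrow> Ck_on k S f \<Longrightarrow> Ck_on k S g \<Longrightarrow> Ck_on k S (\<lambda>x. f x *\<^sub>R g x)"
  by (rule Ck_on_bilinear[OF bounded_bilinear_scaleR])

lemma smooth_on_mult:
  fixes f g :: "_ \<Rightarrow> 'b::{euclidean_space, real_normed_algebra}"
  shows "open S \<Longrightarrow> smooth_on S f \<Longrightarrow> smooth_on S g \<Longrightarrow> smooth_on S (\<lambda>x. f x * g x)"
  by (rule smooth_on_bilinear[OF bounded_bilinear_mult])

lemma smooth_on_power:
  fixes f :: "_ \<Rightarrow> 'b::{euclidean_space, real_normed_algebra_1}"
  shows "open S \<Longrightarrow> smooth_on S f \<Longrightarrow> smooth_on S (\<lambda>x. f x ^ n)"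
  by (induction n) (auto intro: smooth_on_mult)

lemma smooth_on_inner:
  "open S \<Longrightarrow> smooth_on S f \<Longrightarrow> smooth_on S g \<Longrightarrow> smooth_on S (\<lambda>x. f x \<bullet> g x)"
  by (rule smooth_on_bilinear[OF bounded_bilinear_inner])

lemma smooth_on_add:
  "open S \<Longrightarrow> smooth_on S f \<Longrightarrow> smooth_on S g \<Longrightarrow> smooth_on S (\<lambda>x. f x + g x)"
  by (simp add: Ck_on_add smooth_on_def)

lemma Ck_on_sum:
  assumes "open S" "finite I" "\<And>i. i \<in> I \<Longrightarrow> Ck_on k S (f i)"
  shows "Ck_on k S (\<lambda>x. \<Sum>i\<in>I. f i x)"
  using assms(2,3,1) by (induction I rule: finite_induct) (simp_all add: Ck_on_const Ck_on_add)

lemma smooth_on_sum: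
  assumes "open S" "finite I" "\<And>i. i \<in> I \<Longrightarrow> smooth_on S (f i)"
  shows "smooth_on S (\<lambda>x. \<Sum>i\<in>I. f i x)"
  using assms by (simp add: smooth_on_def Ck_on_sum)

lemma linear_expand:
  fixes v :: "'a::euclidean_space"
  assumes "linear f" shows "f v = (\<Sum>b\<in>Basis. (v \<bullet> b) *\<^sub>R f b)"
  by (subst euclidean_representation[of v, symmetric])
    (simp only: linear_sum[OF assms] linear_cmul[OF assms])

text \<open>The chain rule produces a direction that varies with the point. Linearity in that
  direction turns it into a finite sum over \<open>Basis\<close>, where the induction hypothesis
  applies to the composites with the partial derivatives of \<open>g\<close>.\<close>

lemma Ck_on_compose:
  assumes "open S" "open T" "f ` S \<subseteq> T" "Ck_on k S f" "Ck_on k T g"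
  shows "Ck_on k S (\<lambda>x. g (f x))"
  using assms
proof (induction k arbitrary: g)
  case 0
  then show ?case using continuous_on_compose2 by auto
next
  case (Suc k)
  have "(g has_derivative D g (f x)) (at (f x))" if "x \<in> S" for x
    using Suc.prems(3) that by (intro Ck_on_has_derivative[OF Suc.prems(5)]) auto
  then have d: "((\<lambda>x. g (f x)) has_derivative (\<lambda>v. D g (f x) (D f x v))) (at x)"
      and l: "linear (D g (f x))" if "x \<in> S" for x
    using has_derivative_compose[OF Ck_on_has_derivative[OF Suc.prems(4)]] that has_derivative_linear
    by blast+
  show ?case
  proof (rule Ck_on_SucI[OF Suc.prems(1) d])
    fix v
    have "Ck_on k S (\<lambda>x. \<Sum>b\<in>Basis. (D f x v \<bullet> b) *\<^sub>R D g (f x) b)"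
    proof (intro Ck_on_sum Ck_on_scaleR Suc.prems(1) finite_Basis)
      fix b
      show "Ck_on k S (\<lambda>x. D f x v \<bullet> b)"
        by (rule Ck_on_bilinear[OF bounded_bilinear_inner])
          (use Suc.prems in \<open>auto simp: Ck_on_const\<close>)
      show "Ck_on k S (\<lambda>x. D g (f x) b)"
        using Suc.prems Ck_on_Suc_imp[OF Suc.prems(4)] by (intro Suc.IH) auto
    qed
    then show "Ck_on k S (\<lambda>x. D g (f x) (D f x v))"
      by (rule Ck_on_cong[OF Suc.prems(1), rotated]) (use linear_expand[OF l] in simp)
  qed
qed

lemma smooth_on_compose:
  "open S \<Longrightarrow> open T \<Longrightarrow> f ` S \<subseteq> T \<Longrightarrow> smooth_on S f \<Longrightarrow> smooth_on T g \<Longrightarrow>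
    smooth_on S (\<lambda>x. g (f x))"
  by (simp add: Ck_on_compose smooth_on_def)

lemma smooth_on_compose_linear:
  "open S \<Longrightarrow> bounded_linear g \<Longrightarrow> smooth_on S f \<Longrightarrow> smooth_on S (\<lambda>x. g (f x))"
  by (rule smooth_on_compose[where T=UNIV]) (auto simp: smooth_on_linear)

lemma smooth_on_uminus: "open S \<Longrightarrow> smooth_on S f \<Longrightarrow> smooth_on S (\<lambda>x. - f x)"
  by (rule smooth_on_compose_linear) (auto simp: bounded_linear_minus bounded_linear_ident)

lemma smooth_on_diff:
  assumes "open S" "smooth_on S f" "smooth_on S g" shows "smooth_on S (\<lambda>x. f x - g x)"
  using smooth_on_add[OF assms(1,2) smooth_on_uminus[OF assms(1,3)]] by simp

lemma smooth_on_Pair: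
  assumes "open S" "smooth_on S f" "smooth_on S g"
  shows "smooth_on S (\<lambda>x. (f x, g x))"
proof -
  have "bounded_linear (\<lambda>x. (x, 0::'c))" "bounded_linear (\<lambda>x. (0::'b, x))"
    by (auto intro!: bounded_linear_Pair bounded_linear_ident bounded_linear_zero)
  then have "smooth_on S (\<lambda>x. (f x, 0) + (0, g x))"
    using assms by (intro smooth_on_add) (auto intro: smooth_on_compose_linear)
  then show ?thesis by simp
qed

text \<open>The derivative of the reciprocal is a polynomial in the reciprocal and
  \<open>D f\<close>, so regularity bootstraps from one order to the next.\<close>

lemma smooth_on_inverse:
  fixes f :: "_ \<Rightarrow> 'b::{euclidean_space, real_normed_field}"
  assumes "open S" "smooth_on S f" "\<And>x. x \<in> S \<Longrightarrow> f x \<noteq> 0"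
  shows "smooth_on S (\<lambda>x. inverse (f x))"
proof -
  have "Ck_on k S (\<lambda>x. inverse (f x))" for k
  proof (induction k)
    case 0
    then show ?case
      using assms smooth_on_continuous by (auto intro!: continuous_on_inverse)
  next
    case (Suc k)
    have d: "((\<lambda>x. inverse (f x)) has_derivative
        (\<lambda>v. - (inverse (f x) * D f x v * inverse (f x)))) (at x)" if "x \<in> S" for x
      using Deriv.has_derivative_inverse[OF assms(3) smooth_on_has_derivative[OF assms(2)]] that by simp
    show ?case
    proof (rule Ck_on_SucI[OF assms(1) d])
      fix v
      have fv: "Ck_on k S (\<lambda>x. D f x v)"
        using assms(2) smooth_on_deriv smooth_on_def by blast
      have "Ck_on k S (\<lambda>x. (-1) *\<^sub>R (inverse (f x) * D f x v * inverse (f x)))"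
        by (intro Ck_on_scaleR assms Ck_on_const Ck_on_bilinear[OF bounded_bilinear_mult] fv Suc.IH)
      then show "Ck_on k S (\<lambda>x. - (inverse (f x) * D f x v * inverse (f x)))" by simp
    qed
  qed
  then show ?thesis by (simp add: smooth_on_def)
qed

lemma smooth_on_divide:
  fixes f g :: "_ \<Rightarrow> 'b::{euclidean_space, real_normed_field}"
  shows "open S \<Longrightarrow> smooth_on S f \<Longrightarrow> smooth_on S g \<Longrightarrow> (\<And>x. x \<in> S \<Longrightarrow> g x \<noteq> 0) \<Longrightarrow>
    smooth_on S (\<lambda>x. f x / g x)"
  by (simp add: divide_inverse smooth_on_inverse smooth_on_mult)

lemma smooth_on_sqrt:
  assumes "open S" "smooth_on S f" "\<And>x. x \<in> S \<Longrightarrow> f x > 0"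
  shows "smooth_on S (\<lambda>x. sqrt (f x))"
proof -
  have "Ck_on k S (\<lambda>x. sqrt (f x))" for k
  proof (induction k)
    case 0
    then show ?case
      using assms smooth_on_continuous by (auto intro!: continuous_on_real_sqrt)
  next
    case (Suc k)
    have d: "((\<lambda>x. sqrt (f x)) has_derivative
        (\<lambda>v. D f x v * ((1/2) * (inverse (f x) * sqrt (f x))))) (at x)" if "x \<in> S" for x
    proof -
      have "(sqrt has_real_derivative inverse (sqrt (f x)) / 2) (at (f x))"
        using DERIV_real_sqrt assms(3) that by blast
      from has_derivative_compose[OF smooth_on_has_derivative[OF assms(2) that]
          this[unfolded has_field_derivative_def]]
      have "((\<lambda>x. sqrt (f x)) has_derivative (\<lambda>v. inverse (sqrt (f x)) / 2 * D f x v)) (at x)" .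
      \<comment> \<open>The reciprocal root is rewritten so that the derivative contains the root
        itself, the form covered by the induction hypothesis.\<close>
      moreover have "inverse (sqrt (f x)) / 2 = (1/2) * (inverse (f x) * sqrt (f x))"
        using assms(3)[OF that] by (simp add: field_simps)
      ultimately show ?thesis by (simp only: mult.commute[of "1/2 * _"])
    qed
    show ?case
    proof (rule Ck_on_SucI[OF assms(1) d])
      fix v
      have fv: "Ck_on k S (\<lambda>x. D f x v)"
        using assms(2) smooth_on_deriv smooth_on_def by blast
      have "Ck_on k S (\<lambda>x. inverse (f x))"
        using assms smooth_on_inverse[OF assms(1,2)] by (force simp: smooth_on_def)
      then show "Ck_on k S (\<lambda>x. D f x v * ((1/2) * (inverse (f x) * sqrt (f x))))"
        by (intro Ck_on_bilinear[OF bounded_bilinear_mult] assms Ck_on_const fv Suc.IH)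
    qed
  qed
  then show ?thesis by (simp add: smooth_on_def)
qed

lemma smooth_on_norm:
  assumes "open S" "smooth_on S f" "\<And>x. x \<in> S \<Longrightarrow> f x \<noteq> 0"
  shows "smooth_on S (\<lambda>x. norm (f x))"
  unfolding norm_eq_sqrt_inner using assms by (intro smooth_on_sqrt smooth_on_inner) auto

lemma smooth_on_deriv_apply:
  assumes "open S" "smooth_on S f" "smooth_on S h"
  shows "smooth_on S (\<lambda>x. D f x (h x))"
proof -
  have "smooth_on S (\<lambda>x. \<Sum>b\<in>Basis. (h x \<bullet> b) *\<^sub>R D f x b)"
    using assms by (intro smooth_on_sum smooth_on_scaleR smooth_on_inner smooth_on_deriv) auto
  then show ?thesis
    by (rule smooth_on_cong[OF assms(1), rotated])
      (rule linear_expand[symmetric, OF has_derivative_linear[OF smooth_on_has_derivative[OF assms(2)]]])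
qed

lemma linear_D: "smooth_on S f \<Longrightarrow> x \<in> S \<Longrightarrow> linear (D f x)"
  using has_derivative_linear smooth_on_has_derivative by blast

lemma D_eqI: "(f has_derivative f') (at x) \<Longrightarrow> D f x v = f' v"
  using frechet_derivative_at by metis

lemma D_cong:
  assumes "open S" "x \<in> S" "\<And>y. y \<in> S \<Longrightarrow> f y = g y" "f differentiable (at x)"
  shows "D f x = D g x"
  using frechet_derivative_transform_within_open[OF assms(4,1,2,3)] by simp

subsection \<open>Symmetry of second derivatives\<close>

text \<open>The mean value theorem is applied in the direction \<open>h\<close> to the difference
  \<phi>, then in the direction \<open>k\<close> to \<open>D f x h\<close>. The second difference is
  symmetric in \<open>h\<close> and \<open>k\<close>, which is the source of the symmetry of mixed
  derivatives.\<close>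

lemma second_derivative_mean_value:
  fixes f :: "'a::euclidean_space \<Rightarrow> real"
  assumes f: "smooth_on (ball p e) f" and h: "norm h < e/2" and k: "norm k < e/2"
  obtains z where "norm (z - p) \<le> norm h + norm k"
    "f (p + h + k) - f (p + h) - f (p + k) + f p = D (\<lambda>x. D f x h) z k"
proof -
  have ball: "p + s *\<^sub>R h + t *\<^sub>R k \<in> ball p e" "norm (s *\<^sub>R h + t *\<^sub>R k) \<le> norm h + norm k"
    if "0 \<le> s" "s \<le> 1" "0 \<le> t" "t \<le> 1" for s t
  proof -
    have "norm (s *\<^sub>R h + t *\<^sub>R k) \<le> s * norm h + t * norm k"
      using norm_triangle_ineq[of "s *\<^sub>R h" "t *\<^sub>R k"] that by simp
    also have "\<dots> \<le> 1 * norm h + 1 * norm k"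
      using that by (intro add_mono mult_right_mono) auto
    finally show "norm (s *\<^sub>R h + t *\<^sub>R k) \<le> norm h + norm k" by simp
    moreover have "dist p (p + s *\<^sub>R h + t *\<^sub>R k) = norm (s *\<^sub>R h + t *\<^sub>R k)"
      by (simp add: dist_norm add.assoc) (metis norm_minus_cancel minus_add_distrib add_uminus_conv_diff)
    ultimately show "p + s *\<^sub>R h + t *\<^sub>R k \<in> ball p e"
      using h k by simp
  qed
  have l: "linear (D f x)" if "x \<in> ball p e" for x using linear_D[OF f that] .
  define \<phi> where "\<phi> s = f (p + s *\<^sub>R h + 1 *\<^sub>R k) - f (p + s *\<^sub>R h + 0 *\<^sub>R k)" for s
  have d\<phi>: "(\<phi> has_derivative (\<lambda>r. r * (D f (p + s *\<^sub>R h + 1 *\<^sub>R k) h - D f (p + s *\<^sub>R h + 0 *\<^sub>R k) h)))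
      (at s)" if "0 \<le> s" "s \<le> 1" for s
  proof -
    have "((\<lambda>s. f (p + s *\<^sub>R h + t *\<^sub>R k)) has_derivative (\<lambda>r. r * D f (p + s *\<^sub>R h + t *\<^sub>R k) h)) (at s)"
      if "t = 0 \<or> t = 1" for t
    proof -
      have b: "p + s *\<^sub>R h + t *\<^sub>R k \<in> ball p e"
        by (rule ball(1)) (use that \<open>0 \<le> s\<close> \<open>s \<le> 1\<close> in auto)
      have "((\<lambda>s. p + s *\<^sub>R h + t *\<^sub>R k) has_derivative (\<lambda>r. r *\<^sub>R h)) (at s)"
        by (auto intro!: derivative_eq_intros)
      from has_derivative_compose[OF this smooth_on_has_derivative[OF f b]]
      show ?thesis by (simp add: linear_cmul[OF l[OF b]])
    qed
    from has_derivative_diff[OF this[of 1] this[of 0]] show ?thesis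
      unfolding \<phi>_def by (simp add: algebra_simps)
  qed
  obtain s where s: "0 < s" "s < 1"
    "\<phi> 1 - \<phi> 0 = D f (p + s *\<^sub>R h + 1 *\<^sub>R k) h - D f (p + s *\<^sub>R h + 0 *\<^sub>R k) h"
  proof -
    have "\<exists>x\<in>{0<..<1}. \<phi> 1 - \<phi> 0 = (1 - 0) * (D f (p + x *\<^sub>R h + 1 *\<^sub>R k) h - D f (p + x *\<^sub>R h + 0 *\<^sub>R k) h)"
      by (rule mvt_simple[where f = \<phi>, OF _ has_derivative_at_withinI[OF d\<phi>]]) auto
    then show ?thesis using that by auto
  qed
  define g where "g = (\<lambda>x. D f x h)"
  have g: "smooth_on (ball p e) g"
    unfolding g_def using f by (rule smooth_on_deriv)
  have d: "((\<lambda>t. g (p + s *\<^sub>R h + t *\<^sub>R k)) has_derivative (\<lambda>r. r * D g (p + s *\<^sub>R h + t *\<^sub>R k) k)) (at t)"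
    if "0 \<le> t" "t \<le> 1" for t
  proof -
    have b: "p + s *\<^sub>R h + t *\<^sub>R k \<in> ball p e"
      by (rule ball(1)) (use that s in auto)
    have "((\<lambda>t. p + s *\<^sub>R h + t *\<^sub>R k) has_derivative (\<lambda>r. r *\<^sub>R k)) (at t)"
      by (auto intro!: derivative_eq_intros)
    from has_derivative_compose[OF this smooth_on_has_derivative[OF g b]]
    show ?thesis by (simp add: linear_cmul[OF linear_D[OF g b]])
  qed
  obtain t where t: "0 < t" "t < 1"
    "g (p + s *\<^sub>R h + 1 *\<^sub>R k) - g (p + s *\<^sub>R h + 0 *\<^sub>R k) = D g (p + s *\<^sub>R h + t *\<^sub>R k) k"
  proof -
    have "\<exists>x\<in>{0<..<1}. g (p + s *\<^sub>R h + 1 *\<^sub>R k) - g (p + s *\<^sub>R h + 0 *\<^sub>R k)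
        = (1 - 0) * D g (p + s *\<^sub>R h + x *\<^sub>R k) k"
      by (rule mvt_simple[where f = "\<lambda>t. g (p + s *\<^sub>R h + t *\<^sub>R k)", OF _ has_derivative_at_withinI[OF d]]) auto
    then show ?thesis using that by auto
  qed
  show ?thesis
  proof
    show "norm (p + s *\<^sub>R h + t *\<^sub>R k - p) \<le> norm h + norm k"
      using ball(2)[of s t] s t by (simp add: algebra_simps)
    show "f (p + h + k) - f (p + h) - f (p + k) + f p = D (\<lambda>x. D f x h) (p + s *\<^sub>R h + t *\<^sub>R k) k"
      using s(3) t(3) unfolding \<phi>_def g_def by simp
  qed
qed

lemma second_derivative_symmetric_real:
  fixes f :: "'a::euclidean_space \<Rightarrow> real"
  assumes "open S" "smooth_on S f" "p \<in> S"
  shows "D (\<lambda>x. D f x h) p k = D (\<lambda>x. D f x k) p h"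
proof (rule ccontr)
  assume ne: "D (\<lambda>x. D f x h) p k \<noteq> D (\<lambda>x. D f x k) p h" (is "?a \<noteq> ?b")
  obtain e where e: "e > 0" "ball p e \<subseteq> S" using assms openE by blast
  have f: "smooth_on (ball p e) f" using smooth_on_mono[OF assms(2) e(2)] .
  have l1: "linear (D f x)" and l2: "linear (D (\<lambda>x. D f x v) x)" if "x \<in> S" for x v
    using that assms(2) linear_D smooth_on_deriv by blast+
  define \<epsilon> where "\<epsilon> = \<bar>?a - ?b\<bar> / 2"
  have "\<epsilon> > 0" using ne by (simp add: \<epsilon>_def)
  have cont: "continuous_on S (\<lambda>x. D (\<lambda>x. D f x v) x w)" for v w
    using assms(2) by (intro smooth_on_continuous smooth_on_deriv)
  obtain d where d: "d > 0"
    "\<And>x. x \<in> S \<Longrightarrow> dist x p < d \<Longrightarrow> \<bar>D (\<lambda>x. D f x h) x k - ?a\<bar> < \<epsilon>"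
    "\<And>x. x \<in> S \<Longrightarrow> dist x p < d \<Longrightarrow> \<bar>D (\<lambda>x. D f x k) x h - ?b\<bar> < \<epsilon>"
  proof -
    obtain d1 where "d1 > 0" "\<And>x. x \<in> S \<Longrightarrow> dist x p < d1 \<Longrightarrow> \<bar>D (\<lambda>x. D f x h) x k - ?a\<bar> < \<epsilon>"
      using cont[of h k] \<open>\<epsilon> > 0\<close> assms(3) unfolding continuous_on_iff dist_real_def by meson
    moreover obtain d2 where "d2 > 0" "\<And>x. x \<in> S \<Longrightarrow> dist x p < d2 \<Longrightarrow> \<bar>D (\<lambda>x. D f x k) x h - ?b\<bar> < \<epsilon>"
      using cont[of k h] \<open>\<epsilon> > 0\<close> assms(3) unfolding continuous_on_iff dist_real_def by meson
    ultimately show ?thesis using that[of "min d1 d2"] by auto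
  qed
  \<comment> \<open>Scaling \<open>h\<close> and \<open>k\<close> by \<open>c\<close> keeps the
    points of the second difference within \<open>min d e / 2\<close> of \<open>p\<close>, hence in
    the ball and in the range where both mixed derivatives vary by less than \<epsilon>.\<close>
  define c where "c = min d e / (2 * (1 + norm h + norm k))"
  have pos: "1 + norm h + norm k > 0" by (simp add: add_pos_nonneg)
  have c: "c > 0" using d e pos by (simp add: c_def)
  have "c * (2 * (1 + norm h + norm k)) = min d e"
    using pos unfolding c_def by (intro nonzero_eq_divide_eq[THEN iffD1]) auto
  then have ce: "c * (1 + norm h + norm k) = min d e / 2" by (simp only: mult.left_commute)
  have ch: "c * norm h + c * norm k < min d e / 2"
    using ce c unfolding distrib_left by linarith
  have m: "min d e \<le> d" "min d e \<le> e" by auto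
  have nc: "norm (c *\<^sub>R v) = c * norm v" for v :: 'a using c by simp
  have n: "norm (c *\<^sub>R h) < e / 2" "norm (c *\<^sub>R k) < e/2"
    using ch m mult_nonneg_nonneg[OF less_imp_le[OF c] norm_ge_zero[of h]]
      mult_nonneg_nonneg[OF less_imp_le[OF c] norm_ge_zero[of k]]
    unfolding nc by linarith+
  obtain z where z: "norm (z - p) \<le> norm (c *\<^sub>R h) + norm (c *\<^sub>R k)"
    "f (p + c *\<^sub>R h + c *\<^sub>R k) - f (p + c *\<^sub>R h) - f (p + c *\<^sub>R k) + f p = D (\<lambda>x. D f x (c *\<^sub>R h)) z (c *\<^sub>R k)"
    by (rule second_derivative_mean_value[OF f n])
  obtain z' where z': "norm (z' - p) \<le> norm (c *\<^sub>R k) + norm (c *\<^sub>R h)"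
    "f (p + c *\<^sub>R k + c *\<^sub>R h) - f (p + c *\<^sub>R k) - f (p + c *\<^sub>R h) + f p = D (\<lambda>x. D f x (c *\<^sub>R k)) z' (c *\<^sub>R h)"
    by (rule second_derivative_mean_value[OF f n(2) n(1)])
  have "dist z p < min d e" "dist z' p < min d e"
    using z(1) z'(1) ch d e unfolding nc dist_norm by linarith+
  then have zz: "dist z p < d" "dist z' p < d" "z \<in> S" "z' \<in> S"
    using e by (auto simp: dist_commute subset_eq)
  have hom: "D (\<lambda>x. D f x (c *\<^sub>R v)) y (c *\<^sub>R w) = c * (c * D (\<lambda>x. D f x v) y w)" if "y \<in> S" for v w y
  proof -
    have "((\<lambda>x. c * D f x v) has_derivative (\<lambda>u. c * D (\<lambda>x. D f x v) y u)) (at y)"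
      by (intro has_derivative_mult_right smooth_on_has_derivative[OF smooth_on_deriv[OF assms(2)] that])
    then have "((\<lambda>x. D f x (c *\<^sub>R v)) has_derivative (\<lambda>u. c * D (\<lambda>x. D f x v) y u)) (at y)"
      by (rule has_derivative_transform_within_open[OF _ assms(1) that]) (simp add: linear_cmul[OF l1])
    then show ?thesis by (simp add: D_eqI linear_cmul[OF l2[OF that]])
  qed
  \<comment> \<open>One second difference is evaluated in both orders; after cancelling
    \<open>c * c\<close> the two mixed derivatives agree at points near \<open>p\<close>.\<close>
  have "p + c *\<^sub>R h + c *\<^sub>R k = p + c *\<^sub>R k + c *\<^sub>R h" by (simp add: ac_simps)
  then have "c * (c * D (\<lambda>x. D f x h) z k) = c * (c * D (\<lambda>x. D f x k) z' h)"
    using z(2) z'(2) unfolding hom[OF zz(3)] hom[OF zz(4)] by (smt (verit))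
  then have "D (\<lambda>x. D f x h) z k = D (\<lambda>x. D f x k) z' h" using c by simp
  then show False using d(2)[OF zz(3,1)] d(3)[OF zz(4,2)] unfolding \<epsilon>_def by (smt (verit) field_sum_of_halves)
qed

lemma D_inner_const:
  assumes "smooth_on S f" "x \<in> S"
  shows "D (\<lambda>x. f x \<bullet> c) x v = D f x v \<bullet> c"
  by (rule D_eqI) (intro has_derivative_inner_left smooth_on_has_derivative[OF assms])

lemma second_derivative_symmetric:
  fixes f :: "'a::euclidean_space \<Rightarrow> 'b::euclidean_space"
  assumes "open S" "smooth_on S f" "p \<in> S"
  shows "D (\<lambda>x. D f x h) p k = D (\<lambda>x. D f x k) p h"
proof (rule euclidean_eqI)
  fix b :: 'b
  have s: "smooth_on S (\<lambda>x. f x \<bullet> b)" using assms by (intro smooth_on_inner) auto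
  have "D (\<lambda>x. D f x v) p w \<bullet> b = D (\<lambda>x. D (\<lambda>x. f x \<bullet> b) x v) p w" for v w
  proof -
    have "D (\<lambda>x. D f x v) p w \<bullet> b = D (\<lambda>x. D f x v \<bullet> b) p w"
      using D_inner_const[OF smooth_on_deriv[OF assms(2)] assms(3)] by simp
    also have "\<dots> = D (\<lambda>x. D (\<lambda>x. f x \<bullet> b) x v) p w"
    proof -
      have "smooth_on S (\<lambda>x. D f x v \<bullet> b)"
        using assms by (intro smooth_on_inner smooth_on_deriv) auto
      then have "(\<lambda>x. D f x v \<bullet> b) differentiable (at p)"
        using assms(3) smooth_on_has_derivative differentiableI by blast
      then show ?thesis
        using D_cong[OF assms(1,3), of "\<lambda>x. D f x v \<bullet> b" "\<lambda>x. D (\<lambda>x. f x \<bullet> b) x v"]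
          D_inner_const[OF assms(2)] by simp
    qed
    finally show ?thesis .
  qed
  then show "D (\<lambda>x. D f x h) p k \<bullet> b = D (\<lambda>x. D f x k) p h \<bullet> b"
    using second_derivative_symmetric_real[OF assms(1) s assms(3)] by simp
qed

subsection \<open>The inverse function theorem for smooth maps\<close>

text \<open>A product rule with one factor merely continuous, which suffices because the other
  factor vanishes at the point. It serves to differentiate the inverse derivative in the inverse
  function theorem, where only continuity is known beforehand.\<close>

lemma has_derivative_scaleR_vanishing:
  fixes \<phi> :: "'a::real_normed_vector \<Rightarrow> real" and \<psi> :: "'a \<Rightarrow> 'b::real_normed_vector"
  assumes "(\<phi> has_derivative \<phi>') (at x)" "\<phi> x = 0" "continuous (at x) \<psi>"
  shows "((\<lambda>y. \<phi> y *\<^sub>R \<psi> y) has_derivative (\<lambda>v. \<phi>' v *\<^sub>R \<psi> x)) (at x)"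
proof -
  have bl: "bounded_linear \<phi>'" using assms(1) has_derivative_bounded_linear by blast
  then obtain K where K: "\<And>v. \<bar>\<phi>' v\<bar> \<le> norm v * K"
    using bounded_linear.bounded by (metis real_norm_def)
  have lim: "((\<lambda>y. norm (\<phi> y - \<phi> x - \<phi>' (y - x)) / norm (y - x)) \<longlongrightarrow> 0) (at x)"
    using assms(1) has_derivative_at_within by (auto simp: has_derivative_iff_norm)
  have lim\<psi>: "((\<lambda>y. norm (\<psi> y - \<psi> x)) \<longlongrightarrow> 0) (at x)"
    using assms(3) by (simp add: continuous_at tendsto_norm_zero_iff LIM_zero_iff)
  have lim\<psi>': "((\<lambda>y. norm (\<psi> y)) \<longlongrightarrow> norm (\<psi> x)) (at x)"
    using assms(3) by (simp add: continuous_at tendsto_norm)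
  have "((\<lambda>y. norm (\<phi> y - \<phi> x - \<phi>' (y - x)) / norm (y - x) * norm (\<psi> y) +
      \<bar>K\<bar> * norm (\<psi> y - \<psi> x)) \<longlongrightarrow> 0 * norm (\<psi> x) + \<bar>K\<bar> * 0) (at x)"
    by (intro tendsto_intros lim lim\<psi> lim\<psi>')
  then have L: "((\<lambda>y. norm (\<phi> y - \<phi> x - \<phi>' (y - x)) / norm (y - x) * norm (\<psi> y) +
      \<bar>K\<bar> * norm (\<psi> y - \<psi> x)) \<longlongrightarrow> 0) (at x)" by simp
  have bd: "norm (norm (\<phi> y *\<^sub>R \<psi> y - \<phi> x *\<^sub>R \<psi> x - \<phi>' (y - x) *\<^sub>R \<psi> x) / norm (y - x))
      \<le> norm (\<phi> y - \<phi> x - \<phi>' (y - x)) / norm (y - x) * norm (\<psi> y) + \<bar>K\<bar> * norm (\<psi> y - \<psi> x)"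
    if "y \<noteq> x" for y
  proof -
    have "\<phi> y *\<^sub>R \<psi> y - \<phi> x *\<^sub>R \<psi> x - \<phi>' (y - x) *\<^sub>R \<psi> x
        = (\<phi> y - \<phi> x - \<phi>' (y - x)) *\<^sub>R \<psi> y + \<phi>' (y - x) *\<^sub>R (\<psi> y - \<psi> x)"
      using assms(2) by (simp add: algebra_simps)
    then have "norm (\<phi> y *\<^sub>R \<psi> y - \<phi> x *\<^sub>R \<psi> x - \<phi>' (y - x) *\<^sub>R \<psi> x)
        \<le> norm (\<phi> y - \<phi> x - \<phi>' (y - x)) * norm (\<psi> y) + \<bar>\<phi>' (y - x)\<bar> * norm (\<psi> y - \<psi> x)"
      by (metis norm_scaleR norm_triangle_ineq real_norm_def)
    also have "\<dots> \<le> norm (\<phi> y - \<phi> x - \<phi>' (y - x)) * norm (\<psi> y) +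
        (norm (y - x) * \<bar>K\<bar>) * norm (\<psi> y - \<psi> x)"
      using order_trans[OF K[of "y - x"] mult_left_mono[OF abs_ge_self[of K]]]
      by (intro add_left_mono mult_right_mono) auto
    finally show ?thesis
      using that by (simp add: field_simps)
  qed
  have "((\<lambda>y. norm (\<phi> y *\<^sub>R \<psi> y - \<phi> x *\<^sub>R \<psi> x - \<phi>' (y - x) *\<^sub>R \<psi> x) / norm (y - x)) \<longlongrightarrow> 0) (at x)"
    by (rule Lim_null_comparison[OF _ L]) (use bd in \<open>auto simp: eventually_at_filter\<close>)
  then show ?thesis
    using bl by (simp add: has_derivative_iff_norm bounded_linear_scaleR_const)
qed

text \<open>The inverse \<open>g\<close> has derivative \<open>A y\<close>, the inverse of
  \<open>B y = D f (g y)\<close>. Continuity of \<open>A\<close> comes from a lower bound for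
  \<open>B\<close>. If \<open>g\<close> is of class \<open>k\<close>, then so is \<open>B\<close>,
  hence \<open>A\<close> by the resolvent identity, and the order of \<open>g\<close> rises by
  one.\<close>

lemma smooth_inverse_function:
  fixes f :: "'a::euclidean_space \<Rightarrow> 'a"
  assumes S: "open S" and f: "smooth_on S f" and x0: "x0 \<in> S" and inj: "inj (D f x0)"
  obtains U V g where "open U" "U \<subseteq> S" "x0 \<in> U" "open V" "f x0 \<in> V" "homeomorphism U V f g"
    "smooth_on V g"
proof -
  define f' where "f' x = Blinfun (D f x)" for x
  have f': "blinfun_apply (f' x) = D f x" if "x \<in> S" for x
    unfolding f'_def
    using smooth_on_has_derivative[OF f that] has_derivative_bounded_linear bounded_linear_Blinfun_apply
    by blast
  have cf': "continuous_on S f'"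
  proof (rule continuous_on_blinfun_componentwise)
    fix i :: 'a assume "i \<in> Basis"
    show "continuous_on S (\<lambda>x. blinfun_apply (f' x) i)"
      using smooth_on_continuous[OF smooth_on_deriv[OF f, of i]] f' by (simp cong: continuous_on_cong)
  qed
  obtain h where h: "linear h" "h \<circ> D f x0 = id"
    using linear_injective_left_inverse[OF linear_D[OF f x0] inj] by blast
  have "Blinfun h o\<^sub>L f' x0 = id_blinfun"
    using h f'[OF x0] by (intro blinfun_eqI)
      (simp add: bounded_linear_Blinfun_apply linear_conv_bounded_linear fun_eq_iff)
  then obtain U V g A where g: "open U" "U \<subseteq> S" "x0 \<in> U" "open V" "f x0 \<in> V" "homeomorphism U V f g"
    "\<And>y. y \<in> V \<Longrightarrow> (g has_derivative (A y)) (at y)"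
    "\<And>y. y \<in> V \<Longrightarrow> A y = inv_into UNIV (blinfun_apply (f'(g y)))"
    "\<And>y. y \<in> V \<Longrightarrow> bij (blinfun_apply (f'(g y)))"
    using inverse_function_theorem[OF S _ cf' x0, of f "Blinfun h"] f' smooth_on_has_derivative[OF f]
    by (metis (no_types, lifting))
  have gV: "g y \<in> S" if "y \<in> V" for y using g(2,6) that by (auto simp: homeomorphism_def)
  have cg: "continuous_on V g" using g(6) by (simp add: homeomorphism_def)
  define B where "B y = D f (g y)" for y
  have AB: "B y (A y v) = v" "A y (B y v) = v" if "y \<in> V" for y v
    using g(8,9)[OF that] f'[OF gV[OF that]] unfolding B_def
    by (metis bij_inv_eq_iff, metis bij_inv_eq_iff)
  have linA: "linear (A y)" if "y \<in> V" for y using g(7)[OF that] has_derivative_linear by blast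
  have linB: "linear (B y)" if "y \<in> V" for y unfolding B_def using linear_D[OF f gV[OF that]] .
  \<comment> \<open>Resolvent identity: a difference of inverses is expressed by the difference of
    the original maps. It yields first the continuity and then the derivative of
    \<open>A\<close>.\<close>
  have diffA: "A y v - A y0 v = A y (B y0 (A y0 v) - B y (A y0 v))" if "y \<in> V" "y0 \<in> V" for y y0 v
    using that by (simp add: linear_diff[OF linA[OF that(1)]] AB)
  have contA: "continuous_on V (\<lambda>y. A y v)" for v
  proof -
    have "continuous (at y0) (\<lambda>y. A y v)" if y0: "y0 \<in> V" for y0
    proof -
      have "inj (B y0)" using AB(2)[OF y0] by (metis injI)
      then obtain m where m: "m > 0" "\<And>u. m * norm u \<le> norm (B y0 u)"
        using linear_inj_bounded_below_pos[OF linB[OF y0]] by blast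
      have "continuous_on V (\<lambda>y. f' (g y))"
        using continuous_on_compose2[OF cf' cg] gV by blast
      then have "isCont (\<lambda>y. f' (g y)) y0"
        using y0 g(4) by (simp add: continuous_on_eq_continuous_at)
      then have ev: "\<forall>\<^sub>F y in at y0. dist (f' (g y)) (f' (g y0)) < m / 2"
        using m(1) unfolding continuous_at by (intro tendstoD) auto
      have evV: "\<forall>\<^sub>F y in at y0. y \<in> V"
        using g(4) y0 by (simp add: eventually_at_in_open')
      define u where "u = A y0 v"
      \<comment> \<open>\<open>B y0\<close> is bounded below by \<open>m\<close>, so every
        \<open>B y\<close> within \<open>m / 2\<close> of it is bounded below by
        \<open>m / 2\<close>; hence the factor \<open>2 / m\<close>.\<close>
      have bnd: "norm (A y v - A y0 v) \<le> (2 / m) * norm (B y0 u - B y u)"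
        if y: "y \<in> V" and d: "dist (f' (g y)) (f' (g y0)) < m / 2" for y
      proof -
        define w where "w = A y v - A y0 v"
        have w: "B y w = B y0 u - B y u"
          unfolding w_def u_def diffA[OF y y0] AB(1)[OF y] ..
        have "norm (B y w - B y0 w) = norm (blinfun_apply (f' (g y) - f' (g y0)) w)"
          using f'[OF gV[OF y]] f'[OF gV[OF y0]] by (simp add: B_def minus_blinfun.rep_eq)
        also have "\<dots> \<le> (m / 2) * norm w"
          using d unfolding dist_norm
          by (intro order_trans[OF norm_blinfun] mult_right_mono less_imp_le norm_ge_zero)
        finally have "norm (B y w) \<ge> m * norm w - (m / 2) * norm w"
          using m(2)[of w] norm_triangle_ineq4[of "B y w" "B y w - B y0 w"] by simp
        then have "m * norm w \<le> 2 * norm (B y w)" by simp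
        then show ?thesis unfolding w[symmetric] w_def[symmetric]
          using m(1) by (simp add: field_simps)
      qed
      have "\<forall>\<^sub>F y in at y0. norm (A y v - A y0 v) \<le> (2 / m) * norm (B y0 u - B y u)"
        using ev evV by eventually_elim (rule bnd)
      moreover have "((\<lambda>y. (2 / m) * norm (B y0 u - B y u)) \<longlongrightarrow> (2 / m) * norm (B y0 u - B y0 u)) (at y0)"
      proof -
        have "continuous_on V (\<lambda>y. B y u)"
          unfolding B_def using continuous_on_compose2[OF smooth_on_continuous[OF smooth_on_deriv[OF f]] cg] gV
          by blast
        then have "((\<lambda>y. B y u) \<longlongrightarrow> B y0 u) (at y0)"
          using y0 g(4) by (simp add: continuous_on_eq_continuous_at isCont_def)
        then show ?thesis by (intro tendsto_intros)
      qed
      ultimately have "((\<lambda>y. A y v - A y0 v) \<longlongrightarrow> 0) (at y0)"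
        using Lim_null_comparison by force
      then show ?thesis by (simp add: continuous_at LIM_zero_iff)
    qed
    then show ?thesis by (simp add: continuous_at_imp_continuous_on)
  qed
  have derA: "((\<lambda>y. A y v) has_derivative
      (\<lambda>w. \<Sum>b\<in>Basis. (- (D (\<lambda>y. B y (A y0 v)) y0 w \<bullet> b)) *\<^sub>R A y0 b)) (at y0)"
    if y0: "y0 \<in> V" and B: "\<And>u. (\<lambda>y. B y u) differentiable (at y0)" for v y0
  proof -
    define u where "u = A y0 v"
    have "((\<lambda>y. (B y0 u - B y u) \<bullet> b) has_derivative (\<lambda>w. - (D (\<lambda>y. B y u) y0 w \<bullet> b))) (at y0)" for b
      using B[of u] by (auto intro!: derivative_eq_intros simp: frechet_derivative_works)
    then have "((\<lambda>y. ((B y0 u - B y u) \<bullet> b) *\<^sub>R A y b) has_derivative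
        (\<lambda>w. (- (D (\<lambda>y. B y u) y0 w \<bullet> b)) *\<^sub>R A y0 b)) (at y0)" for b
      by (rule has_derivative_scaleR_vanishing)
        (use contA[of b] y0 g(4) in \<open>auto simp: continuous_on_eq_continuous_at\<close>)
    then have "((\<lambda>y. A y0 v + (\<Sum>b\<in>Basis. ((B y0 u - B y u) \<bullet> b) *\<^sub>R A y b)) has_derivative
        (\<lambda>w. 0 + (\<Sum>b\<in>Basis. (- (D (\<lambda>y. B y u) y0 w \<bullet> b)) *\<^sub>R A y0 b))) (at y0)"
      by (intro has_derivative_add has_derivative_const has_derivative_sum)
    then have d: "((\<lambda>y. A y0 v + (\<Sum>b\<in>Basis. ((B y0 u - B y u) \<bullet> b) *\<^sub>R A y b)) has_derivative
        (\<lambda>w. \<Sum>b\<in>Basis. (- (D (\<lambda>y. B y u) y0 w \<bullet> b)) *\<^sub>R A y0 b)) (at y0)"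
      by simp
    show ?thesis
      unfolding u_def[symmetric]
    proof (rule has_derivative_transform_within_open[OF d g(4) y0])
      fix y assume y: "y \<in> V"
      show "A y0 v + (\<Sum>b\<in>Basis. ((B y0 u - B y u) \<bullet> b) *\<^sub>R A y b) = A y v"
        using diffA[OF y y0, of v] linear_expand[OF linA[OF y], of "B y0 u - B y u"]
        unfolding u_def[symmetric] by (metis add.commute diff_add_cancel)
    qed
  qed
  \<comment> \<open>With \<open>g\<close> fixed, the order \<open>j\<close> climbs up to
    \<open>k\<close>: the derivative of \<open>A\<close> is a polynomial in values of
    \<open>A\<close> and first derivatives of \<open>B\<close>, and \<open>B\<close> is of class
    \<open>k\<close>.\<close>
  have CkA: "Ck_on j V (\<lambda>y. A y v)" if "Ck_on k V g" "j \<le> k" for j k v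
    using that(2)
  proof (induction j arbitrary: v)
    case 0
    then show ?case using contA by simp
  next
    case (Suc j)
    have BC: "Ck_on k V (\<lambda>y. B y u)" for u
      unfolding B_def
      by (rule Ck_on_compose[OF g(4) S _ that(1)])
        (use gV smooth_on_deriv[OF f] in \<open>auto simp: smooth_on_def\<close>)
    have BS: "Ck_on (Suc j) V (\<lambda>y. B y u)" for u
    proof -
      have "Ck_on (k - n) V (\<lambda>y. B y u)" if "n \<le> k" for n
        using that
      proof (induction n)
        case (Suc n)
        then have "k - n = Suc (k - Suc n)" by simp
        then show ?case using Suc Ck_on_Suc_imp by (metis Suc_leD)
      qed (use BC in simp)
      from this[of "k - Suc j"] Suc.prems show ?thesis by simp
    qed
    have Bd: "(\<lambda>y. B y u) differentiable (at y0)" if "y0 \<in> V" for y0 u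
      using BS[of u] that by simp
    have jk: "j \<le> k" using Suc.prems by simp
    show ?case
    proof (rule Ck_on_SucI[OF g(4) derA[OF _ Bd]])
      fix w
      have eq: "D (\<lambda>y. B y (A y0 v)) y0 w = (\<Sum>c\<in>Basis. (A y0 v \<bullet> c) *\<^sub>R D (\<lambda>y. B y c) y0 w)"
        if "y0 \<in> V" for y0
      proof -
        have "((\<lambda>y. \<Sum>c\<in>Basis. (A y0 v \<bullet> c) *\<^sub>R B y c) has_derivative
            (\<lambda>w. \<Sum>c\<in>Basis. (A y0 v \<bullet> c) *\<^sub>R D (\<lambda>y. B y c) y0 w)) (at y0)"
          using Bd[OF that] by (intro has_derivative_sum has_derivative_scaleR_right)
            (simp add: frechet_derivative_works)
        then have "((\<lambda>y. B y (A y0 v)) has_derivative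
            (\<lambda>w. \<Sum>c\<in>Basis. (A y0 v \<bullet> c) *\<^sub>R D (\<lambda>y. B y c) y0 w)) (at y0)"
          by (rule has_derivative_transform_within_open[OF _ g(4) that])
            (use linear_expand[OF linB] in metis)
        then show ?thesis by (rule D_eqI)
      qed
      have "Ck_on j V (\<lambda>y0. \<Sum>b\<in>Basis. ((-1) *\<^sub>R (\<Sum>c\<in>Basis. (A y0 v \<bullet> c) *\<^sub>R D (\<lambda>y. B y c) y0 w) \<bullet> b) *\<^sub>R A y0 b)"
        using BS Suc.IH[OF jk] g(4)
        by (intro Ck_on_sum Ck_on_scaleR Ck_on_bilinear[OF bounded_bilinear_inner] Ck_on_const finite_Basis) auto
      then show "Ck_on j V (\<lambda>y0. \<Sum>b\<in>Basis. (- (D (\<lambda>y. B y (A y0 v)) y0 w \<bullet> b)) *\<^sub>R A y0 b)"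
        by (rule Ck_on_cong[OF g(4), rotated]) (simp add: eq inner_sum_left)
    qed
  qed
  have "Ck_on k V g" for k
  proof (induction k)
    case 0
    then show ?case using cg by simp
  next
    case (Suc k)
    show ?case by (rule Ck_on_SucI[OF g(4) g(7)]) (use CkA[OF Suc] in auto)
  qed
  then show ?thesis using that g(1-6) by (simp add: smooth_on_def)
qed

lemma linear_D2:
  fixes f :: "'a::euclidean_space \<Rightarrow> 'b::euclidean_space"
  assumes S: "open S" and f: "smooth_on S f" and q: "q \<in> S"
  shows "linear (\<lambda>v. D (\<lambda>x. D f x v) q h)"
proof (rule linearI)
  fix v w :: 'a and c :: real
  have d: "((\<lambda>x. D f x v) has_derivative D (\<lambda>x. D f x v) q) (at q)" for v
    by (rule smooth_on_has_derivative[OF smooth_on_deriv[OF f] q])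
  have "((\<lambda>x. D f x (v + w)) has_derivative (\<lambda>h. D (\<lambda>x. D f x v) q h + D (\<lambda>x. D f x w) q h)) (at q)"
    by (rule has_derivative_transform_within_open[OF has_derivative_add[OF d d] S q])
      (simp add: linear_add[OF linear_D[OF f]])
  then show "D (\<lambda>x. D f x (v + w)) q h = D (\<lambda>x. D f x v) q h + D (\<lambda>x. D f x w) q h"
    by (rule D_eqI)
  have "((\<lambda>x. D f x (c *\<^sub>R v)) has_derivative (\<lambda>h. c *\<^sub>R D (\<lambda>x. D f x v) q h)) (at q)"
    by (rule has_derivative_transform_within_open[OF has_derivative_scaleR_right[OF d] S q])
      (simp add: linear_cmul[OF linear_D[OF f]])
  then show "D (\<lambda>x. D f x (c *\<^sub>R v)) q h = c *\<^sub>R D (\<lambda>x. D f x v) q h"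
    by (rule D_eqI)
qed

text \<open>Product rule for a direction that moves with the point, needed for tangent fields
  written as \<open>D f x (\<beta> x)\<close>. The two terms are a second derivative of
  \<open>f\<close> and a vector tangent to the image.\<close>

lemma has_derivative_D_apply:
  fixes f :: "'a::euclidean_space \<Rightarrow> 'b::euclidean_space"
  assumes S: "open S" and f: "smooth_on S f" and q: "q \<in> S" and \<beta>: "(\<beta> has_derivative \<beta>') (at q)"
  shows "((\<lambda>x. D f x (\<beta> x)) has_derivative (\<lambda>h. D (\<lambda>x. D f x (\<beta> q)) q h + D f q (\<beta>' h))) (at q)"
proof -
  have "((\<lambda>x. \<Sum>b\<in>Basis. (\<beta> x \<bullet> b) *\<^sub>R D f x b) has_derivative
      (\<lambda>h. \<Sum>b\<in>Basis. ((\<beta> q \<bullet> b) *\<^sub>R D (\<lambda>x. D f x b) q h + (\<beta>' h \<bullet> b) *\<^sub>R D f q b))) (at q)"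
    by (intro has_derivative_sum has_derivative_scaleR has_derivative_inner_left \<beta>
        smooth_on_has_derivative[OF smooth_on_deriv[OF f] q])
  also have "(\<lambda>h. \<Sum>b\<in>Basis. ((\<beta> q \<bullet> b) *\<^sub>R D (\<lambda>x. D f x b) q h + (\<beta>' h \<bullet> b) *\<^sub>R D f q b))
      = (\<lambda>h. D (\<lambda>x. D f x (\<beta> q)) q h + D f q (\<beta>' h))"
  proof
    fix h
    show "(\<Sum>b\<in>Basis. ((\<beta> q \<bullet> b) *\<^sub>R D (\<lambda>x. D f x b) q h + (\<beta>' h \<bullet> b) *\<^sub>R D f q b))
        = D (\<lambda>x. D f x (\<beta> q)) q h + D f q (\<beta>' h)"
      using linear_expand[OF linear_D2[OF assms(1-3), of h], of "\<beta> q"]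
        linear_expand[OF linear_D[OF f q], of "\<beta>' h"]
      by (simp only: sum.distrib)
  qed
  finally show ?thesis
    by (rule has_derivative_transform_within_open[OF _ S q])
      (rule linear_expand[OF linear_D[OF f], symmetric])
qed

subsection \<open>Parametrized charts of submanifolds\<close>

text \<open>A parametrization together with a smooth left inverse on an open subset of the ambient space;
  unlike a slice chart it involves no choice of a complement.\<close>

definition chart :: "'a::euclidean_space set \<Rightarrow> 'p::euclidean_space set \<Rightarrow> ('p \<Rightarrow> 'a) \<Rightarrow> 'a set \<Rightarrow>
    ('a \<Rightarrow> 'p) \<Rightarrow> bool" where
  "chart M P f N \<kappa> \<longleftrightarrow> open P \<and> open N \<and> smooth_on P f \<and> smooth_on N \<kappa> \<and> f ` P = M \<inter> N \<and>
     (\<forall>q\<in>P. \<kappa> (f q) = q)"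

lemma chartD:
  assumes "chart M P f N \<kappa>"
  shows "open P" "open N" "smooth_on P f" "smooth_on N \<kappa>" "f ` P = M \<inter> N"
    "\<And>q. q \<in> P \<Longrightarrow> \<kappa> (f q) = q" "\<And>q. q \<in> P \<Longrightarrow> f q \<in> M" "\<And>q. q \<in> P \<Longrightarrow> f q \<in> N"
    "\<And>x. x \<in> M \<Longrightarrow> x \<in> N \<Longrightarrow> \<kappa> x \<in> P" "\<And>x. x \<in> M \<Longrightarrow> x \<in> N \<Longrightarrow> f (\<kappa> x) = x"
proof -
  show *: "open P" "open N" "smooth_on P f" "smooth_on N \<kappa>" "f ` P = M \<inter> N"
    "\<And>q. q \<in> P \<Longrightarrow> \<kappa> (f q) = q"
    using assms by (auto simp: chart_def)
  then show "\<And>q. q \<in> P \<Longrightarrow> f q \<in> M" "\<And>q. q \<in> P \<Longrightarrow> f q \<in> N" by blast+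
  fix x assume "x \<in> M" "x \<in> N"
  then obtain q where "q \<in> P" "x = f q" using *(5) by blast
  then show "\<kappa> x \<in> P" "f (\<kappa> x) = x" using *(6) by auto
qed

lemma open_vimage_Int:
  assumes "open S" "continuous_on S f" "open T" shows "open {x \<in> S. f x \<in> T}"
  using continuous_open_preimage[OF assms(2,1,3)] by (simp add: vimage_def Int_def)

lemma chart_restrict:
  assumes c: "chart M P f N \<kappa>" and P': "open P'" "P' \<subseteq> P"
  shows "chart M P' f {x \<in> N. \<kappa> x \<in> P'} \<kappa>"
  unfolding chart_def
proof (intro conjI)
  show "open {x \<in> N. \<kappa> x \<in> P'}"
    using c P' by (intro open_vimage_Int) (auto dest: chartD smooth_on_continuous)
  show "f ` P' = M \<inter> {x \<in> N. \<kappa> x \<in> P'}"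
    using chartD(6-10)[OF c] P'(2) by (force simp: image_iff)
qed (use chartD[OF c] P' in \<open>auto intro: smooth_on_mono\<close>)

lemma chart_openin:
  assumes c: "chart M P f N \<kappa>" and P': "open P'" "P' \<subseteq> P"
  shows "openin (top_of_set M) (f ` P')"
  using chartD(2,5)[OF chart_restrict[OF assms]] by (auto simp: openin_open)

text \<open>A linear isomorphism \<iota> from the parameter type onto the slice subspace and a
  linear left inverse \<open>h\<close> turn the slice chart into a parametrization with left inverse
  \<open>h (\<phi> x)\<close>.\<close>

lemma submanifold_imp_chart:
  fixes M :: "'a::euclidean_space set"
  assumes M: "smooth_submanifold DIM('p::euclidean_space) M" and p: "p \<in> M"
  obtains P N and f :: "'p::euclidean_space \<Rightarrow> 'a" and \<kappa> where "chart M P f N \<kappa>" "p \<in> N"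
proof -
  obtain U and V :: "'a set" and \<phi> \<psi> S where "open U \<and> p \<in> U \<and> open V \<and> homeomorphism U V \<phi> \<psi> \<and>
      smooth_on U \<phi> \<and> smooth_on V \<psi> \<and> subspace S \<and> dim S = DIM('p) \<and> \<phi> ` (U \<inter> M) = V \<inter> S"
    using bspec[OF M[unfolded smooth_submanifold_def] p] by (elim exE) (rule that)
  then have *: "open U" "p \<in> U" "open V" "homeomorphism U V \<phi> \<psi>"
    "smooth_on U \<phi>" "smooth_on V \<psi>" "subspace S" "dim S = DIM('p)" "\<phi> ` (U \<inter> M) = V \<inter> S"
    by simp_all
  obtain \<iota> :: "'p \<Rightarrow> 'a" where \<iota>: "linear \<iota>" "range \<iota> = S" "inj \<iota>"
    using subspace_isomorphism[of "UNIV :: 'p set" S] * by auto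
  obtain h where h: "linear h" "h \<circ> \<iota> = id" using linear_injective_left_inverse[OF \<iota>(1,3)] by blast
  then have h': "h (\<iota> q) = q" for q by (metis comp_apply id_apply)
  have bl: "bounded_linear \<iota>" "bounded_linear h" using \<iota> h by (simp_all add: linear_conv_bounded_linear)
  have hom: "\<And>x. x \<in> U \<Longrightarrow> \<psi> (\<phi> x) = x" "\<And>y. y \<in> V \<Longrightarrow> \<phi> (\<psi> y) = y" "\<phi> ` U = V" "\<psi> ` V = U"
    "continuous_on U \<phi>"
    using *(4) by (auto simp: homeomorphism_def)
  have S1: "\<phi> x \<in> V" "\<phi> x \<in> range \<iota>" if "x \<in> U" "x \<in> M" for x
    using that *(9) \<iota>(2) by auto
  have S2: "\<psi> (\<iota> q) \<in> U" "\<psi> (\<iota> q) \<in> M" if "\<iota> q \<in> V" for q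
  proof -
    have "\<iota> q \<in> \<phi> ` (U \<inter> M)" using that *(9) \<iota>(2) by auto
    then obtain x where "x \<in> U" "x \<in> M" "\<iota> q = \<phi> x" by auto
    then show "\<psi> (\<iota> q) \<in> U" "\<psi> (\<iota> q) \<in> M" using hom(1) by auto
  qed
  show ?thesis
  proof
    show "chart M {q. \<iota> q \<in> V} (\<lambda>q. \<psi> (\<iota> q)) {x \<in> U. \<iota> (h (\<phi> x)) \<in> V} (\<lambda>x. h (\<phi> x))"
      unfolding chart_def
    proof (intro conjI)
      show o: "open {q. \<iota> q \<in> V}"
        using open_vimage_Int[OF open_UNIV linear_continuous_on[OF bl(1)] *(3)] by simp
      show N: "open {x \<in> U. \<iota> (h (\<phi> x)) \<in> V}"
        by (rule open_vimage_Int[OF *(1) _ *(3)])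
          (intro linear_continuous_on_compose[OF _ \<iota>(1)] linear_continuous_on_compose[OF _ h(1)] hom(5))
      show "smooth_on {q. \<iota> q \<in> V} (\<lambda>q. \<psi> (\<iota> q))"
        by (rule smooth_on_compose[OF o *(3) _ smooth_on_linear[OF bl(1)] *(6)]) auto
      show "smooth_on {x \<in> U. \<iota> (h (\<phi> x)) \<in> V} (\<lambda>x. h (\<phi> x))"
        using smooth_on_compose_linear[OF N bl(2) smooth_on_mono[OF *(5)]] by auto
      show "(\<lambda>q. \<psi> (\<iota> q)) ` {q. \<iota> q \<in> V} = M \<inter> {x \<in> U. \<iota> (h (\<phi> x)) \<in> V}"
      proof (intro equalityI subsetI)
        fix x assume "x \<in> M \<inter> {x \<in> U. \<iota> (h (\<phi> x)) \<in> V}"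
        then have x: "x \<in> U" "x \<in> M" by auto
        then obtain q where "\<phi> x = \<iota> q" using S1(2) by blast
        then show "x \<in> (\<lambda>q. \<psi> (\<iota> q)) ` {q. \<iota> q \<in> V}"
          using S1(1)[OF x] hom(1)[OF x(1)] by (intro image_eqI[of _ _ q]) auto
      next
        fix x assume "x \<in> (\<lambda>q. \<psi> (\<iota> q)) ` {q. \<iota> q \<in> V}"
        then obtain q where q: "\<iota> q \<in> V" "x = \<psi> (\<iota> q)" by auto
        then have "\<phi> x = \<iota> q" using hom(2) by simp
        then show "x \<in> M \<inter> {x \<in> U. \<iota> (h (\<phi> x)) \<in> V}" using S2 q h' by simp
      qed
    qed (use hom h' in auto)
    obtain q where "\<phi> p = \<iota> q" using S1(2)[OF *(2) p] by blast
    then show "p \<in> {x \<in> U. \<iota> (h (\<phi> x)) \<in> V}" using S1(1)[OF *(2) p] *(2) h' by simp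
  qed
qed

lemma chart_inverse_derivative:
  assumes c: "chart M P f N \<kappa>" and q: "q \<in> P"
  shows "D \<kappa> (f q) (D f q h) = h" "inj (D f q)"
proof -
  have "((\<lambda>x. \<kappa> (f x)) has_derivative (\<lambda>h. D \<kappa> (f q) (D f q h))) (at q)"
    by (rule has_derivative_compose[OF smooth_on_has_derivative[OF chartD(3)[OF c] q]
        smooth_on_has_derivative[OF chartD(4)[OF c] chartD(8)[OF c q]]])
  then have "((\<lambda>x. x) has_derivative (\<lambda>h. D \<kappa> (f q) (D f q h))) (at q)"
    by (rule has_derivative_transform_within_open[OF _ chartD(1)[OF c] q]) (simp add: chartD(6)[OF c])
  then have "(\<lambda>h. D \<kappa> (f q) (D f q h)) = (\<lambda>h. h)"
    using has_derivative_ident has_derivative_unique by blast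
  then show eq: "D \<kappa> (f q) (D f q h) = h" for h by meson
  show "inj (D f q)" by (metis eq injI)
qed

text \<open>The map \<Psi> adds to the point \<open>f (q + K v)\<close> the part of \<open>v\<close>
  that \<open>F K\<close> misses. Its derivative at 0 is the identity, and on the range of
  \<open>F\<close> it reduces to the parametrization, so its local inverse is a slice chart.\<close>

lemma chart_imp_submanifold:
  fixes M :: "'a::euclidean_space set"
  assumes "\<And>p. p \<in> M \<Longrightarrow> \<exists>P (f :: 'p::euclidean_space \<Rightarrow> 'a) N \<kappa>. chart M P f N \<kappa> \<and> p \<in> N"
  shows "smooth_submanifold DIM('p) M"
  unfolding smooth_submanifold_def
proof
  fix p assume p: "p \<in> M"
  obtain P and f :: "'p \<Rightarrow> 'a" and N \<kappa> where c: "chart M P f N \<kappa>" and pN: "p \<in> N"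
    using assms[OF p] by blast
  define q where "q = \<kappa> p"
  have q: "q \<in> P" "f q = p" using chartD(9,10)[OF c p pN] by (auto simp: q_def)
  define F K where "F = D f q" and "K = D \<kappa> p"
  have KF: "K (F h) = h" for h using chart_inverse_derivative(1)[OF c q(1)] q(2) by (simp add: F_def K_def)
  have lF: "linear F" and lK: "linear K"
    unfolding F_def K_def using linear_D chartD[OF c] q(1) pN by blast+
  then have bF: "bounded_linear F" and bK: "bounded_linear K"
    by (simp_all add: linear_conv_bounded_linear)
  have bFK: "bounded_linear (\<lambda>v. F (K v))" by (rule bounded_linear_compose[OF bF bK])
  define \<Psi> where "\<Psi> v = f (q + K v) + (v - F (K v))" for v
  define W where "W = {v. q + K v \<in> P}"
  have contW: "continuous_on UNIV (\<lambda>v. q + K v)"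
    by (intro continuous_intros linear_continuous_on bK)
  have W: "open W" unfolding W_def
    using open_vimage_Int[OF open_UNIV contW chartD(1)[OF c]] by simp
  have "0 \<in> W" using q by (simp add: W_def linear_0[OF lK])
  have s1: "smooth_on W (\<lambda>v. q + K v)"
    by (intro smooth_on_add smooth_on_linear[OF bK] W smooth_on_const)
  have sm: "smooth_on W \<Psi>"
    unfolding \<Psi>_def
    by (intro smooth_on_add smooth_on_diff W smooth_on_id smooth_on_linear[OF bFK]
        smooth_on_compose[OF W chartD(1)[OF c] _ s1 chartD(3)[OF c]]) (auto simp: W_def)
  have "(\<Psi> has_derivative (\<lambda>v. F (K v) + (v - F (K v)))) (at 0)"
  proof -
    have "((\<lambda>v. q + K v) has_derivative (\<lambda>v. 0 + K v)) (at 0)"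
      by (intro has_derivative_add has_derivative_const bounded_linear_imp_has_derivative bK)
    then have "((\<lambda>v. f (q + K v)) has_derivative (\<lambda>v. D f (q + K 0) (0 + K v))) (at 0)"
      by (rule has_derivative_compose) (use q chartD(1,3)[OF c] in \<open>simp add: linear_0[OF lK] smooth_on_has_derivative\<close>)
    then have "((\<lambda>v. f (q + K v)) has_derivative (\<lambda>v. F (K v))) (at 0)"
      by (simp add: F_def linear_0[OF lK])
    then show ?thesis
      unfolding \<Psi>_def
      by (intro has_derivative_add has_derivative_diff has_derivative_ident
          bounded_linear_imp_has_derivative bFK)
  qed
  then have "D \<Psi> 0 v = v" for v using D_eqI by fastforce
  then have "inj (D \<Psi> 0)" by (simp add: inj_def)
  from smooth_inverse_function[OF W sm \<open>0 \<in> W\<close> this]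
  obtain V0 U0 \<phi> where V0: "open V0" "V0 \<subseteq> W" "0 \<in> V0" and U0: "open U0" "\<Psi> 0 \<in> U0"
    and hom: "homeomorphism V0 U0 \<Psi> \<phi>" and sm\<phi>: "smooth_on U0 \<phi>" by metis
  have \<Psi>0: "\<Psi> 0 = p" by (simp add: \<Psi>_def linear_0[OF lK] linear_0[OF lF] q)
  have h: "\<And>v. v \<in> V0 \<Longrightarrow> \<phi> (\<Psi> v) = v" "\<And>x. x \<in> U0 \<Longrightarrow> \<Psi> (\<phi> x) = x"
    "\<And>v. v \<in> V0 \<Longrightarrow> \<Psi> v \<in> U0" "\<And>x. x \<in> U0 \<Longrightarrow> \<phi> x \<in> V0" "continuous_on U0 \<phi>" "continuous_on V0 \<Psi>"
    using hom by (auto simp: homeomorphism_def)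
  \<comment> \<open>A point \<open>x\<close> of \<open>M\<close> in this neighbourhood equals
    \<open>\<Psi> (F (\<kappa> x - q))\<close> with argument in \<open>V0\<close>, so no other piece
    of \<open>M\<close> enters the slice chart.\<close>
  define U where "U = {x \<in> U0 \<inter> N. F (\<kappa> x - q) \<in> V0}"
  define V where "V = {v \<in> V0. \<Psi> v \<in> U}"
  have "continuous_on (U0 \<inter> N) (\<lambda>x. F (\<kappa> x - q))"
    using smooth_on_continuous[OF chartD(4)[OF c]]
    by (intro linear_continuous_on_compose[OF _ lF] continuous_intros) (auto intro: continuous_on_subset)
  then have oU: "open U"
    unfolding U_def using U0 V0 chartD(2)[OF c] by (intro open_vimage_Int) auto
  have oV: "open V" unfolding V_def using V0 oU h(6) by (intro open_vimage_Int)
  have pU: "p \<in> U"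
    using U0 pN V0 \<Psi>0 by (simp add: U_def q_def linear_0[OF lF])
  have UU: "x \<in> U0" "x \<in> N" if "x \<in> U" for x using that by (auto simp: U_def)
  have "homeomorphism U V \<phi> \<Psi>"
  proof (rule homeomorphismI)
    show "continuous_on U \<phi>" "continuous_on V \<Psi>"
      using continuous_on_subset[OF h(5)] continuous_on_subset[OF h(6)] UU(1) by (auto simp: V_def)
    show "\<phi> ` U \<subseteq> V" "\<Psi> ` V \<subseteq> U" using h(2,4) UU(1) by (auto simp: V_def)
    show "\<Psi> (\<phi> x) = x" if "x \<in> U" for x using h(2) UU(1) that by blast
    show "\<phi> (\<Psi> v) = v" if "v \<in> V" for v using h(1) that by (simp add: V_def)
  qed
  moreover have "\<phi> ` (U \<inter> M) = V \<inter> range F"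
  proof (intro equalityI subsetI)
    fix v assume "v \<in> \<phi> ` (U \<inter> M)"
    then obtain x where x: "x \<in> U" "x \<in> M" "v = \<phi> x" by auto
    have "\<Psi> (F (\<kappa> x - q)) = x"
      using chartD(10)[OF c x(2) UU(2)[OF x(1)]] by (simp add: \<Psi>_def KF)
    moreover have "F (\<kappa> x - q) \<in> V0" using x(1) by (simp add: U_def)
    ultimately have "v = F (\<kappa> x - q)" using h(1) x(3) by metis
    moreover have "v \<in> V0" "\<Psi> v = x" using x(3) h(2,4) UU(1)[OF x(1)] by auto
    ultimately show "v \<in> V \<inter> range F" using x(1) unfolding V_def by simp
  next
    fix v assume "v \<in> V \<inter> range F"
    then obtain k where v: "v \<in> V0" "\<Psi> v \<in> U" "v = F k" by (auto simp: V_def)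
    then have "q + K v \<in> P" using V0(2) by (auto simp: W_def)
    then have "\<Psi> v \<in> M" using chartD(7)[OF c] v(3) by (simp add: \<Psi>_def KF)
    then show "v \<in> \<phi> ` (U \<inter> M)" using v h(1) by (metis IntI image_eqI)
  qed
  moreover have "dim (range F) = DIM('p)"
    using dim_image_eq[OF lF, of UNIV] chart_inverse_derivative(2)[OF c q(1)] by (simp add: F_def)
  moreover have "subspace (range F)" using lF by (simp add: linear_subspace_image)
  moreover have "smooth_on U \<phi>" "smooth_on V \<Psi>"
    by (rule smooth_on_mono[OF sm\<phi>], use UU(1) in blast) (rule smooth_on_mono[OF sm], use V0(2) in \<open>auto simp: V_def\<close>)
  ultimately show "\<exists>U (V :: 'a set) \<phi> \<psi> S. open U \<and> p \<in> U \<and> open V \<and> homeomorphism U V \<phi> \<psi> \<and>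
      smooth_on U \<phi> \<and> smooth_on V \<psi> \<and> subspace S \<and> dim S = DIM('p) \<and> \<phi> ` (U \<inter> M) = V \<inter> S"
    using oU oV pU by (intro exI[of _ U] exI[of _ V] exI[of _ \<phi>] exI[of _ \<Psi>] exI[of _ "range F"] conjI)
qed

text \<open>A curve in \<open>M\<close> stays in \<open>N\<close> for a short time and is there the
  image under \<open>f\<close> of a curve of parameters; conversely, images of straight lines
  realize every vector of the range.\<close>

lemma chart_tangent_space:
  assumes c: "chart M P f N \<kappa>" and q: "q \<in> P"
  shows "tangent_space M (f q) = range (D f q)"
proof (intro equalityI subsetI)
  fix v assume "v \<in> tangent_space M (f q)"
  then obtain \<epsilon> \<gamma> where \<gamma>: "\<epsilon> > 0" "smooth_on {-\<epsilon><..<\<epsilon>} \<gamma>" "\<gamma> ` {-\<epsilon><..<\<epsilon>} \<subseteq> M" "\<gamma> 0 = f q"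
    "(\<gamma> has_vector_derivative v) (at (0::real))"
    unfolding tangent_space_def by blast
  define I where "I = {t \<in> {-\<epsilon><..<\<epsilon>}. \<gamma> t \<in> N}"
  have I: "open I" unfolding I_def
    using \<gamma>(2) chartD(2)[OF c] by (intro open_vimage_Int smooth_on_continuous) auto
  have "0 \<in> I" using \<gamma>(1,4) chartD(8)[OF c q] by (simp add: I_def)
  have d\<gamma>: "(\<gamma> has_derivative (\<lambda>t. t *\<^sub>R v)) (at 0)"
    using \<gamma>(5) by (simp add: has_vector_derivative_def)
  have "(\<kappa> has_derivative D \<kappa> (f q)) (at (\<gamma> 0))"
    unfolding \<gamma>(4) by (rule smooth_on_has_derivative[OF chartD(4)[OF c] chartD(8)[OF c q]])
  from has_derivative_compose[OF d\<gamma> this]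
  have d1: "((\<lambda>t. \<kappa> (\<gamma> t)) has_derivative (\<lambda>t. D \<kappa> (f q) (t *\<^sub>R v))) (at 0)" .
  have "(f has_derivative D f q) (at (\<kappa> (\<gamma> 0)))"
    unfolding \<gamma>(4) chartD(6)[OF c q] by (rule smooth_on_has_derivative[OF chartD(3)[OF c] q])
  from has_derivative_compose[OF d1 this]
  have "((\<lambda>t. f (\<kappa> (\<gamma> t))) has_derivative (\<lambda>t. D f q (D \<kappa> (f q) (t *\<^sub>R v)))) (at 0)" .
  then have "(\<gamma> has_derivative (\<lambda>t. D f q (D \<kappa> (f q) (t *\<^sub>R v)))) (at 0)"
    by (rule has_derivative_transform_within_open[OF _ I \<open>0 \<in> I\<close>])
      (use chartD(10)[OF c] \<gamma>(3) in \<open>auto simp: I_def image_subset_iff\<close>)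
  then have "(\<lambda>t. D f q (D \<kappa> (f q) (t *\<^sub>R v))) = (\<lambda>t. t *\<^sub>R v)"
    using d\<gamma> has_derivative_unique by blast
  then have "D f q (D \<kappa> (f q) (1 *\<^sub>R v)) = 1 *\<^sub>R v" by meson
  then show "v \<in> range (D f q)" by (metis rangeI scaleR_one)
next
  fix v assume "v \<in> range (D f q)"
  then obtain h where v: "v = D f q h" by blast
  define I where "I = {t::real. q + t *\<^sub>R h \<in> P}"
  have "open I"
    using open_vimage_Int[OF open_UNIV _ chartD(1)[OF c], of "\<lambda>t::real. q + t *\<^sub>R h"]
    by (simp add: I_def continuous_intros)
  moreover have "0 \<in> I" using q by (simp add: I_def)
  ultimately obtain \<epsilon> where \<epsilon>: "\<epsilon> > 0" "ball 0 \<epsilon> \<subseteq> I" using openE by blast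
  then have sub: "{-\<epsilon><..<\<epsilon>} \<subseteq> I" by (auto simp: subset_eq dist_real_def)
  have "bounded_linear (\<lambda>t. t *\<^sub>R h)" by (rule bounded_linear_scaleR_left)
  then have "smooth_on {-\<epsilon><..<\<epsilon>} (\<lambda>t. q + t *\<^sub>R h)"
    by (intro smooth_on_add smooth_on_linear smooth_on_const) auto
  then have "smooth_on {-\<epsilon><..<\<epsilon>} (\<lambda>t. f (q + t *\<^sub>R h))"
    using sub by (intro smooth_on_compose[OF _ chartD(1)[OF c] _ _ chartD(3)[OF c]]) (auto simp: I_def)
  moreover have "((\<lambda>t. f (q + t *\<^sub>R h)) has_derivative (\<lambda>t. D f q (t *\<^sub>R h))) (at 0)"
  proof (rule has_derivative_compose[of "\<lambda>t. q + t *\<^sub>R h"])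
    show "((\<lambda>t. q + t *\<^sub>R h) has_derivative (\<lambda>t. t *\<^sub>R h)) (at 0)"
      by (auto intro!: derivative_eq_intros)
    show "(f has_derivative D f q) (at (q + 0 *\<^sub>R h))"
      using smooth_on_has_derivative[OF chartD(3)[OF c] q] by simp
  qed
  then have "((\<lambda>t. f (q + t *\<^sub>R h)) has_vector_derivative v) (at 0)"
    by (simp add: has_vector_derivative_def v linear_cmul[OF linear_D[OF chartD(3)[OF c] q]])
  moreover have "(\<lambda>t. f (q + t *\<^sub>R h)) ` {-\<epsilon><..<\<epsilon>} \<subseteq> M"
    using sub chartD(7)[OF c] by (auto simp: I_def)
  ultimately show "v \<in> tangent_space M (f q)"
    unfolding tangent_space_def using \<epsilon>(1)
    by (intro CollectI exI[of _ \<epsilon>] conjI exI[of _ "\<lambda>t. f (q + t *\<^sub>R h)"]) auto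
qed

text \<open>The description under \<open>THE\<close> has to be satisfied and to determine its value.
  The coordinate field \<open>k\<close> carried along \<kappa> is an admissible extension; any other
  one has the form \<open>D f x (\<beta> x)\<close> along \<open>M\<close>, and by the product rule
  its derivative differs by a tangent vector. Against a normal vector \<nu> only the second
  derivative of \<open>f\<close> survives.\<close>

lemma chart_second_fundamental_form:
  assumes c: "chart M P f N \<kappa>" and q: "q \<in> P" and \<nu>: "\<And>h. D f q h \<bullet> \<nu> = 0"
  shows "second_fundamental_form M (f q) (D f q h) (D f q k) \<bullet> \<nu> = D (\<lambda>x. D f x k) q h \<bullet> \<nu>"
proof -
  let ?T = "range (D f q)"
  let ?Q = "\<lambda>n. \<exists>U B. open U \<and> f q \<in> U \<and> smooth_on U B \<and>
        (\<forall>y\<in>U \<inter> M. B y \<in> tangent_space M y) \<and> B (f q) = D f q k \<and>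
        n \<in> orthogonal_comp (tangent_space M (f q)) \<and>
        D B (f q) (D f q h) - n \<in> tangent_space M (f q)"
  note f = chartD(3)[OF c] and P = chartD(1)[OF c] and \<kappa> = chartD(4)[OF c]
  note T = chart_tangent_space[OF c q]
  note df = smooth_on_has_derivative[OF f q]
  have sT: "subspace ?T" using linear_D[OF f q] by (simp add: linear_subspace_image)
  define w where "w = D (\<lambda>x. D f x k) q h"
  obtain t n where tn: "t \<in> span ?T" "\<And>v. v \<in> span ?T \<Longrightarrow> orthogonal n v" "w = t + n"
    using orthogonal_subspace_decomp_exists[of ?T w] by blast
  have "n \<bullet> D f q y = 0" for y
    using tn(2)[OF span_base[OF rangeI]] by (simp add: orthogonal_def)
  then have n1: "n \<in> orthogonal_comp ?T"
    by (auto simp: orthogonal_comp_def orthogonal_def inner_commute)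
  have n2: "w - n \<in> ?T" using tn(1,3) unfolding span_eq_iff[THEN iffD2, OF sT] by simp
  have ex: "?Q n"
  proof (intro exI conjI)
    let ?U = "{x \<in> N. \<kappa> x \<in> P}"
    show oU: "open ?U" using chartD(2)[OF c] P \<kappa> by (intro open_vimage_Int smooth_on_continuous)
    show "f q \<in> ?U" using chartD(6,8)[OF c q] q by simp
    show "smooth_on ?U (\<lambda>y. D f (\<kappa> y) k)"
      by (rule smooth_on_compose[OF oU P _ smooth_on_mono[OF \<kappa>] smooth_on_deriv[OF f]]) auto
    show "\<forall>y\<in>?U \<inter> M. D f (\<kappa> y) k \<in> tangent_space M y"
    proof
      fix y assume "y \<in> ?U \<inter> M"
      then have "f (\<kappa> y) = y" "\<kappa> y \<in> P" using chartD(10)[OF c] by auto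
      then show "D f (\<kappa> y) k \<in> tangent_space M y" using chart_tangent_space[OF c, of "\<kappa> y"] by simp
    qed
    show "D f (\<kappa> (f q)) k = D f q k" using chartD(6)[OF c q] by simp
    show "n \<in> orthogonal_comp (tangent_space M (f q))" using n1 T by simp
    have "((\<lambda>y. D f (\<kappa> y) k) has_derivative (\<lambda>v. D (\<lambda>x. D f x k) q (D \<kappa> (f q) v))) (at (f q))"
      using has_derivative_compose[OF smooth_on_has_derivative[OF \<kappa> chartD(8)[OF c q]], of "\<lambda>x. D f x k"]
        smooth_on_has_derivative[OF smooth_on_deriv[OF f] q] chartD(6)[OF c q] by simp
    from D_eqI[OF this, of "D f q h"] have "D (\<lambda>y. D f (\<kappa> y) k) (f q) (D f q h) = w"
      unfolding w_def chart_inverse_derivative(1)[OF c q] .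
    then show "D (\<lambda>y. D f (\<kappa> y) k) (f q) (D f q h) - n \<in> tangent_space M (f q)"
      using n2 T by simp
  qed
  have uniq: "n' = n" if "?Q n'" for n'
  proof -
    obtain U B where "open U \<and> f q \<in> U \<and> smooth_on U B \<and>
        (\<forall>y\<in>U \<inter> M. B y \<in> tangent_space M y) \<and> B (f q) = D f q k \<and>
        n' \<in> orthogonal_comp ?T \<and> D B (f q) (D f q h) - n' \<in> ?T"
      using \<open>?Q n'\<close> unfolding T by (elim exE) (rule that)
    then have B: "open U" "f q \<in> U" "smooth_on U B" "\<And>y. y \<in> U \<Longrightarrow> y \<in> M \<Longrightarrow> B y \<in> tangent_space M y"
      "B (f q) = D f q k" "n' \<in> orthogonal_comp ?T" "D B (f q) (D f q h) - n' \<in> ?T"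
      by simp_all
    define P' where "P' = {x \<in> P. f x \<in> U}"
    have P': "open P'" "q \<in> P'" "P' \<subseteq> P"
      using open_vimage_Int[OF P smooth_on_continuous[OF f] B(1)] q B(2) by (auto simp: P'_def)
    define \<beta> where "\<beta> x = D \<kappa> (f x) (B (f x))" for x
    have f': "smooth_on P' f" using smooth_on_mono[OF f P'(3)] .
    have "smooth_on P' (\<lambda>x. D \<kappa> (f x) (B (f x)))"
    proof -
      have "smooth_on (U \<inter> N) (\<lambda>y. D \<kappa> y (B y))"
        using smooth_on_mono[OF B(3)] smooth_on_mono[OF \<kappa>] B(1) chartD(2)[OF c]
        by (intro smooth_on_deriv_apply) auto
      then show ?thesis
        by (rule smooth_on_compose[OF P'(1) _ _ f', rotated 2])
          (use B(1) chartD(2)[OF c] chartD(8)[OF c] in \<open>auto simp: P'_def\<close>)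
    qed
    then have "(\<beta> has_derivative D \<beta> q) (at q)"
      unfolding \<beta>_def by (rule smooth_on_has_derivative[OF _ P'(2)])
    from has_derivative_D_apply[OF P'(1) f' P'(2) this]
    have "((\<lambda>x. D f x (\<beta> x)) has_derivative
        (\<lambda>h. D (\<lambda>x. D f x (\<beta> q)) q h + D f q (D \<beta> q h))) (at q)" .
    then have "((\<lambda>x. B (f x)) has_derivative
        (\<lambda>h. D (\<lambda>x. D f x (\<beta> q)) q h + D f q (D \<beta> q h))) (at q)"
    proof (rule has_derivative_transform_within_open[OF _ P'(1,2)])
      fix x assume x: "x \<in> P'"
      then have xP: "x \<in> P" and "f x \<in> U" by (auto simp: P'_def)
      then have "B (f x) \<in> range (D f x)"
        using B(4) chartD(7)[OF c xP] chart_tangent_space[OF c xP] by auto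
      then show "D f x (\<beta> x) = B (f x)"
        unfolding \<beta>_def using chart_inverse_derivative(1)[OF c xP] by auto
    qed
    moreover have "((\<lambda>x. B (f x)) has_derivative (\<lambda>h. D B (f q) (D f q h))) (at q)"
      by (rule has_derivative_compose[OF df smooth_on_has_derivative[OF B(3,2)]])
    ultimately have eq: "D (\<lambda>x. D f x (\<beta> q)) q h + D f q (D \<beta> q h) = D B (f q) (D f q h)"
      using has_derivative_unique[THEN fun_cong] by blast
    have "\<beta> q = k"
      unfolding \<beta>_def B(5) by (rule chart_inverse_derivative(1)[OF c q])
    then have "D B (f q) (D f q h) - w = D f q (D \<beta> q h)" using eq unfolding w_def by (metis add_diff_cancel_left')
    then have "D B (f q) (D f q h) - w \<in> ?T" by simp
    then have "w - n' \<in> ?T"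
      using subspace_diff[OF sT B(7), of "D B (f q) (D f q h) - w"] by simp
    then have "n - n' \<in> ?T" using subspace_diff[OF sT _ n2, of "w - n'"] by simp
    moreover have "n - n' \<in> orthogonal_comp ?T"
      using subspace_diff[OF subspace_orthogonal_comp n1 B(6)] .
    ultimately have "orthogonal (n - n') (n - n')" by (auto simp: orthogonal_comp_def)
    then show "n' = n" by (simp add: orthogonal_def)
  qed
  have "second_fundamental_form M (f q) (D f q h) (D f q k) = n"
    unfolding second_fundamental_form_def by (rule the_equality) (use ex uniq in blast)+
  moreover have "n \<bullet> \<nu> = w \<bullet> \<nu>"
  proof -
    obtain y where "w - n = D f q y" using n2 by blast
    then have "(w - n) \<bullet> \<nu> = 0" using \<nu> by simp
    then show ?thesis by (simp add: inner_diff_left)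
  qed
  ultimately show ?thesis by (simp add: w_def)
qed

subsection \<open>Traceless cubics with a stabilizer of order three\<close>

definition triple :: "'a \<Rightarrow> 'a \<Rightarrow> 'a \<Rightarrow> 3 \<Rightarrow> 'a" where
  "triple a b c i = (if i = 1 then a else if i = 2 then b else c)"

lemma triple_simps [simp]: "triple a b c 1 = a" "triple a b c 2 = b" "triple a b c 3 = c"
  by (simp_all add: triple_def)

lemma orthonormal_basisD:
  assumes "orthonormal_basis T e"
  shows "e i \<bullet> e j = (if i = j then 1 else 0)" "e i \<in> T" "subspace T"
    "v \<in> T \<Longrightarrow> v = (\<Sum>i\<in>UNIV. (v \<bullet> e i) *\<^sub>R e i)"
proof -
  have e: "span (range e) = T" "\<And>i j. e i \<bullet> e j = (if i = j then 1 else 0)"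
    using assms by (auto simp: orthonormal_basis_def)
  show "e i \<bullet> e j = (if i = j then 1 else 0)" "e i \<in> T" "subspace T"
    using e span_base[of "e i" "range e"] subspace_span[of "range e"] by auto
  assume "v \<in> T"
  then have "v \<in> span (range e)" using e(1) by simp
  then obtain u where u: "v = (\<Sum>x\<in>range e. u x *\<^sub>R x)" by (auto simp: span_finite)
  have inj: "inj e"
  proof (rule injI)
    fix i j assume "e i = e j"
    then have "e i \<bullet> e j = e j \<bullet> e j" by simp
    then show "i = j" unfolding e(2) by (simp split: if_splits)
  qed
  have v: "v = (\<Sum>i\<in>UNIV. u (e i) *\<^sub>R e i)" unfolding u by (subst sum.reindex[OF inj]) (simp add: o_def)
  have "v \<bullet> e j = u (e j)" for j
    unfolding v inner_sum_left inner_scaleR_left e(2) by (simp add: mult_delta_right)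
  then show "v = (\<Sum>i\<in>UNIV. (v \<bullet> e i) *\<^sub>R e i)" using v by simp
qed

lemma orthonormal_basis_inner:
  assumes "orthonormal_basis T e" "v \<in> T"
  shows "v \<bullet> w = (\<Sum>k\<in>UNIV. (v \<bullet> e k) * (e k \<bullet> w))"
  using arg_cong[OF orthonormal_basisD(4)[OF assms], of "\<lambda>x. x \<bullet> w"]
  by (simp only: inner_sum_left inner_scaleR_left)

lemma orthonormal_basisI:
  assumes T: "subspace T" "dim T = 3" and e: "\<And>i. e i \<in> T" "\<And>i j. e i \<bullet> e j = (if i = j then 1 else 0)"
  shows "orthonormal_basis T e"
proof -
  have inj: "inj e"
  proof (rule injI)
    fix i j assume "e i = e j"
    then have "e i \<bullet> e j = e j \<bullet> e j" by simp
    then show "i = j" unfolding e(2) by (simp split: if_splits)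
  qed
  have "pairwise orthogonal (range e)" "0 \<notin> range e"
    using e(2) inj by (auto simp: pairwise_def orthogonal_def inj_eq) (metis inner_zero_left zero_neq_one)
  then have "independent (range e)" by (rule pairwise_orthogonal_independent)
  moreover have "card (range e) = 3" using card_image[OF inj] by simp
  ultimately have "dim T \<le> card (range e)" "independent (range e)" using T by auto
  then have "T \<subseteq> span (range e)" using card_ge_dim_independent[of "range e" T] e(1) by auto
  moreover have "span (range e) \<subseteq> T" using e(1) T(1) by (intro span_minimal) auto
  ultimately show ?thesis using e(2) by (auto simp: orthonormal_basis_def)
qed

lemma orthonormal_basis_dim: "orthonormal_basis T e \<Longrightarrow> dim T = 3"
proof -
  assume e: "orthonormal_basis T e"
  have inj: "inj e"
    by (rule injI) (metis orthonormal_basisD(1)[OF e] zero_neq_one)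
  have "pairwise orthogonal (range e)" "0 \<notin> range e"
    using orthonormal_basisD(1)[OF e] inj
    by (auto simp: pairwise_def orthogonal_def inj_eq) (metis inner_zero_left zero_neq_one)
  then have "independent (range e)" by (rule pairwise_orthogonal_independent)
  then have "dim (span (range e)) = card (range e)" by (simp add: dim_eq_card_independent)
  moreover have "span (range e) = T" using e by (simp add: orthonormal_basis_def)
  moreover have "card (range e) = 3" using card_image[OF inj] by simp
  ultimately show ?thesis by (metis dim_span)
qed

lemma orthonormal_basis_triple:
  assumes T: "orthonormal_basis T f" and "a \<in> T" "b \<in> T" "c \<in> T" "a \<bullet> a = 1" "b \<bullet> b = 1" "c \<bullet> c = 1"
    "a \<bullet> b = 0" "a \<bullet> c = 0" "b \<bullet> c = 0"
  shows "orthonormal_basis T (triple a b c)"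
proof (rule orthonormal_basisI)
  show "subspace T" "dim T = 3" using T orthonormal_basisD(3) orthonormal_basis_dim by auto
  show "triple a b c i \<in> T" for i using assms by (simp add: triple_def)
  have "\<forall>i j. triple a b c i \<bullet> triple a b c j = (if i = j then 1 else 0)"
    unfolding forall_3 using assms by (simp add: inner_commute)
  then show "triple a b c i \<bullet> triple a b c j = (if i = j then 1 else 0)" for i j by blast
qed

lemma orthonormal_basis_extend:
  assumes f: "orthonormal_basis T f" and u: "u \<in> T" "norm u = 1"
  obtains e where "orthonormal_basis T e" "e 1 = u"
proof -
  have T: "subspace T" "dim T = 3" using f orthonormal_basisD(3) orthonormal_basis_dim by auto
  define T' where "T' = {y \<in> T. \<forall>x\<in>span {u}. orthogonal x y}"
  have "dim T' + dim (span {u}) = dim T"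
    unfolding T'_def by (rule dim_subspace_orthogonal_to_vectors) (use T u span_minimal[of "{u}" T] in auto)
  moreover have "dim (span {u}) = 1" using u(2) by (metis dim_span dim_singleton norm_zero zero_neq_one)
  ultimately have d: "dim T' = 2" using T by simp
  have "subspace T'"
    unfolding T'_def using T(1)
    by (auto simp: subspace_def orthogonal_clauses)
  then obtain B where B: "B \<subseteq> T'" "pairwise orthogonal B" "\<And>x. x \<in> B \<Longrightarrow> norm x = 1" "card B = dim T'"
    by (metis orthonormal_basis_subspace)
  then obtain b c where bc: "B = {b, c}" "b \<noteq> c" using d by (auto simp: card_2_iff)
  have T': "x \<in> T" "u \<bullet> x = 0" if "x \<in> T'" for x
    using that span_base[of u "{u}"] by (auto simp: T'_def orthogonal_def)
  have "orthonormal_basis T (triple u b c)"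
    using B(1-3) bc T' u
    by (intro orthonormal_basis_triple[OF f]) (auto simp: pairwise_def orthogonal_def dot_square_norm)
  then show ?thesis using that by simp
qed

text \<open>Contraction of two slots does not depend on the orthonormal basis; tracelessness and
  both covariants inherit their basis independence from this.\<close>

lemma orthonormal_basis_trace:
  fixes B :: "'a::euclidean_space \<Rightarrow> 'a \<Rightarrow> real"
  assumes e: "orthonormal_basis T e" and f: "orthonormal_basis T f"
    and B: "\<And>a. linear (B a)" "\<And>b. linear (\<lambda>a. B a b)"
  shows "(\<Sum>i\<in>UNIV. B (f i) (f i)) = (\<Sum>i\<in>UNIV. B (e i) (e i))"
proof -
  have "B (f i) (f i) = (\<Sum>k\<in>UNIV. \<Sum>l\<in>UNIV. (f i \<bullet> e k) * (f i \<bullet> e l) * B (e k) (e l))" for i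
  proof -
    have fi: "f i = (\<Sum>k\<in>UNIV. (f i \<bullet> e k) *\<^sub>R e k)"
      by (rule orthonormal_basisD(4)[OF e orthonormal_basisD(2)[OF f]])
    have "B (f i) (f i) = B (\<Sum>k\<in>UNIV. (f i \<bullet> e k) *\<^sub>R e k) (\<Sum>k\<in>UNIV. (f i \<bullet> e k) *\<^sub>R e k)"
      using fi by simp
    also have "\<dots> = (\<Sum>k\<in>UNIV. \<Sum>l\<in>UNIV. (f i \<bullet> e k) * (f i \<bullet> e l) * B (e k) (e l))"
      by (simp add: linear_sum[OF B(1)] linear_sum[OF B(2)] linear_cmul[OF B(1)] linear_cmul[OF B(2)]
          sum_distrib_left mult.assoc mult.left_commute)
        (subst sum.swap, simp add: mult.left_commute)
    finally show ?thesis .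
  qed
  then have "(\<Sum>i\<in>UNIV. B (f i) (f i)) = (\<Sum>i\<in>UNIV. \<Sum>k\<in>UNIV. \<Sum>l\<in>UNIV. (f i \<bullet> e k) * (f i \<bullet> e l) * B (e k) (e l))"
    by simp
  also have "\<dots> = (\<Sum>k\<in>UNIV. \<Sum>l\<in>UNIV. (\<Sum>i\<in>UNIV. (e k \<bullet> f i) * (f i \<bullet> e l)) * B (e k) (e l))"
    by (simp add: sum_3 inner_commute algebra_simps)
  also have "\<dots> = (\<Sum>k\<in>UNIV. \<Sum>l\<in>UNIV. (e k \<bullet> e l) * B (e k) (e l))"
  proof -
    have "(\<Sum>i\<in>UNIV. (e k \<bullet> f i) * (f i \<bullet> e l)) = e k \<bullet> e l" for k l
      by (rule orthonormal_basis_inner[OF f orthonormal_basisD(2)[OF e], symmetric])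
    then show ?thesis by simp
  qed
  also have "\<dots> = (\<Sum>i\<in>UNIV. B (e i) (e i))"
    by (simp add: orthonormal_basisD(1)[OF e] if_distrib[where f = "\<lambda>x. x * _"] cong: if_cong)
  finally show ?thesis .
qed

section \<open>Isometries and rotations of a three-dimensional space, and stabilizers of order
  three\<close>

definition linear_isometry :: "'a::euclidean_space set \<Rightarrow> ('a \<Rightarrow> 'a) set" where
  "linear_isometry T = {A \<in> Bij T. (\<forall>a\<in>T. \<forall>b\<in>T. A (a + b) = A a + A b) \<and>
     (\<forall>r. \<forall>a\<in>T. A (r *\<^sub>R a) = r *\<^sub>R A a) \<and> (\<forall>a\<in>T. \<forall>b\<in>T. A a \<bullet> A b = a \<bullet> b)}"

lemma linear_isometryD:
  assumes "A \<in> linear_isometry T"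
  shows "A \<in> Bij T" "\<And>a. a \<in> T \<Longrightarrow> A a \<in> T" "\<And>a b. a \<in> T \<Longrightarrow> b \<in> T \<Longrightarrow> A (a + b) = A a + A b"
    "\<And>a r. a \<in> T \<Longrightarrow> A (r *\<^sub>R a) = r *\<^sub>R A a" "\<And>a b. a \<in> T \<Longrightarrow> b \<in> T \<Longrightarrow> A a \<bullet> A b = a \<bullet> b"
  using assms by (auto simp: linear_isometry_def Bij_def bij_betw_def)

lemma special_orthogonal_iff:
  "A \<in> special_orthogonal T \<longleftrightarrow> A \<in> linear_isometry T \<and>
    (\<forall>e. orthonormal_basis T e \<longrightarrow> det (\<chi> i j. e i \<bullet> A (e j) :: real ^ 3 ^ 3) = 1)"
  by (auto simp: special_orthogonal_def linear_isometry_def)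

lemma linear_isometry_compose:
  assumes A: "A \<in> linear_isometry T" and B: "B \<in> linear_isometry T" and T: "subspace T"
  shows "compose T A B \<in> linear_isometry T"
proof -
  note A = linear_isometryD[OF A] and B = linear_isometryD[OF B]
  show ?thesis
    unfolding linear_isometry_def
    using A B T by (auto simp: compose_Bij compose_eq subspace_add subspace_scale)
qed

lemma matrix_compose:
  assumes A: "A \<in> linear_isometry T" and B: "B \<in> linear_isometry T" and e: "orthonormal_basis T e"
  shows "(\<chi> i j. e i \<bullet> compose T A B (e j) :: real ^ 3 ^ 3) =
    (\<chi> i j. e i \<bullet> A (e j)) ** (\<chi> i j. e i \<bullet> B (e j))"
proof -
  note A = linear_isometryD[OF A] and B = linear_isometryD[OF B] and e = orthonormal_basisD[OF e]
  have "e i \<bullet> A (B (e j)) = (\<Sum>k\<in>UNIV. (e i \<bullet> A (e k)) * (e k \<bullet> B (e j)))" for i j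
  proof -
    define b where "b k = B (e j) \<bullet> e k" for k
    have "B (e j) = b 1 *\<^sub>R e 1 + b 2 *\<^sub>R e 2 + b 3 *\<^sub>R e 3"
      using e(4)[OF B(2)[OF e(2)], of j] by (simp add: sum_3 b_def)
    then have "A (B (e j)) = b 1 *\<^sub>R A (e 1) + b 2 *\<^sub>R A (e 2) + b 3 *\<^sub>R A (e 3)"
      using A(3,4) e(2,3) by (simp add: subspace_add subspace_scale)
    then show ?thesis by (simp add: sum_3 b_def inner_commute inner_right_distrib)
  qed
  then show ?thesis
    by (simp add: matrix_matrix_mult_def vec_eq_iff compose_eq e(2))
qed

lemma matrix_det_square:
  assumes A: "A \<in> linear_isometry T" and e: "orthonormal_basis T e"
  shows "det (\<chi> i j. e i \<bullet> A (e j) :: real ^ 3 ^ 3) * det (\<chi> i j. e i \<bullet> A (e j) :: real ^ 3 ^ 3) = 1"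
proof -
  note A = linear_isometryD[OF A] and e' = orthonormal_basisD[OF e]
  let ?M = "(\<chi> i j. e i \<bullet> A (e j) :: real ^ 3 ^ 3)"
  have "(\<Sum>k\<in>UNIV. (e k \<bullet> A (e i)) * (e k \<bullet> A (e j))) = (if i = j then 1 else 0)" for i j
    using orthonormal_basis_inner[OF e A(2)[OF e'(2)], of i "A (e j)"] A(5)[OF e'(2) e'(2), of i j]
      e'(1)[of i j] by (simp add: inner_commute[of "A (e i)" "e _"])
  then have "transpose ?M ** ?M = mat 1"
    by (simp add: matrix_matrix_mult_def vec_eq_iff transpose_def mat_def)
  then have "det (transpose ?M ** ?M) = 1" by simp
  then show ?thesis by (simp add: det_mul det_transpose)
qed

lemma special_orthogonal_compose:
  assumes "A \<in> special_orthogonal T" "B \<in> special_orthogonal T" "subspace T"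
  shows "compose T A B \<in> special_orthogonal T"
proof -
  have A: "A \<in> linear_isometry T" and B: "B \<in> linear_isometry T"
    using assms by (simp_all add: special_orthogonal_iff)
  show ?thesis
    unfolding special_orthogonal_iff
  proof (intro conjI allI impI)
    show "compose T A B \<in> linear_isometry T" by (rule linear_isometry_compose[OF A B assms(3)])
    fix e assume e: "orthonormal_basis T e"
    show "det (\<chi> i j. e i \<bullet> compose T A B (e j) :: real ^ 3 ^ 3) = 1"
      using assms(1,2) e by (simp add: matrix_compose[OF A B e] det_mul special_orthogonal_iff)
  qed
qed

text \<open>The determinant of an isometry is a sign, so squares are rotations. This supplies half
  turns without computing a determinant.\<close>

lemma special_orthogonal_square:
  assumes "A \<in> linear_isometry T" "subspace T"
  shows "compose T A A \<in> special_orthogonal T"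
  unfolding special_orthogonal_iff
proof (intro conjI allI impI)
  show "compose T A A \<in> linear_isometry T" by (rule linear_isometry_compose[OF assms(1,1,2)])
  fix e assume e: "orthonormal_basis T e"
  show "det (\<chi> i j. e i \<bullet> compose T A A (e j) :: real ^ 3 ^ 3) = 1"
    by (simp add: matrix_compose[OF assms(1,1) e] det_mul matrix_det_square[OF assms(1) e])
qed

lemma special_orthogonal_id:
  assumes "subspace T" shows "(\<lambda>x\<in>T. x) \<in> special_orthogonal T"
proof -
  have "(\<chi> i j. e i \<bullet> (\<lambda>x\<in>T. x) (e j) :: real ^ 3 ^ 3) = mat 1" if "orthonormal_basis T e" for e
    using orthonormal_basisD[OF that] by (simp add: vec_eq_iff mat_def)
  then show ?thesis
    using assms
    by (auto simp: special_orthogonal_def id_Bij subspace_add subspace_scale)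
qed

definition cubic_symmetry :: "'a::euclidean_space set \<Rightarrow> ('a \<Rightarrow> 'a \<Rightarrow> 'a \<Rightarrow> real) \<Rightarrow> ('a \<Rightarrow> 'a) \<Rightarrow> bool" where
  "cubic_symmetry T C A \<longleftrightarrow> A \<in> special_orthogonal T \<and>
     (\<forall>a\<in>T. \<forall>b\<in>T. \<forall>c\<in>T. C (A a) (A b) (A c) = C a b c)"

text \<open>An element sent to 1 by the isomorphism has order three, and an involution would be sent
  to a class \<open>x\<close> with \<open>2 x = 0\<close> modulo 3, hence is the identity. The rest
  of the proof works with these two consequences.\<close>

lemma cubic_stabilizer_Z3:
  assumes iso: "cubic_stabilizer T C \<cong> integer_mod_group 3" and T: "subspace T"
  obtains A where "cubic_symmetry T C A" "\<forall>a\<in>T. A (A (A a)) = a" "\<exists>a\<in>T. A a \<noteq> a"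
    "\<forall>B. cubic_symmetry T C B \<and> (\<forall>a\<in>T. B (B a) = a) \<longrightarrow> (\<forall>a\<in>T. B a = a)"
proof -
  define G where "G = {A \<in> special_orthogonal T. \<forall>a\<in>T. \<forall>b\<in>T. \<forall>c\<in>T. C (A a) (A b) (A c) = C a b c}"
  have car: "carrier (cubic_stabilizer T C) = G" by (simp add: cubic_stabilizer_def G_def)
  have GB: "A \<in> Bij T" "A \<in> linear_isometry T" if "A \<in> G" for A
    using that linear_isometryD(1) by (auto simp: G_def special_orthogonal_iff)
  have mult: "A \<otimes>\<^bsub>cubic_stabilizer T C\<^esub> B = compose T A B" if "A \<in> G" "B \<in> G" for A B
    using GB that by (simp add: cubic_stabilizer_def BijGroup_def)
  obtain h where h: "h \<in> hom (cubic_stabilizer T C) (integer_mod_group 3)"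
    "bij_betw h G {0..<3}"
    using iso by (auto simp: is_iso_def iso_def car carrier_integer_mod_group)
  have hm: "h (compose T A B) = (h A + h B) mod 3" if "A \<in> G" "B \<in> G" for A B
    using hom_mult[OF h(1), of A B] that mult[OF that] car by simp
  have h3: "h A \<in> {0..<3}" if "A \<in> G" for A using h(2) that by (auto simp: bij_betw_def)
  have inj: "A = B" if "A \<in> G" "B \<in> G" "h A = h B" for A B
    using h(2) that by (auto simp: bij_betw_def inj_on_def)
  define I where "I = (\<lambda>x\<in>T. x)"
  have I: "I \<in> G" using special_orthogonal_id[OF T] by (simp add: G_def I_def)
  have "compose T I I = I" by (auto simp: I_def compose_def)
  then have "h I = (h I + h I) mod 3" using hm[OF I I] by simp
  then have hI: "h I = 0" using h3[OF I] by (auto, presburger)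
  have comp: "compose T A B \<in> G" if "A \<in> G" "B \<in> G" for A B
    using that special_orthogonal_compose[OF _ _ T, of A B] linear_isometryD(2)[OF GB(2)[OF that(2)]]
    by (simp add: G_def compose_eq)
  have nid: "A = I" if "A \<in> G" "\<And>a. a \<in> T \<Longrightarrow> A a = a" for A
  proof
    fix a show "A a = I a"
      using that(2) GB(1)[OF that(1)] by (cases "a \<in> T") (auto simp: I_def Bij_def extensional_def)
  qed
  have "1 \<in> h ` G" using h(2) by (auto simp: bij_betw_def)
  then obtain A where A: "A \<in> G" "h A = 1" by auto
  have AT: "A a \<in> T" if "a \<in> T" for a using linear_isometryD(2)[OF GB(2)[OF A(1)] that] .
  have "h (compose T A A) = 2" using hm[OF A(1) A(1)] A(2) by simp
  then have "h (compose T A (compose T A A)) = 0" using hm[OF A(1) comp[OF A(1) A(1)]] A(2) by simp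
  then have AAA: "compose T A (compose T A A) = I"
    using inj[OF comp[OF A(1) comp[OF A(1) A(1)]] I] hI by simp
  show ?thesis
  proof (rule that[of A])
    show "cubic_symmetry T C A" using A(1) by (simp add: G_def cubic_symmetry_def)
    show "\<forall>a\<in>T. A (A (A a)) = a"
    proof
      fix a assume "a \<in> T"
      then show "A (A (A a)) = a" using fun_cong[OF AAA, of a] by (simp add: compose_eq I_def)
    qed
    show "\<exists>a\<in>T. A a \<noteq> a"
      using nid[OF A(1)] A(2) hI by fastforce
    show "\<forall>B. cubic_symmetry T C B \<and> (\<forall>a\<in>T. B (B a) = a) \<longrightarrow> (\<forall>a\<in>T. B a = a)"
    proof (intro allI impI ballI, elim conjE)
      fix B a assume B: "cubic_symmetry T C B" "\<forall>a\<in>T. B (B a) = a" and a: "a \<in> T"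
      have BG: "B \<in> G" using B(1) by (simp add: G_def cubic_symmetry_def)
      have "compose T B B = I" using nid[OF comp[OF BG BG]] B(2) by (simp add: compose_eq)
      then have "(h B + h B) mod 3 = 0" using hm[OF BG BG] hI by simp
      then have "h B = 0" using h3[OF BG] by (auto, presburger)
      then have "B = I" using inj[OF BG I] hI by simp
      then show "B a = a" using a by (simp add: I_def)
    qed
  qed
qed

lemma linear_isometry_of_bases:
  assumes e: "orthonormal_basis T e" and g: "orthonormal_basis T g"
  defines "A \<equiv> (\<lambda>v\<in>T. \<Sum>i\<in>UNIV. (v \<bullet> e i) *\<^sub>R g i)"
  shows "A \<in> linear_isometry T" "A (e i) = g i"
proof -
  note e' = orthonormal_basisD[OF e] and g' = orthonormal_basisD[OF g]
  have A: "A v = (\<Sum>i\<in>UNIV. (v \<bullet> e i) *\<^sub>R g i)" if "v \<in> T" for v using that by (simp add: A_def)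
  have AT: "A v \<in> T" if "v \<in> T" for v
    unfolding A[OF that] by (intro subspace_sum subspace_scale g'(2,3))
  have Ag: "A v \<bullet> g j = v \<bullet> e j" if "v \<in> T" for v j
    unfolding A[OF that] inner_sum_left inner_scaleR_left g'(1) by (simp add: mult_delta_right)
  have inner: "A v \<bullet> A w = v \<bullet> w" if "v \<in> T" "w \<in> T" for v w
  proof -
    have "v \<bullet> w = (\<Sum>i\<in>UNIV. (v \<bullet> e i) * (A w \<bullet> g i))"
      using orthonormal_basis_inner[OF e that(1), of w] Ag[OF that(2)] inner_commute[of "e _" w] by simp
    also have "\<dots> = A v \<bullet> A w"
      unfolding A[OF that(1)] by (simp add: inner_sum_left inner_commute[of "g _"])
    finally show ?thesis by simp
  qed
  have "bij_betw A T T"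
    unfolding bij_betw_def
  proof
    show "inj_on A T"
    proof (rule inj_onI)
      fix v w assume vw: "v \<in> T" "w \<in> T" "A v = A w"
      then have "v \<bullet> e i = w \<bullet> e i" for i using Ag by metis
      then have "(\<Sum>i\<in>UNIV. (v \<bullet> e i) *\<^sub>R e i) = (\<Sum>i\<in>UNIV. (w \<bullet> e i) *\<^sub>R e i)" by simp
      then show "v = w" unfolding e'(4)[OF vw(1), symmetric] e'(4)[OF vw(2), symmetric] .
    qed
    show "A ` T = T"
    proof (intro equalityI subsetI)
      fix v assume v: "v \<in> T"
      define w where "w = (\<Sum>i\<in>UNIV. (v \<bullet> g i) *\<^sub>R e i)"
      have w: "w \<in> T" unfolding w_def by (intro subspace_sum subspace_scale e'(2,3))
      have "w \<bullet> e j = v \<bullet> g j" for j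
        unfolding w_def inner_sum_left inner_scaleR_left e'(1) by (simp add: mult_delta_right)
      then have "A w = v" by (simp add: A[OF w] g'(4)[OF v, symmetric])
      then show "v \<in> A ` T" using w by auto
    qed (use AT in auto)
  qed
  moreover have "A \<in> extensional T" by (simp add: A_def)
  ultimately have "A \<in> Bij T" by (simp add: Bij_def)
  moreover have "A (v + w) = A v + A w" if "v \<in> T" "w \<in> T" for v w
    using that subspace_add[OF e'(3) that] by (simp add: A inner_left_distrib scaleR_left_distrib sum.distrib)
  moreover have "A (r *\<^sub>R v) = r *\<^sub>R A v" if "v \<in> T" for v r
    using that subspace_scale[OF e'(3) that] by (simp add: A scaleR_sum_right)
  ultimately show "A \<in> linear_isometry T" using inner by (simp add: linear_isometry_def)
  have "e i \<bullet> e j = (if i = j then 1 else 0)" for j by (rule e'(1))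
  then show "A (e i) = g i"
    unfolding A[OF e'(2)] by (simp add: if_distrib[where f = "\<lambda>x. x *\<^sub>R _"] cong: if_cong)
qed

text \<open>Built as the square of the quarter turn sending \<open>n 2\<close> to \<open>n 3\<close>
  and \<open>n 3\<close> to \<open>- n 2\<close>, which makes it a rotation automatically.\<close>

lemma half_turn:
  assumes n: "orthonormal_basis T n"
  obtains B where "B \<in> special_orthogonal T" "B (n 1) = n 1" "B (n 2) = - n 2" "B (n 3) = - n 3"
    "\<forall>a\<in>T. B (B a) = a"
    "\<forall>a\<in>T. B a = (a \<bullet> n 1) *\<^sub>R n 1 - (a \<bullet> n 2) *\<^sub>R n 2 - (a \<bullet> n 3) *\<^sub>R n 3"
proof -
  note n' = orthonormal_basisD[OF n]
  have g: "orthonormal_basis T (triple (n 1) (n 3) (- n 2))"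
    using n'(1,2,3) by (intro orthonormal_basis_triple[OF n]) (auto intro: subspace_neg)
  define A where "A = (\<lambda>v\<in>T. \<Sum>i\<in>UNIV. (v \<bullet> n i) *\<^sub>R triple (n 1) (n 3) (- n 2) i)"
  note A = linear_isometry_of_bases[OF n g, folded A_def]
  note A' = linear_isometryD[OF A(1)]
  have An: "A (n 1) = n 1" "A (n 2) = n 3" "A (n 3) = - n 2" using A(2)[of 1] A(2)[of 2] A(2)[of 3] by simp_all
  have neg: "A (- v) = - A v" if "v \<in> T" for v using A'(4)[OF that, of "-1"] by simp
  define B where "B = compose T A A"
  have Bn: "B (n 1) = n 1" "B (n 2) = - n 2" "B (n 3) = - n 3"
    using An neg n'(2) by (simp_all add: B_def compose_eq)
  have BS: "B \<in> special_orthogonal T" unfolding B_def by (rule special_orthogonal_square[OF A(1) n'(3)])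
  then have B': "B \<in> linear_isometry T" by (simp add: special_orthogonal_iff)
  note B' = linear_isometryD[OF B']
  have B: "B a = (a \<bullet> n 1) *\<^sub>R n 1 - (a \<bullet> n 2) *\<^sub>R n 2 - (a \<bullet> n 3) *\<^sub>R n 3" if "a \<in> T" for a
  proof -
    have "B a = B ((a \<bullet> n 1) *\<^sub>R n 1 + (a \<bullet> n 2) *\<^sub>R n 2 + (a \<bullet> n 3) *\<^sub>R n 3)"
      using n'(4)[OF that] by (simp add: sum_3)
    then show ?thesis
      using B'(3,4) n'(2,3) Bn by (simp add: subspace_add subspace_scale)
  qed
  have "B (B a) = a" if "a \<in> T" for a
  proof -
    have "B a \<bullet> n 1 = a \<bullet> n 1" "B a \<bullet> n 2 = - (a \<bullet> n 2)" "B a \<bullet> n 3 = - (a \<bullet> n 3)"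
      unfolding B[OF that] by (simp_all add: inner_diff_left n'(1))
    then show ?thesis
      using n'(4)[OF that] B'(2)[OF that] by (simp add: B sum_3)
  qed
  then show ?thesis using that BS Bn B by blast
qed

text \<open>A rotation in odd dimension has a fixed vector. On the orthogonal plane it is a plane
  rotation, and the condition on its cube leaves the cosine \<open>- 1/2\<close>; the sign of the
  sine \<beta> stays open.\<close>

lemma order_three_rotation:
  assumes A: "A \<in> special_orthogonal T" and f: "orthonormal_basis T f"
    and A3: "\<And>a. a \<in> T \<Longrightarrow> A (A (A a)) = a" and ne: "\<exists>a\<in>T. A a \<noteq> a"
  obtains e \<beta> where "orthonormal_basis T e" "\<beta>\<^sup>2 = 3 / 4" "A (e 1) = e 1"
    "A (e 2) = - (1/2) *\<^sub>R e 2 + \<beta> *\<^sub>R e 3" "A (e 3) = - \<beta> *\<^sub>R e 2 - (1/2) *\<^sub>R e 3"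
proof -
  have Ai: "A \<in> linear_isometry T" using A by (simp add: special_orthogonal_iff)
  note A' = linear_isometryD[OF Ai]
  have sT: "subspace T" using orthonormal_basisD(3)[OF f] .
  have expand: "A v = (v \<bullet> e 1) *\<^sub>R A (e 1) + (v \<bullet> e 2) *\<^sub>R A (e 2) + (v \<bullet> e 3) *\<^sub>R A (e 3)"
    if e: "orthonormal_basis T e" and v: "v \<in> T" for e v
  proof -
    have "A v = A ((v \<bullet> e 1) *\<^sub>R e 1 + (v \<bullet> e 2) *\<^sub>R e 2 + (v \<bullet> e 3) *\<^sub>R e 3)"
      using orthonormal_basisD(4)[OF e v] by (simp add: sum_3)
    then show ?thesis using A'(3,4) orthonormal_basisD(2,3)[OF e] by (simp add: subspace_add subspace_scale)
  qed
  obtain u where u: "u \<in> T" "u \<noteq> 0" "A u = u"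
  proof -
    define M where "M = (\<chi> i j. f i \<bullet> A (f j) :: real ^ 3 ^ 3)"
    have "det M = 1" using A f by (simp add: special_orthogonal_iff M_def)
    have "(\<Sum>k\<in>UNIV. (f k \<bullet> A (f i)) * (f k \<bullet> A (f j))) = (if i = j then 1 else 0)" for i j
      using orthonormal_basis_inner[OF f A'(2)[OF orthonormal_basisD(2)[OF f]], of i "A (f j)"]
        A'(5)[of "f i" "f j"] orthonormal_basisD(1,2)[OF f] by (simp add: inner_commute[of "A (f i)" "f _"])
    then have MM: "transpose M ** M = mat 1"
      by (simp add: M_def matrix_matrix_mult_def vec_eq_iff transpose_def mat_def)
    \<comment> \<open>For orthogonal \<open>M\<close> the product
      \<open>transpose M ** (M - mat 1)\<close> is \<open>- transpose (M - mat 1)\<close>. Taking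
      determinants in dimension three, \<open>det (M - mat 1)\<close> equals its own
      negative.\<close>
    have "transpose M ** (M - mat 1) + transpose M ** mat 1 = mat 1"
      by (simp only: matrix_add_ldistrib[symmetric]) (simp add: MM)
    then have "transpose M ** (M - mat 1) = mat 1 - transpose M" by (simp add: eq_diff_eq)
    also have "\<dots> = - transpose (M - mat 1)"
      by (auto simp: transpose_def vec_eq_iff mat_def)
    finally have "transpose M ** (M - mat 1) = - transpose (M - mat 1)" .
    then have "det (transpose M) * det (M - mat 1) = det (- transpose (M - mat 1))"
      by (metis det_mul)
    also have "\<dots> = - det (M - mat 1)"
      using det_transpose[of "M - mat 1"] by (simp add: det_3)
    finally have "det (M - mat 1) = 0" using \<open>det M = 1\<close> by (simp add: det_transpose)
    then have "\<not> invertible (M - mat 1)" by (simp add: invertible_det_nz)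
    then obtain x where x: "x \<noteq> 0" "(M - mat 1) *v x = 0"
      by (metis invertible_left_inverse matrix_left_invertible_ker)
    then have Mx: "M *v x = x" by (simp add: matrix_vector_mult_diff_rdistrib)
    define u where "u = (\<Sum>i\<in>UNIV. (x $ i) *\<^sub>R f i)"
    have uf: "u \<bullet> f i = x $ i" for i
      unfolding u_def inner_sum_left inner_scaleR_left orthonormal_basisD(1)[OF f] by (simp add: mult_delta_right)
    have uT: "u \<in> T" unfolding u_def by (intro subspace_sum subspace_scale orthonormal_basisD(2,3)[OF f])
    have "A u \<bullet> f i = u \<bullet> f i" for i
    proof -
      have "A u \<bullet> f i = (M *v x) $ i"
        unfolding expand[OF f uT] uf
        by (simp add: M_def matrix_vector_mult_def sum_3 inner_left_distrib inner_commute[of "A _"] mult.commute)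
      then show ?thesis using Mx uf by simp
    qed
    then have "(\<Sum>i\<in>UNIV. (A u \<bullet> f i) *\<^sub>R f i) = (\<Sum>i\<in>UNIV. (u \<bullet> f i) *\<^sub>R f i)" by simp
    then have "A u = u"
      unfolding orthonormal_basisD(4)[OF f uT, symmetric] orthonormal_basisD(4)[OF f A'(2)[OF uT], symmetric] .
    moreover have "u \<noteq> 0" using uf x(1) by (auto simp: vec_eq_iff)
    ultimately show ?thesis using that uT by blast
  qed
  define E where "E = (1 / norm u) *\<^sub>R u"
  have E: "E \<in> T" "norm E = 1" "A E = E"
    using u sT A'(4) by (simp_all add: E_def subspace_scale)
  obtain e where e: "orthonormal_basis T e" "e 1 = E" using orthonormal_basis_extend[OF f E(1,2)] .
  note e' = orthonormal_basisD[OF e(1)]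
  have A1: "A (e 1) = e 1" using E(3) e(2) by simp
  have perp: "A (e i) \<bullet> e 1 = e i \<bullet> e 1" for i using A'(5)[OF e'(2) e'(2), of i 1] A1 by simp
  define \<alpha> \<beta> \<gamma> \<delta> where "\<alpha> = A (e 2) \<bullet> e 2" and "\<beta> = A (e 2) \<bullet> e 3"
    and "\<gamma> = A (e 3) \<bullet> e 2" and "\<delta> = A (e 3) \<bullet> e 3"
  have A2: "A (e 2) = \<alpha> *\<^sub>R e 2 + \<beta> *\<^sub>R e 3" and A3': "A (e 3) = \<gamma> *\<^sub>R e 2 + \<delta> *\<^sub>R e 3"
    using e'(4)[OF A'(2)[OF e'(2)], of 2] e'(4)[OF A'(2)[OF e'(2)], of 3] perp
    by (simp_all add: sum_3 \<alpha>_def \<beta>_def \<gamma>_def \<delta>_def e'(1))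
  have "det (\<chi> i j. e i \<bullet> A (e j) :: real ^ 3 ^ 3) = 1"
    using A e(1) by (simp add: special_orthogonal_iff)
  then have d: "\<alpha> * \<delta> - \<beta> * \<gamma> = 1"
    by (simp add: det_3 A1 A2 A3' inner_right_distrib e'(1) mult.commute)
  have n: "\<alpha>\<^sup>2 + \<beta>\<^sup>2 = 1" "\<gamma>\<^sup>2 + \<delta>\<^sup>2 = 1"
    using A'(5)[OF e'(2) e'(2), of 2 2] A'(5)[OF e'(2) e'(2), of 3 3]
    by (simp_all add: A2 A3' inner_add_left inner_add_right e'(1) power2_eq_square)
  \<comment> \<open>The left side is the sum of the squared column norms minus twice the
    determinant, that is \<open>2 - 2\<close>.\<close>
  have "(\<alpha> - \<delta>)\<^sup>2 + (\<beta> + \<gamma>)\<^sup>2 = 0"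
    using d n by (simp add: power2_eq_square algebra_simps)
  then have "\<delta> = \<alpha>" "\<gamma> = - \<beta>"
    by (simp_all add: sum_power2_eq_zero_iff)
  then have A3: "A (e 3) = - \<beta> *\<^sub>R e 2 + \<alpha> *\<^sub>R e 3" using A3' by simp
  have comb: "A (x *\<^sub>R e 2 + y *\<^sub>R e 3) = x *\<^sub>R A (e 2) + y *\<^sub>R A (e 3)" for x y
    using A'(3)[of "x *\<^sub>R e 2" "y *\<^sub>R e 3"] A'(4)[OF e'(2)] subspace_scale[OF e'(3) e'(2)] by simp
  have "A (A (e 2)) = \<alpha> *\<^sub>R A (e 2) + \<beta> *\<^sub>R A (e 3)"
    by (subst A2) (rule comb)
  also have "\<dots> = (\<alpha>\<^sup>2 - \<beta>\<^sup>2) *\<^sub>R e 2 + (2 * \<alpha> * \<beta>) *\<^sub>R e 3"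
  proof -
    have "(2 * \<alpha> * \<beta>) *\<^sub>R e 3 = (\<alpha> * \<beta>) *\<^sub>R e 3 + (\<beta> * \<alpha>) *\<^sub>R e 3"
      by (simp add: scaleR_left.add[symmetric] mult.commute)
    then show ?thesis
      unfolding A2 A3 by (simp add: power2_eq_square scaleR_left_diff_distrib scaleR_right_distrib scaleR_right_diff_distrib)
  qed
  finally have AA: "A (A (e 2)) = (\<alpha>\<^sup>2 - \<beta>\<^sup>2) *\<^sub>R e 2 + (2 * \<alpha> * \<beta>) *\<^sub>R e 3" .
  have "e 2 = A (A (A (e 2)))" by (rule assms(3)[OF e'(2), symmetric])
  also have "\<dots> = A ((\<alpha>\<^sup>2 - \<beta>\<^sup>2) *\<^sub>R e 2 + (2 * \<alpha> * \<beta>) *\<^sub>R e 3)" by (rule arg_cong[OF AA])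
  also have "\<dots> = (\<alpha>\<^sup>2 - \<beta>\<^sup>2) *\<^sub>R A (e 2) + (2 * \<alpha> * \<beta>) *\<^sub>R A (e 3)" by (rule comb)
  finally have "e 2 = (\<alpha>\<^sup>2 - \<beta>\<^sup>2) *\<^sub>R A (e 2) + (2 * \<alpha> * \<beta>) *\<^sub>R A (e 3)" .
  from arg_cong[OF this, of "\<lambda>v. v \<bullet> e 2"]
  have "e 2 \<bullet> e 2 = ((\<alpha>\<^sup>2 - \<beta>\<^sup>2) *\<^sub>R A (e 2) + (2 * \<alpha> * \<beta>) *\<^sub>R A (e 3)) \<bullet> e 2" .
  then have cub: "1 = (\<alpha>\<^sup>2 - \<beta>\<^sup>2) * \<alpha> - 2 * \<alpha> * \<beta> * \<beta>"
    unfolding A2 A3 by (simp add: inner_add_left inner_diff_left e'(1))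
  have b2: "\<beta>\<^sup>2 = 1 - \<alpha>\<^sup>2" using n(1) by simp
  \<comment> \<open>This is the factorized form of the triple angle equation
    \<open>4 \<alpha>^3 - 3 \<alpha> = 1\<close>.\<close>
  have "(\<alpha> - 1) * (2 * \<alpha> + 1)\<^sup>2 = 0"
  proof -
    have "(\<alpha> - 1) * (2 * \<alpha> + 1)\<^sup>2 = 4 * \<alpha> * \<alpha>\<^sup>2 - 3 * \<alpha> - 1" by (simp add: power2_eq_square algebra_simps)
    also have "\<dots> = (\<alpha>\<^sup>2 - \<beta>\<^sup>2) * \<alpha> - 2 * \<alpha> * \<beta>\<^sup>2 - 1" unfolding b2 by (simp add: algebra_simps)
    also have "\<dots> = 0" using cub by (simp add: power2_eq_square)
    finally show ?thesis .
  qed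
  moreover have "\<alpha> \<noteq> 1"
  proof
    assume "\<alpha> = 1"
    then have "\<beta> = 0" using b2 by simp
    have "A v = v" if "v \<in> T" for v
      using expand[OF e(1) that] e'(4)[OF that, symmetric] A1 A2 A3 \<open>\<alpha> = 1\<close> \<open>\<beta> = 0\<close> by (simp add: sum_3)
    then show False using ne by blast
  qed
  ultimately have \<alpha>: "\<alpha> = - 1/2" by simp
  show ?thesis
  proof (rule that[of e \<beta>])
    show "\<beta>\<^sup>2 = 3 / 4" using b2 \<alpha> by (simp add: power2_eq_square)
    show "A (e 2) = - (1/2) *\<^sub>R e 2 + \<beta> *\<^sub>R e 3" "A (e 3) = - \<beta> *\<^sub>R e 2 - (1/2) *\<^sub>R e 3"
      using A2 A3 \<alpha> by simp_all
  qed (use e A1 in auto)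
qed

section \<open>Normal form of a traceless cubic with stabilizer of order three\<close>

locale symmetric_cubic =
  fixes C :: "'a::euclidean_space \<Rightarrow> 'a \<Rightarrow> 'a \<Rightarrow> real"
  assumes lin: "linear (C a b)" and sym12: "C a b c = C b a c" and sym23: "C a b c = C a c b"
begin

lemma cubic_add: "C a b (c + c') = C a b c + C a b c'" "C a (b + b') c = C a b c + C a b' c"
    "C (a + a') b c = C a b c + C a' b c"
  using linear_add[OF lin] sym12 sym23 by metis+

lemma cubic_scale: "C a b (r *\<^sub>R c) = r * C a b c" "C a (r *\<^sub>R b) c = r * C a b c"
    "C (r *\<^sub>R a) b c = r * C a b c"
  using linear_cmul[OF lin] sym12 sym23 by (metis real_scaleR_def)+

lemma cubic_minus: "C a b (- c) = - C a b c" "C a (- b) c = - C a b c" "C (- a) b c = - C a b c"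
  using cubic_scale(1)[of a b "-1" c] cubic_scale(2)[of a "-1" b c] cubic_scale(3)[of "-1" a b c] by simp_all

lemma cubic_diff: "C a b (c - c') = C a b c - C a b c'" "C a (b - b') c = C a b c - C a b' c"
    "C (a - a') b c = C a b c - C a' b c"
  using cubic_add(1)[of a b c "- c'"] cubic_add(2)[of a b "- b'" c] cubic_add(3)[of a "- a'" b c]
  by (simp_all add: cubic_minus)

lemmas cubic_linear = cubic_add cubic_scale cubic_minus cubic_diff

lemma cubic_sort: "C (e 2) (e 1) x = C (e 1) (e 2) x" "C (e 3) (e 1) x = C (e 1) (e 3) x"
    "C (e 3) (e 2) x = C (e 2) (e 3) x" "C x (e 2) (e 1) = C x (e 1) (e 2)"
    "C x (e 3) (e 1) = C x (e 1) (e 3)" "C x (e 3) (e 2) = C x (e 2) (e 3)" for e :: "3 \<Rightarrow> 'a"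
  using sym12 sym23 by auto

definition normal_form :: "(3 \<Rightarrow> 'a) \<Rightarrow> real \<Rightarrow> real \<Rightarrow> bool" where
  "normal_form e r s \<longleftrightarrow> C (e 1) (e 1) (e 1) = 2 * r \<and> C (e 1) (e 1) (e 2) = 0 \<and> C (e 1) (e 1) (e 3) = 0 \<and>
     C (e 1) (e 2) (e 2) = - r \<and> C (e 1) (e 2) (e 3) = 0 \<and> C (e 1) (e 3) (e 3) = - r \<and>
     C (e 2) (e 2) (e 2) = s \<and> C (e 2) (e 2) (e 3) = 0 \<and> C (e 2) (e 3) (e 3) = - s \<and>
     C (e 3) (e 3) (e 3) = 0"

lemma traceless_basis:
  assumes "orthonormal_basis T f" "orthonormal_basis T e" "\<And>a. (\<Sum>i\<in>UNIV. C a (f i) (f i)) = 0"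
  shows "(\<Sum>i\<in>UNIV. C a (e i) (e i)) = 0"
  using orthonormal_basis_trace[OF assms(2,1), of "C a"] assms(3)[of a]
  by (simp add: lin linearI cubic_linear)

text \<open>The vanishing components are those with an odd number of indices 2 and 3, so the cubic
  is even under the half turn about \<open>n 1\<close>, which would be an involution in the
  stabilizer.\<close>

lemma half_turn_contradiction:
  assumes n: "orthonormal_basis T n"
    and C0: "C (n 1) (n 1) (n 2) = 0" "C (n 1) (n 1) (n 3) = 0" "C (n 2) (n 2) (n 2) = 0"
      "C (n 2) (n 2) (n 3) = 0" "C (n 2) (n 3) (n 3) = 0" "C (n 3) (n 3) (n 3) = 0"
    and inv: "\<forall>B. cubic_symmetry T C B \<and> (\<forall>a\<in>T. B (B a) = a) \<longrightarrow> (\<forall>a\<in>T. B a = a)"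
  shows False
proof -
  obtain B where B: "B \<in> special_orthogonal T" "B (n 1) = n 1" "B (n 2) = - n 2" "B (n 3) = - n 3" "\<forall>a\<in>T. B (B a) = a"
    "\<forall>a\<in>T. B a = (a \<bullet> n 1) *\<^sub>R n 1 - (a \<bullet> n 2) *\<^sub>R n 2 - (a \<bullet> n 3) *\<^sub>R n 3"
    by (rule half_turn[OF n])
  have C: "C (x1 *\<^sub>R n 1 + x2 *\<^sub>R n 2 + x3 *\<^sub>R n 3) (y1 *\<^sub>R n 1 + y2 *\<^sub>R n 2 + y3 *\<^sub>R n 3)
        (z1 *\<^sub>R n 1 + z2 *\<^sub>R n 2 + z3 *\<^sub>R n 3)
      = x1 * y1 * z1 * C (n 1) (n 1) (n 1) + (x1 * y2 * z2 + x2 * y1 * z2 + x2 * y2 * z1) * C (n 1) (n 2) (n 2)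
        + (x1 * y3 * z3 + x3 * y1 * z3 + x3 * y3 * z1) * C (n 1) (n 3) (n 3)
        + (x1 * y2 * z3 + x1 * y3 * z2 + x2 * y1 * z3 + x3 * y1 * z2 + x2 * y3 * z1 + x3 * y2 * z1) * C (n 1) (n 2) (n 3)"
    for x1 x2 x3 y1 y2 y3 z1 z2 z3
    by (simp add: cubic_linear cubic_sort[where e = n] C0 algebra_simps)
  have Bn: "B a = (a \<bullet> n 1) *\<^sub>R n 1 + (- (a \<bullet> n 2)) *\<^sub>R n 2 + (- (a \<bullet> n 3)) *\<^sub>R n 3" if "a \<in> T" for a
    using B(6) that by simp
  have an: "a = (a \<bullet> n 1) *\<^sub>R n 1 + (a \<bullet> n 2) *\<^sub>R n 2 + (a \<bullet> n 3) *\<^sub>R n 3" if "a \<in> T" for a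
    using orthonormal_basisD(4)[OF n that] by (simp add: sum_3)
  have "C (B a) (B b) (B c) = C a b c" if "a \<in> T" "b \<in> T" "c \<in> T" for a b c
  proof -
    have "C a b c = C ((a \<bullet> n 1) *\<^sub>R n 1 + (a \<bullet> n 2) *\<^sub>R n 2 + (a \<bullet> n 3) *\<^sub>R n 3)
        ((b \<bullet> n 1) *\<^sub>R n 1 + (b \<bullet> n 2) *\<^sub>R n 2 + (b \<bullet> n 3) *\<^sub>R n 3)
        ((c \<bullet> n 1) *\<^sub>R n 1 + (c \<bullet> n 2) *\<^sub>R n 2 + (c \<bullet> n 3) *\<^sub>R n 3)"
      by (simp only: an[OF that(1), symmetric] an[OF that(2), symmetric] an[OF that(3), symmetric])
    then show ?thesis
      unfolding Bn[OF that(1)] Bn[OF that(2)] Bn[OF that(3)] C by simp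
  qed
  then have "cubic_symmetry T C B" using B(1) by (simp add: cubic_symmetry_def)
  then have "B (n 2) = n 2" using inv B(5) orthonormal_basisD(2)[OF n] by blast
  then have "(- n 2) \<bullet> n 2 = n 2 \<bullet> n 2" using B(3) by metis
  then show False using orthonormal_basisD(1)[OF n, of 2 2] by simp
qed

text \<open>A third of a turn acts without fixed vectors on the parts of the cubic that have weight
  one and two about the axis, so these vanish. Tracelessness fixes the weight zero part up to
  \<open>r\<close>, and turning the basis of the plane brings the weight three part to one
  coefficient \<open>s\<close>.\<close>

lemma Z3_normal_form:
  assumes iso: "cubic_stabilizer T C \<cong> integer_mod_group 3" and f: "orthonormal_basis T f"
    and tr: "\<And>a. (\<Sum>i\<in>UNIV. C a (f i) (f i)) = 0"
  obtains e r s where "orthonormal_basis T e" "normal_form e r s" "r \<noteq> 0" "s\<^sup>2 \<noteq> 2 * r\<^sup>2"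
proof -
  obtain A where A': "cubic_symmetry T C A" "\<forall>a\<in>T. A (A (A a)) = a" "\<exists>a\<in>T. A a \<noteq> a"
    and inv: "\<forall>B. cubic_symmetry T C B \<and> (\<forall>a\<in>T. B (B a) = a) \<longrightarrow> (\<forall>a\<in>T. B a = a)"
    by (rule cubic_stabilizer_Z3[OF iso orthonormal_basisD(3)[OF f]])
  have A: "A \<in> special_orthogonal T" "\<And>a b c. a \<in> T \<Longrightarrow> b \<in> T \<Longrightarrow> c \<in> T \<Longrightarrow> C (A a) (A b) (A c) = C a b c"
    "\<And>a. a \<in> T \<Longrightarrow> A (A (A a)) = a"
    using A' by (simp_all add: cubic_symmetry_def)
  obtain g \<beta> where g: "orthonormal_basis T g" and \<beta>: "\<beta>\<^sup>2 = 3 / 4" and Ag: "A (g 1) = g 1"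
    "A (g 2) = - (1/2) *\<^sub>R g 2 + \<beta> *\<^sub>R g 3" "A (g 3) = - \<beta> *\<^sub>R g 2 - (1/2) *\<^sub>R g 3"
    by (rule order_three_rotation[OF A(1) f A(3) A'(3)])
  note gT = orthonormal_basisD(2)[OF g]
  have Ag3: "A (g 3) = (- \<beta>) *\<^sub>R g 2 + (- (1/2)) *\<^sub>R g 3" using Ag(3) by simp
  note Ag' = Ag(1,2) Ag3
  have \<beta>2: "\<beta> * \<beta> = 3 / 4" using \<beta> by (simp add: power2_eq_square)
  have e112: "C (g 1) (g 1) (g 2) = 0" and e113: "C (g 1) (g 1) (g 3) = 0"
  proof -
    have 1: "3 * C (g 1) (g 1) (g 2) = 2 * \<beta> * C (g 1) (g 1) (g 3)"
      using A(2)[OF gT[of 1] gT[of 1] gT[of 2]] unfolding Ag' by (simp add: cubic_linear)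
    have 2: "3 * C (g 1) (g 1) (g 3) = - 2 * \<beta> * C (g 1) (g 1) (g 2)"
      using A(2)[OF gT[of 1] gT[of 1] gT[of 3]] unfolding Ag' by (simp add: cubic_linear)
    have "3 * (3 * C (g 1) (g 1) (g 2)) = 2 * \<beta> * (3 * C (g 1) (g 1) (g 3))" using 1 by simp
    also have "\<dots> = - 4 * (\<beta> * \<beta>) * C (g 1) (g 1) (g 2)" unfolding 2 by simp
    finally show "C (g 1) (g 1) (g 2) = 0" unfolding \<beta>2 by simp
    then show "C (g 1) (g 1) (g 3) = 0" using 2 by simp
  qed
  have e123: "C (g 1) (g 2) (g 3) = 0" and e133: "C (g 1) (g 3) (g 3) = C (g 1) (g 2) (g 2)"
  proof -
    let ?a = "C (g 1) (g 2) (g 2)" and ?b = "C (g 1) (g 2) (g 3)" and ?c = "C (g 1) (g 3) (g 3)"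
    have "?a = ?a / 4 - \<beta> * ?b + (\<beta> * \<beta>) * ?c"
      using A(2)[OF gT[of 1] gT[of 2] gT[of 2]] unfolding Ag' by (simp add: cubic_linear cubic_sort algebra_simps)
    then have 1: "3 * (?a - ?c) = - 4 * \<beta> * ?b" unfolding \<beta>2 by (simp add: algebra_simps)
    have "?b = \<beta> / 2 * (?a - ?c) + (1/4 - \<beta> * \<beta>) * ?b"
      using A(2)[OF gT[of 1] gT[of 2] gT[of 3]] unfolding Ag' by (simp add: cubic_linear cubic_sort algebra_simps)
    then have 2: "3 * ?b = \<beta> * (?a - ?c)" unfolding \<beta>2 by (simp add: algebra_simps)
    have "3 * (3 * ?b) = \<beta> * (3 * (?a - ?c))" unfolding 2 by simp
    also have "\<dots> = - 4 * (\<beta> * \<beta>) * ?b" unfolding 1 by simp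
    finally show "?b = 0" unfolding \<beta>2 by simp
    then show "?c = ?a" using 1 by simp
  qed
  define r where "r = - C (g 1) (g 2) (g 2)"
  define x y where "x = C (g 2) (g 2) (g 2)" and "y = C (g 2) (g 2) (g 3)"
  have tg: "(\<Sum>i\<in>UNIV. C a (g i) (g i)) = 0" for a by (rule traceless_basis[OF f g tr])
  have e111: "C (g 1) (g 1) (g 1) = 2 * r" using tg[of "g 1"] e133 by (simp add: sum_3 r_def)
  have e233: "C (g 2) (g 3) (g 3) = - x" using tg[of "g 2"] e112 by (simp add: sum_3 x_def cubic_sort[where e = g])
  have e333: "C (g 3) (g 3) (g 3) = - y" using tg[of "g 3"] e113 by (simp add: sum_3 y_def cubic_sort[where e = g])
  \<comment> \<open>In the plane the cubic is the real part of \<open>Complex x (- y)\<close> times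
    the cube of \<open>x2 + i x3\<close>. Turning the basis by \<open>w\<close> multiplies the
    coefficient by \<open>w ^ 3\<close>, and \<open>w\<close> is the phase that makes it
    real.\<close>
  obtain u v :: real where uv: "u\<^sup>2 + v\<^sup>2 = 1" "x * (v ^ 3 - 3 * u\<^sup>2 * v) + y * (u ^ 3 - 3 * u * v\<^sup>2) = 0"
  proof -
    define z where "z = Complex x (- y)"
    define w where "w = cis (- Arg z / 3)"
    have "z * w ^ 3 = of_real (norm z)"
    proof -
      have "w ^ 3 = cis (- Arg z)" unfolding w_def by (simp add: Complex.DeMoivre)
      moreover have "z = norm z * cis (Arg z)" by (metis rcis_cmod_Arg rcis_def)
      ultimately show ?thesis by (metis cis_mult mult.assoc add.right_inverse cis_zero mult.right_neutral)
    qed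
    then have "Im (z * w ^ 3) = 0" by simp
    moreover have "w ^ 3 = Complex (Re w ^ 3 - 3 * Re w * (Im w)\<^sup>2) (3 * (Re w)\<^sup>2 * Im w - Im w ^ 3)"
      by (simp add: complex_eq_iff power3_eq_cube power2_eq_square algebra_simps)
    ultimately have "x * (3 * (Re w)\<^sup>2 * Im w - Im w ^ 3) - y * (Re w ^ 3 - 3 * Re w * (Im w)\<^sup>2) = 0"
      by (simp add: z_def)
    moreover have "(Re w)\<^sup>2 + (Im w)\<^sup>2 = 1" by (simp add: w_def)
    ultimately show ?thesis using that[of "Re w" "Im w"] by (simp add: algebra_simps)
  qed
  define e where "e = triple (g 1) (u *\<^sub>R g 2 + v *\<^sub>R g 3) ((- v) *\<^sub>R g 2 + u *\<^sub>R g 3)"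
  have gT': "subspace T" using orthonormal_basisD(3)[OF g] .
  have uv': "u * u + v * v = 1" using uv(1) by (simp add: power2_eq_square)
  have e: "orthonormal_basis T e"
    unfolding e_def using gT gT' uv'
    by (intro orthonormal_basis_triple[OF g])
      (simp_all add: subspace_add subspace_scale inner_add_left inner_add_right orthonormal_basisD(1)[OF g]
        subspace_diff algebra_simps)
  have te: "(\<Sum>i\<in>UNIV. C a (e i) (e i)) = 0" for a by (rule traceless_basis[OF f e tr])
  define s where "s = C (e 2) (e 2) (e 2)"
  note G = e111 e112 e113 e123 e133 e233 e333 x_def[symmetric] y_def[symmetric]
  have c122: "C (g 1) (g 2) (g 2) = - r" by (simp add: r_def)
  have c223: "C (e 2) (e 2) (e 3) = 0"
  proof -
    have "C (e 2) (e 2) (e 3) = x * (v ^ 3 - 3 * u\<^sup>2 * v) + y * (u ^ 3 - 3 * u * v\<^sup>2)"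
      by (simp add: e_def cubic_linear cubic_sort[where e = g] G power2_eq_square power3_eq_cube algebra_simps)
    then show ?thesis using uv(2) by simp
  qed
  have "u * (u * r) + v * (v * r) = r"
    using uv' by (metis distrib_right mult.assoc mult_1)
  then have c1: "C (e 1) (e 1) (e 2) = 0" "C (e 1) (e 1) (e 3) = 0" "C (e 1) (e 2) (e 2) = - r" "C (e 1) (e 2) (e 3) = 0"
    by (simp_all add: e_def cubic_linear cubic_sort[where e = g] G c122 algebra_simps)
  have c111: "C (e 1) (e 1) (e 1) = 2 * r" by (simp add: e_def G)
  have c: "C (e 1) (e 3) (e 3) = - r" "C (e 2) (e 3) (e 3) = - s" "C (e 3) (e 3) (e 3) = 0"
    using te[of "e 1"] te[of "e 2"] te[of "e 3"] c1 c111 c223 by (simp_all add: sum_3 cubic_sort[where e = e] s_def)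
  have nf: "normal_form e r s"
    unfolding normal_form_def using c c1 c111 c223 by (simp add: s_def)
  note eT = orthonormal_basisD(2)[OF e]
  have r: "r \<noteq> 0"
  proof
    assume "r = 0"
    \<comment> \<open>For \<open>r = 0\<close> the cubic is \<open>s (x2^3 - 3 x2 x3^2)\<close>,
      invariant under the half turn about \<open>e 2\<close>.\<close>
    have "orthonormal_basis T (triple (e 2) (e 1) (e 3))"
      by (rule orthonormal_basis_triple[OF e]) (simp_all add: eT orthonormal_basisD(1)[OF e])
    then show False
      by (rule half_turn_contradiction[OF _ _ _ _ _ _ _ inv])
        (use nf \<open>r = 0\<close> in \<open>auto simp: normal_form_def cubic_sort[where e = e]\<close>)
  qed
  have "s\<^sup>2 \<noteq> 2 * r\<^sup>2"
  proof
    assume s: "s\<^sup>2 = 2 * r\<^sup>2"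
    \<comment> \<open>This is the tetrahedral cubic, a multiple of the product of three orthonormal
      coordinates, with \<open>e 1\<close> along a diagonal. The vector
      \<open>e 1 + \<tau> e 2\<close> points along a coordinate axis, which is the axis of a half
      turn.\<close>
    define \<tau> where "\<tau> = s / r"
    have \<tau>: "s = \<tau> * r" "\<tau> * \<tau> = 2"
      using r s by (simp_all add: \<tau>_def power2_eq_square field_simps)
    define k where "k = 1 / sqrt 3"
    have k: "k * k = 1 / 3" by (simp add: k_def)
    have "k * (\<tau> * (k * \<tau>)) = (k * k) * (\<tau> * \<tau>)" by (simp only: ac_simps)
    then have kt: "k * (\<tau> * (k * \<tau>)) = 2 / 3" using k \<tau>(2) by simp
    let ?n = "triple (k *\<^sub>R (e 1 + \<tau> *\<^sub>R e 2)) (k *\<^sub>R (\<tau> *\<^sub>R e 1 + (-1) *\<^sub>R e 2)) (e 3)"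
    have n: "orthonormal_basis T ?n"
      using eT orthonormal_basisD(3)[OF e]
      by (intro orthonormal_basis_triple[OF e])
        (simp_all add: k kt subspace_add subspace_scale subspace_diff inner_add_left inner_add_right inner_diff_left
          inner_diff_right orthonormal_basisD(1)[OF e] distrib_left)
    have \<tau>2: "\<tau> * (\<tau> * z) = 2 * z" for z using \<tau>(2) by (simp add: mult.assoc[symmetric])
    show False
      by (rule half_turn_contradiction[OF n _ _ _ _ _ _ inv])
        (use nf in \<open>simp_all add: normal_form_def cubic_linear cubic_sort[where e = e] \<tau>(1) algebra_simps \<tau>2\<close>)
  qed
  then show ?thesis using that e nf r by blast
qed

subsection \<open>A covariant vector along the axis of symmetry\<close>

definition quadratic_covariant :: "(3 \<Rightarrow> 'a) \<Rightarrow> 'a \<Rightarrow> 'a \<Rightarrow> real" where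
  "quadratic_covariant f a b = (\<Sum>k\<in>UNIV. \<Sum>l\<in>UNIV. C a (f k) (f l) * C b (f k) (f l))"

text \<open>Contracting a traceless cubic with the metric gives zero, so it is contracted with a
  quadratic form built from itself; the result has degree three in the cubic.\<close>

definition linear_covariant :: "(3 \<Rightarrow> 'a) \<Rightarrow> 'a \<Rightarrow> real" where
  "linear_covariant f a = (\<Sum>j\<in>UNIV. \<Sum>k\<in>UNIV. C a (f j) (f k) * quadratic_covariant f (f j) (f k))"

lemma quadratic_covariant_basis:
  assumes "orthonormal_basis T e" "orthonormal_basis T f"
  shows "quadratic_covariant f a b = quadratic_covariant e a b"
proof -
  have "(\<Sum>l\<in>UNIV. C a x (f l) * C b x (f l)) = (\<Sum>l\<in>UNIV. C a x (e l) * C b x (e l))" for x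
    by (rule orthonormal_basis_trace[OF assms, of "\<lambda>y z. C a x y * C b x z"])
      (auto intro!: linearI simp: cubic_linear algebra_simps)
  moreover have "(\<Sum>k\<in>UNIV. \<Sum>l\<in>UNIV. C a (f k) (e l) * C b (f k) (e l))
      = (\<Sum>k\<in>UNIV. \<Sum>l\<in>UNIV. C a (e k) (e l) * C b (e k) (e l))"
    by (rule orthonormal_basis_trace[OF assms, of "\<lambda>y z. \<Sum>l\<in>UNIV. C a y (e l) * C b z (e l)"])
      (auto intro!: linearI simp: cubic_linear algebra_simps sum.distrib sum_distrib_left)
  ultimately show ?thesis by (simp add: quadratic_covariant_def)
qed

lemma linear_quadratic_covariant:
  "linear (quadratic_covariant e a)" "linear (\<lambda>a. quadratic_covariant e a b)"
  by (auto intro!: linearI simp: quadratic_covariant_def cubic_linear algebra_simps sum.distrib sum_distrib_left)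

lemma linear_covariant_basis:
  assumes e: "orthonormal_basis T e" and f: "orthonormal_basis T f"
  shows "linear_covariant f a = linear_covariant e a"
proof -
  have q: "quadratic_covariant e (x + y) z = quadratic_covariant e x z + quadratic_covariant e y z"
    "quadratic_covariant e z (x + y) = quadratic_covariant e z x + quadratic_covariant e z y"
    "quadratic_covariant e (r *\<^sub>R x) z = r * quadratic_covariant e x z"
    "quadratic_covariant e z (r *\<^sub>R x) = r * quadratic_covariant e z x" for x y z r
    using linear_add[OF linear_quadratic_covariant(1)] linear_add[OF linear_quadratic_covariant(2)]
      linear_cmul[OF linear_quadratic_covariant(1)] linear_cmul[OF linear_quadratic_covariant(2)]
    by (auto simp del: linear_covariant_def)
  have "(\<Sum>k\<in>UNIV. C a x (f k) * quadratic_covariant e x (f k)) =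
      (\<Sum>k\<in>UNIV. C a x (e k) * quadratic_covariant e x (e k))" for x
    by (rule orthonormal_basis_trace[OF e f, of "\<lambda>y z. C a x y * quadratic_covariant e x z"])
      (auto intro!: linearI simp: cubic_linear q algebra_simps)
  moreover have "(\<Sum>j\<in>UNIV. \<Sum>k\<in>UNIV. C a (f j) (e k) * quadratic_covariant e (f j) (e k)) =
      (\<Sum>j\<in>UNIV. \<Sum>k\<in>UNIV. C a (e j) (e k) * quadratic_covariant e (e j) (e k))"
    by (rule orthonormal_basis_trace[OF e f, of "\<lambda>y z. \<Sum>k\<in>UNIV. C a y (e k) * quadratic_covariant e z (e k)"])
      (auto intro!: linearI simp: cubic_linear q algebra_simps sum.distrib sum_distrib_left)
  ultimately show ?thesis
    by (simp add: linear_covariant_def quadratic_covariant_basis[OF e f])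
qed

text \<open>The first value is nonzero exactly when both cases with a half turn,
  \<open>r = 0\<close> and \<open>s\<^sup>2 = 2 * r\<^sup>2\<close>, are excluded; the form then
  determines the axis.\<close>

lemma linear_covariant_normal_form:
  assumes "normal_form e r s"
  shows "linear_covariant e (e 1) = 4 * r * (2 * r\<^sup>2 - s\<^sup>2)" "linear_covariant e (e 2) = 0"
    "linear_covariant e (e 3) = 0"
proof -
  have n: "C (e 1) (e 1) (e 1) = 2 * r" "C (e 1) (e 1) (e 2) = 0" "C (e 1) (e 1) (e 3) = 0"
     "C (e 1) (e 2) (e 2) = - r" "C (e 1) (e 2) (e 3) = 0" "C (e 1) (e 3) (e 3) = - r"
     "C (e 2) (e 2) (e 2) = s" "C (e 2) (e 2) (e 3) = 0" "C (e 2) (e 3) (e 3) = - s"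
     "C (e 3) (e 3) (e 3) = 0"
    using assms by (simp_all add: normal_form_def)
  have Q: "quadratic_covariant e (e 1) (e 1) = 6 * r\<^sup>2" "quadratic_covariant e (e 2) (e 2) = 2 * r\<^sup>2 + 2 * s\<^sup>2"
    "quadratic_covariant e (e 3) (e 3) = 2 * r\<^sup>2 + 2 * s\<^sup>2"
    "quadratic_covariant e (e 1) (e 2) = 0" "quadratic_covariant e (e 1) (e 3) = 0"
    "quadratic_covariant e (e 2) (e 3) = 0" "quadratic_covariant e (e 2) (e 1) = 0"
    "quadratic_covariant e (e 3) (e 1) = 0" "quadratic_covariant e (e 3) (e 2) = 0"
    by (simp_all add: quadratic_covariant_def sum_3 cubic_sort[where e = e] n power2_eq_square)
  show "linear_covariant e (e 1) = 4 * r * (2 * r\<^sup>2 - s\<^sup>2)" "linear_covariant e (e 2) = 0"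
    "linear_covariant e (e 3) = 0"
    by (simp_all add: linear_covariant_def sum_3 cubic_sort[where e = e] n Q algebra_simps)
qed

definition axis :: "(3 \<Rightarrow> 'a) \<Rightarrow> 'a" where
  "axis f = (\<Sum>i\<in>UNIV. linear_covariant f (f i) *\<^sub>R f i)"

lemma linear_covariant_linear: "linear (linear_covariant f)"
  by (auto intro!: linearI simp: linear_covariant_def cubic_linear algebra_simps sum.distrib sum_distrib_left)

text \<open>\<open>axis f\<close> is the vector dual to the linear covariant, computed in an
  arbitrary basis \<open>f\<close>; evaluated on an adapted basis it is a multiple of the first
  vector. A negative multiple is absorbed by reversing two basis vectors, which changes the signs of
  \<open>r\<close> and \<open>s\<close>.\<close>

lemma Z3_axis:
  assumes iso: "cubic_stabilizer T C \<cong> integer_mod_group 3" and f: "orthonormal_basis T f"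
    and tr: "\<And>a. (\<Sum>i\<in>UNIV. C a (f i) (f i)) = 0"
  obtains e r s where "orthonormal_basis T e" "normal_form e r s" "r \<noteq> 0" "axis f \<noteq> 0"
    "e 1 = (1 / norm (axis f)) *\<^sub>R axis f"
proof -
  obtain g r s where g: "orthonormal_basis T g" "normal_form g r s" and r: "r \<noteq> 0" and s: "s\<^sup>2 \<noteq> 2 * r\<^sup>2"
    by (rule Z3_normal_form[OF iso f tr])
  define w where "w = 4 * r * (2 * r\<^sup>2 - s\<^sup>2)"
  have w: "w \<noteq> 0" using r s by (simp add: w_def)
  have ax: "axis f \<bullet> g i = linear_covariant g (g i)" for i
  proof -
    have "linear_covariant f (g i) = linear_covariant f (\<Sum>k\<in>UNIV. (g i \<bullet> f k) *\<^sub>R f k)"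
      by (rule arg_cong[OF orthonormal_basisD(4)[OF f orthonormal_basisD(2)[OF g(1)]]])
    also have "\<dots> = axis f \<bullet> g i"
      unfolding axis_def linear_sum[OF linear_covariant_linear] linear_cmul[OF linear_covariant_linear]
      by (simp add: inner_sum_left mult.commute inner_commute[of "f _"])
    finally show ?thesis using linear_covariant_basis[OF g(1) f] by simp
  qed
  have "axis f \<in> T"
    unfolding axis_def using orthonormal_basisD(2,3)[OF f] by (intro subspace_sum subspace_scale)
  from orthonormal_basisD(4)[OF g(1) this] have axg: "axis f = w *\<^sub>R g 1"
    unfolding ax sum_3 by (simp add: linear_covariant_normal_form[OF g(2)] w_def)
  have ng: "norm (g 1) = 1" using orthonormal_basisD(1)[OF g(1), of 1 1] by (simp add: norm_eq_1)
  then have ne: "axis f \<noteq> 0" using w unfolding axg by auto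
  show ?thesis
  proof (cases "w > 0")
    case True
    then show ?thesis using that[OF g r ne] ng axg by simp
  next
    case False
    let ?e = "triple (- g 1) (- g 2) (g 3)"
    have "orthonormal_basis T ?e"
      using orthonormal_basisD[OF g(1)]
      by (intro orthonormal_basis_triple[OF g(1)]) (auto intro: subspace_neg)
    moreover have "normal_form ?e (- r) (- s)"
      using g(2) by (simp add: normal_form_def cubic_linear)
    moreover have "?e 1 = (1 / norm (axis f)) *\<^sub>R axis f"
      using False w ng by (simp add: axg)
    ultimately show ?thesis using that[of ?e "- r" "- s"] r ne by simp
  qed
qed

end

subsection \<open>Hermitian linear algebra in \<open>\<complex>\<^sup>3\<close>\<close>

definition herm :: "complex ^ 3 \<Rightarrow> complex ^ 3 \<Rightarrow> complex" where
  "herm v w = (\<Sum>k\<in>UNIV. v $ k * cnj (w $ k))"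

lemma herm_left: "herm (v + v') w = herm v w + herm v' w" "herm (v - v') w = herm v w - herm v' w"
    "herm (- v) w = - herm v w" "herm (c *s v) w = c * herm v w" "herm (r *\<^sub>R v) w = of_real r * herm v w"
    "herm 0 w = 0"
  unfolding herm_def vector_scalar_mult_def scaleR_vec_def
  by (simp_all add: sum_3 algebra_simps scaleR_conv_of_real)

lemma herm_right: "herm v (w + w') = herm v w + herm v w'" "herm v (w - w') = herm v w - herm v w'"
    "herm v (- w) = - herm v w" "herm v (c *s w) = cnj c * herm v w" "herm v (r *\<^sub>R w) = of_real r * herm v w"
    "herm v 0 = 0"
  unfolding herm_def vector_scalar_mult_def scaleR_vec_def
  by (simp_all add: sum_3 algebra_simps scaleR_conv_of_real)

lemma herm_commute: "herm w v = cnj (herm v w)"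
  by (simp add: herm_def mult.commute)

lemma scale_eq_scaleR: "c *s v = Re c *\<^sub>R v + Im c *\<^sub>R J v"
  by (auto simp: J_def vec_eq_iff complex_eq_iff)

lemma of_real_scale: "of_real r *s v = r *\<^sub>R v" for v :: "complex ^ 3"
  by (simp add: scale_eq_scaleR)

lemma Re_herm: "Re (herm v w) = v \<bullet> w"
  by (simp add: herm_def inner_vec_def inner_complex_def)

lemma Im_herm: "Im (herm v w) = v \<bullet> J w"
  by (simp add: herm_def inner_vec_def inner_complex_def J_def sum_3)

lemma herm_eq: "herm v w = Complex (v \<bullet> w) (v \<bullet> J w)"
  by (simp add: complex_eq_iff Re_herm Im_herm)

lemma herm_self: "herm v v = of_real ((norm v)\<^sup>2)"
  using herm_commute[of v v] by (auto simp: complex_eq_iff Re_herm power2_norm_eq_inner)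

lemma kaehler_form_herm: "kaehler_form a b = - Im (herm a b)"
  by (simp add: kaehler_form_def herm_def sum_3)

lemma inner_J: "J v \<bullet> w = - (v \<bullet> J w)" "J v \<bullet> J w = v \<bullet> w" "J (J v) = - v" "v \<bullet> J v = 0"
proof -
  show 1: "J v \<bullet> w = - (v \<bullet> J w)" for v w
    by (simp add: inner_vec_def inner_complex_def J_def sum_3)
  show 2: "J (J v) = - v" by (simp add: J_def vec_eq_iff)
  show "J v \<bullet> J w = v \<bullet> w" by (simp add: inner_vec_def inner_complex_def J_def sum_3)
  show "v \<bullet> J v = 0" using 1[of v v] by (simp add: inner_commute)
qed

lemma bounded_linear_J: "bounded_linear J"
proof -
  have "linear J" by (rule linearI) (auto simp: J_def vec_eq_iff algebra_simps)
  then show ?thesis by (simp add: linear_conv_bounded_linear)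
qed

lemma linear_J: "J (v + w) = J v + J w" "J (r *\<^sub>R v) = r *\<^sub>R J v" "J (v - w) = J v - J w" "J (- v) = - J v"
  by (auto simp: J_def vec_eq_iff algebra_simps)

lemma bounded_bilinear_herm: "bounded_bilinear herm"
proof -
  have "bilinear herm"
    unfolding bilinear_def by (auto intro!: linearI simp: herm_left herm_right scaleR_conv_of_real[where 'a = complex])
  then show ?thesis by (simp add: bilinear_conv_bounded_bilinear)
qed

lemma bounded_bilinear_scale: "bounded_bilinear (\<lambda>(c::complex) (v::complex ^ 3). c *s v)"
proof -
  have "bilinear (\<lambda>(c::complex) (v::complex ^ 3). c *s v)"
    unfolding bilinear_def
    by (auto intro!: linearI simp: vec_eq_iff algebra_simps)
  then show ?thesis by (simp add: bilinear_conv_bounded_bilinear)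
qed

lemma norm_scale: "norm (c *s v) = norm c * norm v" for v :: "complex ^ 3"
proof -
  have "of_real ((norm (c *s v))\<^sup>2) = (of_real ((norm c * norm v)\<^sup>2) :: complex)"
    unfolding herm_self[symmetric] herm_left herm_right
    by (simp add: herm_self power_mult_distrib mult.assoc[symmetric] complex_norm_square[unfolded of_real_power] mult.commute)
  then have "(norm (c *s v))\<^sup>2 = (norm c * norm v)\<^sup>2" using of_real_eq_iff by blast
  then show ?thesis by (simp add: power2_eq_iff_nonneg)
qed

lemma Upsilon_expand: "Upsilon a b c = a$1 * b$2 * c$3 + a$2 * b$3 * c$1 + a$3 * b$1 * c$2
    - a$1 * b$3 * c$2 - a$2 * b$1 * c$3 - a$3 * b$2 * c$1"
  by (simp add: Upsilon_def det_3)

lemma Upsilon_add: "Upsilon (a + a') b c = Upsilon a b c + Upsilon a' b c"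
    "Upsilon a (b + b') c = Upsilon a b c + Upsilon a b' c" "Upsilon a b (c + c') = Upsilon a b c + Upsilon a b c'"
  by (simp_all add: Upsilon_expand algebra_simps)

lemma Upsilon_scale: "Upsilon (k *s a) b c = k * Upsilon a b c"
    "Upsilon a (k *s b) c = k * Upsilon a b c" "Upsilon a b (k *s c) = k * Upsilon a b c"
  by (simp_all add: Upsilon_expand algebra_simps)

lemma Upsilon_scaleR: "Upsilon (r *\<^sub>R a) b c = of_real r * Upsilon a b c"
    "Upsilon a (r *\<^sub>R b) c = of_real r * Upsilon a b c" "Upsilon a b (r *\<^sub>R c) = of_real r * Upsilon a b c"
  unfolding of_real_scale[symmetric] by (rule Upsilon_scale)+

lemma Upsilon_alternating: "Upsilon a a b = 0" "Upsilon a b a = 0" "Upsilon b a a = 0"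
  by (simp_all add: Upsilon_expand)

lemma Upsilon_swap: "Upsilon b a c = - Upsilon a b c" "Upsilon a c b = - Upsilon a b c"
  by (simp_all add: Upsilon_expand)

lemma has_derivative_Upsilon:
  assumes "(a has_derivative a') (at x)" "(b has_derivative b') (at x)" "(c has_derivative c') (at x)"
  shows "((\<lambda>x. Upsilon (a x) (b x) (c x)) has_derivative
    (\<lambda>h. Upsilon (a' h) (b x) (c x) + Upsilon (a x) (b' h) (c x) + Upsilon (a x) (b x) (c' h))) (at x)"
proof -
  have d: "((\<lambda>x. v x $ i) has_derivative (\<lambda>h. v' h $ i)) (at x)" if "(v has_derivative v') (at x)"
    for v v' and i :: 3
    by (rule bounded_linear.has_derivative[OF bounded_linear_vec_nth that])
  show ?thesis
    unfolding Upsilon_expand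
    by (rule derivative_eq_intros d assms refl)+ (simp add: algebra_simps fun_eq_iff)
qed

text \<open>The matrix of \<open>e\<close> is unitary, and a right inverse of a square matrix is a
  left inverse. An orthonormal basis of a Lagrangian space thus gives coordinates on the whole
  complex space.\<close>

lemma unitary_expand:
  fixes e :: "3 \<Rightarrow> complex ^ 3"
  assumes "\<And>i j. herm (e i) (e j) = (if i = j then 1 else 0)"
  shows "v = (\<Sum>i\<in>UNIV. herm v (e i) *s e i)" "Upsilon (e 1) (e 2) (e 3) \<noteq> 0"
proof -
  define M where "M = (\<chi> i k. e i $ k)"
  define M' where "M' = (\<chi> k i. cnj (e i $ k))"
  have MM: "M ** M' = mat 1"
    using assms by (simp add: M_def M'_def matrix_matrix_mult_def vec_eq_iff mat_def herm_def)
  then have "M' ** M = mat 1" by (simp add: matrix_left_right_inverse)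
  then have "(\<Sum>i\<in>UNIV. cnj (e i $ k) * (e i $ l)) = (if k = l then 1 else 0)" for k l
    by (simp add: M_def M'_def matrix_matrix_mult_def vec_eq_iff mat_def)
  then have s: "(\<Sum>i\<in>UNIV. v $ k * (cnj (e i $ k) * (e i $ l))) = v $ k * (if k = l then 1 else 0)" for k l
    by (simp add: sum_distrib_left[symmetric])
  have "(\<Sum>i\<in>UNIV. herm v (e i) *s e i) $ l = v $ l" for l
  proof -
    have "(\<Sum>i\<in>UNIV. herm v (e i) *s e i) $ l = (\<Sum>i\<in>UNIV. \<Sum>k\<in>UNIV. v $ k * (cnj (e i $ k) * (e i $ l)))"
      by (simp add: herm_def sum_distrib_right mult.assoc)
    also have "\<dots> = (\<Sum>k\<in>UNIV. \<Sum>i\<in>UNIV. v $ k * (cnj (e i $ k) * (e i $ l)))" by (rule sum.swap)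
    also have "\<dots> = v $ l" unfolding s by (simp add: mult_delta_right)
    finally show ?thesis .
  qed
  then show "v = (\<Sum>i\<in>UNIV. herm v (e i) *s e i)" by (simp add: vec_eq_iff)
  have "det M * det M' = 1" using MM by (metis det_I det_mul)
  then have "det M \<noteq> 0" by auto
  then show "Upsilon (e 1) (e 2) (e 3) \<noteq> 0" by (simp add: Upsilon_expand M_def det_3)
qed

lemma unitary_inner:
  fixes e :: "3 \<Rightarrow> complex ^ 3"
  assumes "\<And>i j. herm (e i) (e j) = (if i = j then 1 else 0)"
  shows "a \<bullet> b = (\<Sum>i\<in>UNIV. (a \<bullet> e i) * (b \<bullet> e i) + (a \<bullet> J (e i)) * (b \<bullet> J (e i)))"
proof -
  have "herm a b = herm (\<Sum>i\<in>UNIV. herm a (e i) *s e i) b"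
    by (rule arg_cong[OF unitary_expand(1)[OF assms]])
  also have "\<dots> = (\<Sum>i\<in>UNIV. herm a (e i) * herm (e i) b)"
    by (simp add: sum_3 herm_left)
  finally have "Re (herm a b) = Re (\<Sum>i\<in>UNIV. herm a (e i) * cnj (herm b (e i)))"
    by (simp add: herm_commute[of b])
  then show ?thesis by (simp add: Re_herm Im_herm)
qed

text \<open>Components along the other two arguments drop out by alternation, so differentiating
  \<open>Upsilon\<close> of a frame picks out the diagonal entries of the derivative of the
  frame.\<close>

lemma unitary_Upsilon:
  fixes e :: "3 \<Rightarrow> complex ^ 3"
  assumes "\<And>i j. herm (e i) (e j) = (if i = j then 1 else 0)"
  shows "Upsilon v (e 2) (e 3) = herm v (e 1) * Upsilon (e 1) (e 2) (e 3)"
    "Upsilon (e 1) v (e 3) = herm v (e 2) * Upsilon (e 1) (e 2) (e 3)"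
    "Upsilon (e 1) (e 2) v = herm v (e 3) * Upsilon (e 1) (e 2) (e 3)"
proof -
  have v: "v = herm v (e 1) *s e 1 + herm v (e 2) *s e 2 + herm v (e 3) *s e 3"
    using unitary_expand(1)[OF assms, of v] by (simp add: sum_3)
  define x y z where "x = herm v (e 1)" and "y = herm v (e 2)" and "z = herm v (e 3)"
  have v': "v = x *s e 1 + y *s e 2 + z *s e 3" using v by (simp add: x_def y_def z_def)
  have "Upsilon v (e 2) (e 3) = x * Upsilon (e 1) (e 2) (e 3)"
    "Upsilon (e 1) v (e 3) = y * Upsilon (e 1) (e 2) (e 3)"
    "Upsilon (e 1) (e 2) v = z * Upsilon (e 1) (e 2) (e 3)"
    unfolding v' by (simp_all add: Upsilon_add Upsilon_scale Upsilon_alternating)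
  then show "Upsilon v (e 2) (e 3) = herm v (e 1) * Upsilon (e 1) (e 2) (e 3)"
    "Upsilon (e 1) v (e 3) = herm v (e 2) * Upsilon (e 1) (e 2) (e 3)"
    "Upsilon (e 1) (e 2) v = herm v (e 3) * Upsilon (e 1) (e 2) (e 3)"
    by (simp_all only: x_def y_def z_def)
qed

subsection \<open>Charts of special Lagrangian submanifolds\<close>

text \<open>Gram--Schmidt applied to the coordinate fields; the second field keeps a real second component,
  so that the third one does not vanish.\<close>

lemma orthonormal_frame:
  fixes X :: "real \<times> complex \<Rightarrow> 'a::euclidean_space"
  assumes P: "open P" and X: "smooth_on P X" and inj: "\<And>q. q \<in> P \<Longrightarrow> inj (D X q)"
  obtains \<theta> where "\<forall>i. smooth_on P (\<theta> i)"
    "\<forall>q\<in>P. \<forall>i j. D X q (\<theta> (i::3) q) \<bullet> D X q (\<theta> j q) = (if i = j then 1 else 0)"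
proof -
  have lin: "linear (D X q)" if "q \<in> P" for q using linear_D[OF X that] .
  have nz: "D X q v \<noteq> 0" if "q \<in> P" "v \<noteq> 0" for q v
    using inj[OF that(1)] that(2) linear_0[OF lin[OF that(1)]] by (metis injD)
  define unit where "unit \<eta> q = (1 / norm (D X q (\<eta> q))) *\<^sub>R \<eta> q" for \<eta> q
  have unit1: "smooth_on P (unit \<eta>)" if "smooth_on P \<eta>" "\<And>q. q \<in> P \<Longrightarrow> \<eta> q \<noteq> 0" for \<eta>
    unfolding unit_def using P X that nz
    by (intro smooth_on_scaleR smooth_on_divide smooth_on_norm smooth_on_const smooth_on_deriv_apply) auto
  have unit2: "D X q (unit \<eta> q) \<bullet> D X q (unit \<eta> q) = 1" if "q \<in> P" "\<eta> q \<noteq> 0" for \<eta> q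
    using nz[OF that] by (simp add: unit_def linear_cmul[OF lin[OF that(1)]] power2_norm_eq_inner[symmetric] power2_eq_square[symmetric] power_divide flip: power_mult_distrib)
  define b1 b2 b3 where "b1 = (1::real, 0::complex)" and "b2 = (0::real, 1::complex)" and "b3 = (0::real, \<i>)"
  define \<theta>1 where "\<theta>1 = unit (\<lambda>_. b1)"
  define \<eta>2 where "\<eta>2 q = b2 - (D X q b2 \<bullet> D X q (\<theta>1 q)) *\<^sub>R \<theta>1 q" for q
  define \<theta>2 where "\<theta>2 = unit \<eta>2"
  define \<eta>3 where "\<eta>3 q = b3 - (D X q b3 \<bullet> D X q (\<theta>1 q)) *\<^sub>R \<theta>1 q - (D X q b3 \<bullet> D X q (\<theta>2 q)) *\<^sub>R \<theta>2 q" for q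
  define \<theta>3 where "\<theta>3 = unit \<eta>3"
  have b1: "b1 \<noteq> 0" by (simp add: b1_def zero_prod_def)
  have s1: "smooth_on P \<theta>1" unfolding \<theta>1_def using b1 by (intro unit1) auto
  have sn1: "snd (\<theta>1 q) = 0" for q by (simp add: \<theta>1_def unit_def b1_def)
  have sn2: "snd (\<eta>2 q) = 1" for q by (simp add: \<eta>2_def sn1 b2_def)
  have \<eta>2: "\<eta>2 q \<noteq> 0" for q using sn2[of q] by auto
  have se2: "smooth_on P \<eta>2"
    unfolding \<eta>2_def using P X s1
    by (intro smooth_on_diff smooth_on_scaleR smooth_on_inner smooth_on_const smooth_on_deriv_apply) auto
  have s2: "smooth_on P \<theta>2" unfolding \<theta>2_def by (rule unit1[OF se2 \<eta>2])
  have "Im (snd (\<theta>2 q)) = 0" for q by (simp add: \<theta>2_def unit_def sn2)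
  then have "Im (snd (\<eta>3 q)) = 1" for q by (simp add: \<eta>3_def sn1 b3_def)
  then have \<eta>3: "\<eta>3 q \<noteq> 0" for q by (metis complex_Re_numeral one_neq_zero snd_zero zero_complex.simps(2))
  have se3: "smooth_on P \<eta>3"
    unfolding \<eta>3_def using P X s1 s2
    by (intro smooth_on_diff smooth_on_scaleR smooth_on_inner smooth_on_const smooth_on_deriv_apply) auto
  have s3: "smooth_on P \<theta>3" unfolding \<theta>3_def by (rule unit1[OF se3 \<eta>3])
  have n: "D X q (\<theta>1 q) \<bullet> D X q (\<theta>1 q) = 1" "D X q (\<theta>2 q) \<bullet> D X q (\<theta>2 q) = 1"
    "D X q (\<theta>3 q) \<bullet> D X q (\<theta>3 q) = 1" if "q \<in> P" for q
    unfolding \<theta>1_def \<theta>2_def \<theta>3_def using b1 \<eta>2 \<eta>3 that by (intro unit2; simp)+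
  have o12: "D X q (\<theta>2 q) \<bullet> D X q (\<theta>1 q) = 0" if q: "q \<in> P" for q
    using n(1)[OF q]
    by (simp add: \<theta>2_def unit_def \<eta>2_def linear_cmul[OF lin[OF q]] linear_diff[OF lin[OF q]] inner_diff_left)
  have o3: "D X q (\<theta>3 q) \<bullet> D X q (\<theta>1 q) = 0" "D X q (\<theta>3 q) \<bullet> D X q (\<theta>2 q) = 0" if q: "q \<in> P" for q
    using n(1,2)[OF q] o12[OF q] inner_commute[of "D X q (\<theta>1 q)" "D X q (\<theta>2 q)"]
    by (simp_all add: \<theta>3_def unit_def \<eta>3_def linear_cmul[OF lin[OF q]] linear_diff[OF lin[OF q]] inner_diff_left)
  show ?thesis
  proof (rule that[of "triple \<theta>1 \<theta>2 \<theta>3"])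
    show "\<forall>i. smooth_on P (triple \<theta>1 \<theta>2 \<theta>3 i)" using s1 s2 s3 by (simp add: triple_def)
    show "\<forall>q\<in>P. \<forall>i j. D X q (triple \<theta>1 \<theta>2 \<theta>3 i q) \<bullet> D X q (triple \<theta>1 \<theta>2 \<theta>3 j q) = (if i = j then 1 else 0)"
      unfolding forall_3 using n o12 o3 by (simp add: inner_commute)
  qed
qed

lemma orthonormal_basis_unitary:
  assumes "orthonormal_basis T e" "\<And>a b. a \<in> T \<Longrightarrow> b \<in> T \<Longrightarrow> a \<bullet> J b = 0"
  shows "herm (e i) (e j) = (if i = j then 1 else 0)"
  using orthonormal_basisD(1,2)[OF assms(1)] assms(2) by (simp add: herm_eq complex_eq_iff)

locale sl_chart =
  fixes L :: "(complex ^ 3) set" and P :: "(real \<times> complex) set" and X N \<kappa>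
  assumes sl: "special_lagrangian L" and ch: "chart L P X N \<kappa>"
begin

lemmas P = chartD(1)[OF ch] and X = chartD(3)[OF ch] and \<kappa> = chartD(4)[OF ch]

definition T where "T q = range (D X q)"
definition \<tau> where "\<tau> q = D \<kappa> (X q)"
definition X2 where "X2 q h k = D (\<lambda>x. D X x k) q h"
definition cub where "cub q h k m = X2 q h k \<bullet> J (D X q m)"
text \<open>The map \<tau> is defined on the ambient space and inverts \<open>D X q\<close> on the
  tangent space. Composing with it makes the cubic trilinear without membership conditions, as
  \<open>symmetric_cubic\<close> asks.\<close>

definition C where "C q a b c = cub q (\<tau> q a) (\<tau> q b) (\<tau> q c)"

lemma T: "q \<in> P \<Longrightarrow> tangent_space L (X q) = T q"
  unfolding T_def by (rule chart_tangent_space[OF ch])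

lemma DX_T [simp]: "D X q h \<in> T q"
  by (simp add: T_def)

lemma linear_X: "q \<in> P \<Longrightarrow> linear (D X q)"
  by (rule linear_D[OF X])

lemma DX_deriv: "q \<in> P \<Longrightarrow> ((\<lambda>x. D X x k) has_derivative (\<lambda>h. X2 q h k)) (at q)"
  unfolding X2_def by (rule smooth_on_has_derivative[OF smooth_on_deriv[OF X]])

lemma X_deriv: "q \<in> P \<Longrightarrow> (X has_derivative D X q) (at q)"
  by (rule smooth_on_has_derivative[OF X])

lemma \<tau>_X: "q \<in> P \<Longrightarrow> \<tau> q (D X q h) = h"
  unfolding \<tau>_def by (rule chart_inverse_derivative(1)[OF ch])

lemma X_\<tau>: "q \<in> P \<Longrightarrow> a \<in> T q \<Longrightarrow> D X q (\<tau> q a) = a"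
  by (auto simp: T_def \<tau>_X)

lemma linear_\<tau>: "q \<in> P \<Longrightarrow> linear (\<tau> q)"
  unfolding \<tau>_def by (rule linear_D[OF \<kappa> chartD(8)[OF ch]])

lemma subspace_T: "q \<in> P \<Longrightarrow> subspace (T q)"
  unfolding T_def by (simp add: linear_subspace_image linear_X)

lemma dim_T: "q \<in> P \<Longrightarrow> dim (T q) = 3"
  using dim_image_eq[OF linear_X, of q UNIV] chart_inverse_derivative(2)[OF ch, of q] by (simp add: T_def)

lemma lagrangian: "q \<in> P \<Longrightarrow> a \<in> T q \<Longrightarrow> b \<in> T q \<Longrightarrow> a \<bullet> J b = 0"
proof -
  assume q: "q \<in> P" and ab: "a \<in> T q" "b \<in> T q"
  have "kaehler_form a b = 0"
    using sl chartD(7)[OF ch q] ab T[OF q] by (simp add: special_lagrangian_def)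
  then show ?thesis by (simp add: kaehler_form_herm Im_herm)
qed

lemma special: "q \<in> P \<Longrightarrow> a \<in> T q \<Longrightarrow> b \<in> T q \<Longrightarrow> c \<in> T q \<Longrightarrow> Im (Upsilon a b c) = 0"
proof -
  assume q: "q \<in> P" and abc: "a \<in> T q" "b \<in> T q" "c \<in> T q"
  have "\<forall>x\<in>L. \<forall>a\<in>tangent_space L x. \<forall>b\<in>tangent_space L x. \<forall>c\<in>tangent_space L x. Im (Upsilon a b c) = 0"
    using sl by (simp add: special_lagrangian_def)
  then show ?thesis using chartD(7)[OF ch q] abc T[OF q] by blast
qed

lemma X2_sym: "q \<in> P \<Longrightarrow> X2 q h k = X2 q k h"
  unfolding X2_def by (rule second_derivative_symmetric[OF P X])

lemma J_deriv: "(f has_derivative f') F \<Longrightarrow> ((\<lambda>x. J (f x)) has_derivative (\<lambda>h. J (f' h))) F"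
  by (rule bounded_linear.has_derivative[OF bounded_linear_J])

text \<open>The first symmetry is that of second derivatives; the second comes from differentiating
  the Lagrangian condition for the coordinate fields \<open>k\<close> and \<open>m\<close>.\<close>

lemma cub_sym: assumes q: "q \<in> P" shows "cub q h k m = cub q k h m" "cub q h k m = cub q h m k"
proof -
  show "cub q h k m = cub q k h m" using X2_sym[OF q] by (simp add: cub_def)
  have "((\<lambda>x. D X x k \<bullet> J (D X x m)) has_derivative
      (\<lambda>h. D X q k \<bullet> J (X2 q h m) + X2 q h k \<bullet> J (D X q m))) (at q)"
    by (intro has_derivative_inner DX_deriv J_deriv q)
  then have "((\<lambda>x. 0) has_derivative
      (\<lambda>h. D X q k \<bullet> J (X2 q h m) + X2 q h k \<bullet> J (D X q m))) (at q)"
    by (rule has_derivative_transform_within_open[OF _ P q]) (rule lagrangian, assumption, simp_all)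
  from D_eqI[OF this, of h] have "D X q k \<bullet> J (X2 q h m) + X2 q h k \<bullet> J (D X q m) = 0" by simp
  moreover have "D X q k \<bullet> J (X2 q h m) = - (X2 q h m \<bullet> J (D X q k))"
    using inner_J(1)[of "X2 q h m" "D X q k"] by (simp add: inner_commute[of "D X q k"])
  ultimately show "cub q h k m = cub q h m k" by (simp add: cub_def)
qed

lemma symmetric_cubic_C: assumes q: "q \<in> P" shows "symmetric_cubic (C q)"
proof (rule symmetric_cubic.intro)
  have "linear (\<lambda>c. X2 q h k \<bullet> J (D X q (\<tau> q c)))" for h k
    by (intro linearI) (simp_all add: linear_add[OF linear_X[OF q]] linear_add[OF linear_\<tau>[OF q]]
        linear_cmul[OF linear_X[OF q]] linear_cmul[OF linear_\<tau>[OF q]] linear_J inner_right_distrib)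
  moreover have "C q a b = (\<lambda>c. X2 q (\<tau> q a) (\<tau> q b) \<bullet> J (D X q (\<tau> q c)))" for a b
    by (simp add: fun_eq_iff C_def cub_def)
  ultimately show "linear (C q a b)" for a b by metis
  show "C q a b c = C q b a c" "C q a b c = C q a c b" for a b c
    unfolding C_def by (rule cub_sym[OF q])+
qed

text \<open>\<open>J c\<close> is normal because the tangent space is Lagrangian, so the cubic can
  be read off the second derivative of the parametrization.\<close>

lemma fundamental_cubic_C:
  assumes q: "q \<in> P" and "a \<in> T q" "b \<in> T q" "c \<in> T q"
  shows "fundamental_cubic L (X q) a b c = C q a b c"
proof -
  have "D X q h \<bullet> J c = 0" for h by (rule lagrangian[OF q]) (use assms in auto)
  from chart_second_fundamental_form[OF ch q this, of "\<tau> q a" "\<tau> q b"] show ?thesis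
    unfolding fundamental_cubic_def C_def cub_def X2_def using X_\<tau>[OF q] assms by simp
qed

lemma cubic_stabilizer_C:
  assumes q: "q \<in> P"
  shows "cubic_stabilizer (tangent_space L (X q)) (fundamental_cubic L (X q)) = cubic_stabilizer (T q) (C q)"
proof -
  have "A a \<in> T q" if "A \<in> special_orthogonal (T q)" "a \<in> T q" for A a
    using that linear_isometryD(2) special_orthogonal_iff by blast
  then have "{A \<in> special_orthogonal (T q). \<forall>a\<in>T q. \<forall>b\<in>T q. \<forall>c\<in>T q. fundamental_cubic L (X q) (A a) (A b) (A c) =
      fundamental_cubic L (X q) a b c} =
      {A \<in> special_orthogonal (T q). \<forall>a\<in>T q. \<forall>b\<in>T q. \<forall>c\<in>T q. C q (A a) (A b) (A c) = C q a b c}"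
    using fundamental_cubic_C[OF q] by auto
  then show ?thesis by (simp add: cubic_stabilizer_def T[OF q])
qed

text \<open>\<open>Upsilon\<close> of an orthonormal frame is real and nonzero. Its derivative is
  \<i> times the trace of the cubic times the same value, and must be real as well, so the trace
  vanishes.\<close>

lemma frame_traceless:
  assumes \<theta>: "\<forall>i. smooth_on P (\<theta> i)"
    "\<forall>q\<in>P. \<forall>i j. D X q (\<theta> (i::3) q) \<bullet> D X q (\<theta> j q) = (if i = j then 1 else 0)" and q: "q \<in> P"
  shows "orthonormal_basis (T q) (\<lambda>i. D X q (\<theta> i q))"
    "(\<Sum>i\<in>UNIV. C q a (D X q (\<theta> i q)) (D X q (\<theta> i q))) = 0"
proof -
  let ?f = "\<lambda>i x. D X x (\<theta> i x)"
  have onb: "orthonormal_basis (T x) (\<lambda>i. ?f i x)" if "x \<in> P" for x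
    by (rule orthonormal_basisI[OF subspace_T[OF that] dim_T[OF that]]) (use \<theta>(2) that in auto)
  then show "orthonormal_basis (T q) (\<lambda>i. ?f i q)" using q .
  have un: "herm (?f i q) (?f j q) = (if i = j then 1 else 0)" for i j
    by (rule orthonormal_basis_unitary[OF onb[OF q] lagrangian[OF q]])
  define \<theta>' where "\<theta>' i = D (\<theta> i) q" for i
  have d\<theta>: "(\<theta> i has_derivative \<theta>' i) (at q)" for i
    unfolding \<theta>'_def by (rule smooth_on_has_derivative[OF _ q]) (use \<theta> in auto)
  define f' where "f' i h = X2 q h (\<theta> i q) + D X q (\<theta>' i h)" for i h
  have df: "(?f i has_derivative f' i) (at q)" for i
    unfolding f'_def X2_def by (rule has_derivative_D_apply[OF P X q d\<theta>])
  \<comment> \<open>The real part vanishes by unit length. In the imaginary part the derivative of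
    the coefficients \<theta> contributes a tangent vector, which is orthogonal to \<open>J\<close>
    of the frame.\<close>
  have hf: "herm (f' i h) (?f i q) = \<i> * of_real (cub q h (\<theta> i q) (\<theta> i q))" for i h
  proof -
    have "((\<lambda>x. ?f i x \<bullet> ?f i x) has_derivative (\<lambda>h. ?f i q \<bullet> f' i h + f' i h \<bullet> ?f i q)) (at q)"
      by (intro has_derivative_inner df)
    then have "((\<lambda>x. 1) has_derivative (\<lambda>h. ?f i q \<bullet> f' i h + f' i h \<bullet> ?f i q)) (at q)"
      by (rule has_derivative_transform_within_open[OF _ P q]) (use \<theta>(2) in auto)
    from D_eqI[OF this, of h] have "f' i h \<bullet> ?f i q = 0" by (simp add: inner_commute)
    moreover have "f' i h \<bullet> J (?f i q) = cub q h (\<theta> i q) (\<theta> i q)"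
      unfolding f'_def cub_def inner_add_left using lagrangian[OF q DX_T DX_T] by simp
    ultimately show ?thesis by (simp add: herm_eq complex_eq_iff)
  qed
  define u where "u = Upsilon (?f 1 q) (?f 2 q) (?f 3 q)"
  have "((\<lambda>x. Upsilon (?f 1 x) (?f 2 x) (?f 3 x)) has_derivative
      (\<lambda>h. Upsilon (f' 1 h) (?f 2 q) (?f 3 q) + Upsilon (?f 1 q) (f' 2 h) (?f 3 q) + Upsilon (?f 1 q) (?f 2 q) (f' 3 h))) (at q)"
    by (rule has_derivative_Upsilon[OF df df df])
  then have "((\<lambda>x. Upsilon (?f 1 x) (?f 2 x) (?f 3 x)) has_derivative
      (\<lambda>h. \<i> * of_real (\<Sum>i\<in>UNIV. cub q h (\<theta> i q) (\<theta> i q)) * u)) (at q)"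
    by (simp add: unitary_Upsilon(1)[OF un, of "f' 1 _"] unitary_Upsilon(2)[OF un, of "f' 2 _"]
        unitary_Upsilon(3)[OF un, of "f' 3 _"] hf u_def[symmetric] sum_3 distrib_right distrib_left)
  then have "((\<lambda>x. Im (Upsilon (?f 1 x) (?f 2 x) (?f 3 x))) has_derivative
      (\<lambda>h. Im (\<i> * of_real (\<Sum>i\<in>UNIV. cub q h (\<theta> i q) (\<theta> i q)) * u))) (at q)"
    by (rule bounded_linear.has_derivative[OF bounded_linear_Im])
  then have d: "((\<lambda>x. 0) has_derivative
      (\<lambda>h. Im (\<i> * of_real (\<Sum>i\<in>UNIV. cub q h (\<theta> i q) (\<theta> i q)) * u))) (at q)"
    by (rule has_derivative_transform_within_open[OF _ P q]) (rule special, assumption, simp_all)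
  have "Im u = 0" unfolding u_def by (rule special[OF q]) simp_all
  moreover have "u \<noteq> 0" unfolding u_def by (rule unitary_expand(2)[OF un])
  ultimately have "Re u \<noteq> 0" by (simp add: complex_eq_iff)
  moreover have "(\<Sum>i\<in>UNIV. cub q h (\<theta> i q) (\<theta> i q)) * Re u = 0" for h
    using D_eqI[OF d, of h] by simp
  ultimately show "(\<Sum>i\<in>UNIV. C q a (?f i q) (?f i q)) = 0"
    by (simp add: C_def \<tau>_X[OF q])
qed

lemma smooth_on_\<tau>:
  assumes "smooth_on P E" shows "smooth_on P (\<lambda>x. \<tau> x (E x))"
proof -
  have "smooth_on P (\<lambda>x. \<Sum>b\<in>Basis. (E x \<bullet> b) *\<^sub>R D \<kappa> (X x) b)"
    using P assms chartD(2,8)[OF ch]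
    by (intro smooth_on_sum smooth_on_scaleR smooth_on_inner smooth_on_const finite_Basis
        smooth_on_compose[OF P chartD(2)[OF ch] _ X smooth_on_deriv[OF \<kappa>]]) auto
  then show ?thesis
    unfolding \<tau>_def
    by (rule smooth_on_cong[OF P, rotated])
      (rule linear_expand[OF linear_D[OF \<kappa> chartD(8)[OF ch]], symmetric])
qed

text \<open>The derivative of the coordinates of \<open>E\<close> gives a tangent vector, invisible
  to \<open>J (D X q k)\<close>. The cubic on smooth fields is thus expressed by first derivatives
  of fields, which shows its smoothness.\<close>

lemma tangent_field_deriv:
  assumes E: "smooth_on P E" "\<And>q. q \<in> P \<Longrightarrow> E q \<in> T q" and q: "q \<in> P"
  shows "D E q h \<bullet> J (D X q k) = C q (D X q h) (E q) (D X q k)"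
proof -
  have s: "smooth_on P (\<lambda>x. \<tau> x (E x))" by (rule smooth_on_\<tau>[OF E(1)])
  define \<eta>' where "\<eta>' = D (\<lambda>x. \<tau> x (E x)) q"
  have "((\<lambda>x. D X x (\<tau> x (E x))) has_derivative
      (\<lambda>h. X2 q h (\<tau> q (E q)) + D X q (\<eta>' h))) (at q)"
    unfolding X2_def \<eta>'_def by (rule has_derivative_D_apply[OF P X q smooth_on_has_derivative[OF s q]])
  then have "(E has_derivative (\<lambda>h. X2 q h (\<tau> q (E q)) + D X q (\<eta>' h))) (at q)"
    by (rule has_derivative_transform_within_open[OF _ P q]) (use X_\<tau> E(2) in auto)
  then have "D E q h = X2 q h (\<tau> q (E q)) + D X q (\<eta>' h)" by (rule D_eqI)
  then show ?thesis
    using lagrangian[OF q DX_T DX_T] by (simp add: C_def cub_def inner_add_left \<tau>_X[OF q])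
qed

text \<open>Adapted bases come point by point, so smoothness has to come from formulas:
  \<open>E\<close> is the normalized covariant computed in a smooth frame, and \<open>r\<close> is
  half of \<open>C q (E q) (E q) (E q)\<close>.\<close>

lemma Z3_axis_field:
  assumes Z3: "\<And>q. q \<in> P \<Longrightarrow> has_Z3_symmetry L (X q)"
  obtains E r where "smooth_on P E" "smooth_on P r"
    "\<forall>q\<in>P. \<exists>e s. orthonormal_basis (T q) e \<and> symmetric_cubic.normal_form (C q) e (r q) s \<and> e 1 = E q \<and> r q \<noteq> 0"
proof -
  obtain \<theta> where \<theta>: "\<forall>i. smooth_on P (\<theta> i)"
    "\<forall>q\<in>P. \<forall>i j. D X q (\<theta> (i::3) q) \<bullet> D X q (\<theta> j q) = (if i = j then 1 else 0)"
    by (rule orthonormal_frame[OF P X chart_inverse_derivative(2)[OF ch]])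
  define f where "f i q = D X q (\<theta> i q)" for i q
  have sf: "smooth_on P (f i)" for i
    unfolding f_def using P X \<theta> by (intro smooth_on_deriv_apply) auto
  note onb = frame_traceless(1)[OF \<theta>, folded f_def] and tr = frame_traceless(2)[OF \<theta>, folded f_def]
  have fT: "f i q \<in> T q" for i q by (simp add: f_def)
  have sC: "smooth_on P (\<lambda>q. C q (f i q) (f j q) (f k q))" for i j k
  proof -
    have "smooth_on P (\<lambda>q. D (f j) q (\<theta> i q) \<bullet> J (f k q))"
      using P sf \<theta> by (intro smooth_on_inner smooth_on_deriv_apply smooth_on_compose_linear[OF _ bounded_linear_J]) auto
    then show ?thesis
    proof (rule smooth_on_cong[OF P, rotated])
      fix q assume "q \<in> P"
      from tangent_field_deriv[OF sf fT this, of j "\<theta> i q" "\<theta> k q"]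
      show "D (f j) q (\<theta> i q) \<bullet> J (f k q) = C q (f i q) (f j q) (f k q)"
        by (simp only: f_def[symmetric])
    qed
  qed
  define A where "A q = symmetric_cubic.axis (C q) (\<lambda>i. f i q)" for q
  have sA: "smooth_on P A"
  proof -
    have Q: "smooth_on P (\<lambda>q. \<Sum>k\<in>UNIV. \<Sum>l\<in>UNIV. C q (f i q) (f k q) (f l q) * C q (f j q) (f k q) (f l q))" for i j
      using P by (intro smooth_on_sum smooth_on_mult sC) auto
    have "smooth_on P (\<lambda>q. \<Sum>i\<in>UNIV. (\<Sum>j\<in>UNIV. \<Sum>k\<in>UNIV. C q (f i q) (f j q) (f k q) *
        (\<Sum>k'\<in>UNIV. \<Sum>l\<in>UNIV. C q (f j q) (f k' q) (f l q) * C q (f k q) (f k' q) (f l q))) *\<^sub>R f i q)"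
      using P by (intro smooth_on_sum smooth_on_scaleR smooth_on_mult sC sf Q) auto
    then show ?thesis
    proof (rule smooth_on_cong[OF P, rotated])
      fix q assume "q \<in> P"
      then interpret symmetric_cubic "C q" by (rule symmetric_cubic_C)
      show "(\<Sum>i\<in>UNIV. (\<Sum>j\<in>UNIV. \<Sum>k\<in>UNIV. C q (f i q) (f j q) (f k q) *
        (\<Sum>k'\<in>UNIV. \<Sum>l\<in>UNIV. C q (f j q) (f k' q) (f l q) * C q (f k q) (f k' q) (f l q))) *\<^sub>R f i q) = A q"
        by (simp add: A_def axis_def linear_covariant_def quadratic_covariant_def)
    qed
  qed
  define E where "E q = (1 / norm (A q)) *\<^sub>R A q" for q
  define r where "r q = D E q (\<tau> q (E q)) \<bullet> J (E q) / 2" for q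
  have main: "\<exists>e r s. orthonormal_basis (T q) e \<and> symmetric_cubic.normal_form (C q) e r s \<and> r \<noteq> 0 \<and> A q \<noteq> 0 \<and> e 1 = E q"
    if q: "q \<in> P" for q
  proof -
    interpret symmetric_cubic "C q" by (rule symmetric_cubic_C[OF q])
    have "cubic_stabilizer (T q) (C q) \<cong> integer_mod_group 3"
      using Z3[OF q] by (simp add: has_Z3_symmetry_def cubic_stabilizer_C[OF q])
    from Z3_axis[OF this onb[OF q] tr[OF q]] show ?thesis
      unfolding E_def A_def by metis
  qed
  have A0: "A q \<noteq> 0" if "q \<in> P" for q using main[OF that] by blast
  have sE: "smooth_on P E"
    unfolding E_def
    by (intro smooth_on_scaleR smooth_on_divide smooth_on_norm smooth_on_const P sA) (use A0 in auto)
  have ET: "E q \<in> T q" if "q \<in> P" for q using main[OF that] orthonormal_basisD(2) by metis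
  have r: "r q = C q (E q) (E q) (E q) / 2" if "q \<in> P" for q
    using tangent_field_deriv[OF sE ET that, of "\<tau> q (E q)" "\<tau> q (E q)"] X_\<tau>[OF that ET[OF that]]
    by (simp add: r_def)
  show ?thesis
  proof (rule that[of E r])
    show "smooth_on P E" by (rule sE)
    have "smooth_on P (\<lambda>q. D E q (\<tau> q (E q)) \<bullet> J (E q) / 2)"
      using P sE
      by (intro smooth_on_divide smooth_on_inner smooth_on_deriv_apply smooth_on_\<tau> smooth_on_compose_linear[OF _ bounded_linear_J]) auto
    then show "smooth_on P r" by (rule smooth_on_cong[OF P, rotated]) (simp add: r_def)
    show "\<forall>q\<in>P. \<exists>e s. orthonormal_basis (T q) e \<and> symmetric_cubic.normal_form (C q) e (r q) s \<and> e 1 = E q \<and> r q \<noteq> 0"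
    proof
      fix q assume q: "q \<in> P"
      interpret symmetric_cubic "C q" by (rule symmetric_cubic_C[OF q])
      obtain e r' s where e: "orthonormal_basis (T q) e" "normal_form e r' s" "r' \<noteq> 0" "e 1 = E q"
        using main[OF q] by blast
      have "r q = r'" using e(2,4) by (simp add: r[OF q] normal_form_def)
      then show "\<exists>e s. orthonormal_basis (T q) e \<and> normal_form e (r q) s \<and> e 1 = E q \<and> r q \<noteq> 0"
        using e by blast
    qed
  qed
qed

end

text \<open>With the axis in one slot, \<open>s\<close> and the vectors \<open>e 2\<close> and
  \<open>e 3\<close> drop out. Hence the normal part of the derivative of the axis field depends on
  \<open>E\<close>, \<open>r\<close> and the metric alone.\<close>

lemma (in symmetric_cubic) normal_form_axis:
  assumes e: "orthonormal_basis T e" and nf: "normal_form e r s" and ab: "a \<in> T" "b \<in> T"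
  shows "C (e 1) a b = r * (3 * (a \<bullet> e 1) * (b \<bullet> e 1) - a \<bullet> b)"
proof -
  define x y where "x i = a \<bullet> e i" and "y i = b \<bullet> e i" for i
  have a: "a = x 1 *\<^sub>R e 1 + x 2 *\<^sub>R e 2 + x 3 *\<^sub>R e 3"
    and b: "b = y 1 *\<^sub>R e 1 + y 2 *\<^sub>R e 2 + y 3 *\<^sub>R e 3"
    using orthonormal_basisD(4)[OF e ab(1)] orthonormal_basisD(4)[OF e ab(2)] by (simp_all add: sum_3 x_def y_def)
  have "a \<bullet> b = x 1 * y 1 + x 2 * y 2 + x 3 * y 3"
    using orthonormal_basis_inner[OF e ab(1), of b] by (simp add: sum_3 x_def y_def inner_commute)
  moreover have "C (e 1) a b = 2 * r * (x 1 * y 1) - r * (x 2 * y 2) - r * (x 3 * y 3)"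
    unfolding a b using nf
    by (simp add: normal_form_def cubic_linear cubic_sort[where e = e])
  ultimately show ?thesis by (simp add: x_def y_def algebra_simps)
qed

text \<open>The equations are the components of the symmetry of the second derivatives of the axis field:
  \<open>p12\<close> etc. are the components of its covariant derivative and \<open>\<rho>1\<close>, \<open>\<rho>2\<close>, \<open>\<rho>3\<close> the derivatives of
  \<open>r\<close>.\<close>

lemma codazzi_algebra:
  fixes r s :: real
  assumes r: "r \<noteq> 0"
    and eqs: "\<rho>2 = 2 * r * p12" "\<rho>3 = 2 * r * p13" "4 * r * p23 = 4 * r * p32"
      "4 * r * p22 = - \<rho>1 - s * p12" "4 * r * p33 = - \<rho>1 + s * p12" "4 * r * p23 = s * p13"
      "s * p22 - s * p33 = \<rho>2" "- s * p23 - s * p32 = \<rho>3"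
  shows "p12 = 0" "p13 = 0" "p23 = 0" "p32 = 0" "p33 = p22"
proof -
  have "0 < r * r" using r by (simp add: zero_less_mult_iff) linarith
  \<comment> \<open>Eliminating the derivatives of \<open>r\<close> and the diagonal components
    leaves this number as the coefficient of \<open>p12\<close> and of \<open>p13\<close>, so both
    vanish.\<close>
  then have pos: "4 * r * r + s * s > 0" using zero_le_square[of s] by linarith
  have p: "p23 = p32" using eqs(3) r by simp
  have "4 * r * (s * p22 - s * p33) = s * (4 * r * p22 - 4 * r * p33)" by (simp add: algebra_simps)
  also have "\<dots> = - 2 * s * s * p12" unfolding eqs(4,5) by (simp add: algebra_simps)
  finally have "(4 * r * r + s * s) * p12 = 0" unfolding eqs(7) eqs(1) by (simp add: algebra_simps)
  then show p12: "p12 = 0" using pos by simp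
  have "4 * r * (- s * p23 - s * p32) = - 2 * s * (4 * r * p23)" by (simp add: p)
  then have "4 * r * \<rho>3 = - 2 * s * (s * p13)" unfolding eqs(8) eqs(6) .
  then have "(4 * r * r + s * s) * p13 = 0" unfolding eqs(2) by (simp add: algebra_simps)
  then show "p13 = 0" using pos by simp
  then show "p23 = 0" using eqs(6) r by simp
  then show "p32 = 0" using p by simp
  have "4 * r * p33 = 4 * r * p22" using eqs(4,5) p12 by simp
  then show "p33 = p22" using r by simp
qed

section \<open>Derivative of the axis field from the Codazzi equation\<close>

context sl_chart
begin

definition axis_field where
  "axis_field E r \<longleftrightarrow> smooth_on P E \<and> smooth_on P r \<and>
    (\<forall>q\<in>P. \<exists>e s. orthonormal_basis (T q) e \<and> symmetric_cubic.normal_form (C q) e (r q) s \<and> e 1 = E q \<and> r q \<noteq> 0)"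

lemma axis_fieldD:
  assumes "axis_field E r"
  shows "smooth_on P E" "smooth_on P r"
    "q \<in> P \<Longrightarrow> E q \<in> T q" "q \<in> P \<Longrightarrow> E q \<bullet> E q = 1" "q \<in> P \<Longrightarrow> r q \<noteq> 0"
    "q \<in> P \<Longrightarrow> D E q h \<bullet> J (D X q k) =
      r q * (3 * (D X q h \<bullet> E q) * (D X q k \<bullet> E q) - D X q h \<bullet> D X q k)"
proof -
  show E: "smooth_on P E" "smooth_on P r" using assms by (simp_all add: axis_field_def)
  have ex: "\<exists>e s. orthonormal_basis (T q) e \<and> symmetric_cubic.normal_form (C q) e (r q) s \<and> e 1 = E q \<and> r q \<noteq> 0"
    if "q \<in> P" for q
    using assms that by (simp add: axis_field_def)
  show ET: "E q \<in> T q" if "q \<in> P" for q using ex[OF that] orthonormal_basisD(2) by metis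
  show "E q \<bullet> E q = 1" "r q \<noteq> 0" if q: "q \<in> P" for q
  proof -
    obtain e s where e: "orthonormal_basis (T q) e" "e 1 = E q" "r q \<noteq> 0" using ex[OF q] by blast
    then show "r q \<noteq> 0" by simp
    show "E q \<bullet> E q = 1" using orthonormal_basisD(1)[OF e(1), of 1 1] e(2) by simp
  qed
  assume q: "q \<in> P"
  interpret symmetric_cubic "C q" by (rule symmetric_cubic_C[OF q])
  obtain e s where e: "orthonormal_basis (T q) e" "normal_form e (r q) s" "e 1 = E q" using ex[OF q] by blast
  have "C q (e 1) (D X q h) (D X q k) = r q * (3 * (D X q h \<bullet> e 1) * (D X q k \<bullet> e 1) - D X q h \<bullet> D X q k)"
    by (rule normal_form_axis[OF e(1,2)]) simp_all
  then have "C q (D X q h) (e 1) (D X q k) = r q * (3 * (D X q h \<bullet> e 1) * (D X q k \<bullet> e 1) - D X q h \<bullet> D X q k)"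
    by (subst sym12)
  then show "D E q h \<bullet> J (D X q k) =
      r q * (3 * (D X q h \<bullet> E q) * (D X q k \<bullet> E q) - D X q h \<bullet> D X q k)"
    unfolding e(3) using tangent_field_deriv[OF E(1) ET q, of h k] by simp
qed

text \<open>Differentiating the formula for the normal part of \<open>D E\<close> once more and
  antisymmetrizing removes the second derivatives of \<open>E\<close>. What is left is the Codazzi
  equation with the axis in one slot.\<close>

lemma axis_field_second_derivative:
  assumes af: "axis_field E r" and q: "q \<in> P"
  shows "D E q h \<bullet> J (X2 q m k) - D E q m \<bullet> J (X2 q h k) =
    D r q m * (3 * (D X q h \<bullet> E q) * (D X q k \<bullet> E q) - D X q h \<bullet> D X q k)
    - D r q h * (3 * (D X q m \<bullet> E q) * (D X q k \<bullet> E q) - D X q m \<bullet> D X q k)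
    + r q * (3 * (D X q h \<bullet> D E q m - D X q m \<bullet> D E q h) * (D X q k \<bullet> E q)
      + 3 * (D X q h \<bullet> E q) * (X2 q m k \<bullet> E q + D X q k \<bullet> D E q m)
      - 3 * (D X q m \<bullet> E q) * (X2 q h k \<bullet> E q + D X q k \<bullet> D E q h)
      - D X q h \<bullet> X2 q m k + D X q m \<bullet> X2 q h k)"
proof -
  note E = axis_fieldD[OF af]
  have dE: "(E has_derivative D E q) (at q)" by (rule smooth_on_has_derivative[OF E(1) q])
  have dr: "(r has_derivative D r q) (at q)" by (rule smooth_on_has_derivative[OF E(2) q])
  define E2 where "E2 m h = D (\<lambda>x. D E x h) q m" for m h
  have E2: "E2 m h = E2 h m" unfolding E2_def by (rule second_derivative_symmetric[OF P E(1) q])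
  have dDE: "((\<lambda>x. D E x h) has_derivative (\<lambda>m. E2 m h)) (at q)" for h
    unfolding E2_def by (rule smooth_on_has_derivative[OF smooth_on_deriv[OF E(1)] q])
  have eq: "D E q h \<bullet> J (X2 q m k) + E2 m h \<bullet> J (D X q k) =
      r q * (3 * ((D X q h \<bullet> D E q m + X2 q m h \<bullet> E q) * (D X q k \<bullet> E q)
        + (D X q h \<bullet> E q) * (D X q k \<bullet> D E q m + X2 q m k \<bullet> E q))
        - (D X q h \<bullet> X2 q m k + X2 q m h \<bullet> D X q k))
      + D r q m * (3 * (D X q h \<bullet> E q) * (D X q k \<bullet> E q) - D X q h \<bullet> D X q k)" for m h
  proof -
    have "((\<lambda>x. D E x h \<bullet> J (D X x k)) has_derivative
        (\<lambda>m. D E q h \<bullet> J (X2 q m k) + E2 m h \<bullet> J (D X q k))) (at q)"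
      by (intro has_derivative_inner dDE DX_deriv J_deriv q)
    moreover have "((\<lambda>x. r x * (3 * ((D X x h \<bullet> E x) * (D X x k \<bullet> E x)) - D X x h \<bullet> D X x k)) has_derivative
        (\<lambda>m. r q * (3 * ((D X q h \<bullet> E q) * (D X q k \<bullet> D E q m + X2 q m k \<bullet> E q)
          + (D X q h \<bullet> D E q m + X2 q m h \<bullet> E q) * (D X q k \<bullet> E q))
          - (D X q h \<bullet> X2 q m k + X2 q m h \<bullet> D X q k))
        + D r q m * (3 * ((D X q h \<bullet> E q) * (D X q k \<bullet> E q)) - D X q h \<bullet> D X q k))) (at q)"
      by (intro has_derivative_mult dr has_derivative_diff has_derivative_mult_right has_derivative_inner
          DX_deriv q dE)
    then have "((\<lambda>x. D E x h \<bullet> J (D X x k)) has_derivative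
        (\<lambda>m. r q * (3 * ((D X q h \<bullet> E q) * (D X q k \<bullet> D E q m + X2 q m k \<bullet> E q)
          + (D X q h \<bullet> D E q m + X2 q m h \<bullet> E q) * (D X q k \<bullet> E q))
          - (D X q h \<bullet> X2 q m k + X2 q m h \<bullet> D X q k))
        + D r q m * (3 * ((D X q h \<bullet> E q) * (D X q k \<bullet> E q)) - D X q h \<bullet> D X q k))) (at q)"
      by (rule has_derivative_transform_within_open[OF _ P q]) (simp add: E(6) mult.assoc)
    ultimately have "(\<lambda>m. D E q h \<bullet> J (X2 q m k) + E2 m h \<bullet> J (D X q k)) =
        (\<lambda>m. r q * (3 * ((D X q h \<bullet> E q) * (D X q k \<bullet> D E q m + X2 q m k \<bullet> E q)
          + (D X q h \<bullet> D E q m + X2 q m h \<bullet> E q) * (D X q k \<bullet> E q))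
          - (D X q h \<bullet> X2 q m k + X2 q m h \<bullet> D X q k))
        + D r q m * (3 * ((D X q h \<bullet> E q) * (D X q k \<bullet> E q)) - D X q h \<bullet> D X q k))"
      by (rule has_derivative_unique)
    from fun_cong[OF this, of m] show ?thesis by (simp add: algebra_simps)
  qed
  show ?thesis
    using eq[of h m] eq[of m h] E2 X2_sym[OF q, of m h] inner_commute[of "X2 q h m" "D X q k"]
      inner_commute[of "X2 q h k" "D X q m"]
    by (simp add: algebra_simps)
qed

text \<open>In an adapted basis the proof splits \<open>D E\<close> into tangential components
  \<open>p\<close> and normal components \<open>n\<close>, and the second derivatives of
  \<open>X\<close> into \<open>t\<close> and \<open>c\<close>. The relations among them force the
  tangential part of \<open>D E\<close> to vanish along \<open>E\<close> and to be a multiple of the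
  identity on the complement.\<close>

lemma axis_field_derivative:
  assumes af: "axis_field E r" and q: "q \<in> P"
  obtains t where "\<forall>v. D E q v = Complex t (- r q) *s (D X q v - (D X q v \<bullet> E q) *\<^sub>R E q)
      + Complex 0 (2 * r q * (D X q v \<bullet> E q)) *s E q"
proof -
  note E = axis_fieldD[OF af]
  interpret symmetric_cubic "C q" by (rule symmetric_cubic_C[OF q])
  obtain e s where e: "orthonormal_basis (T q) e" "normal_form e (r q) s" "e 1 = E q"
    using af q by (auto simp: axis_field_def)
  note eD = orthonormal_basisD[OF e(1)]
  have un: "herm (e i) (e j) = (if i = j then 1 else 0)" for i j
    by (rule orthonormal_basis_unitary[OF e(1) lagrangian[OF q]])
  define h where "h i = \<tau> q (e i)" for i
  have Xh: "D X q (h i) = e i" for i unfolding h_def by (rule X_\<tau>[OF q eD(2)])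
  define p where "p i j = D E q (h i) \<bullet> e j" for i j
  define n where "n i j = D E q (h i) \<bullet> J (e j)" for i j
  define t where "t i j k = X2 q (h i) (h j) \<bullet> e k" for i j k
  define c where "c i j k = X2 q (h i) (h j) \<bullet> J (e k)" for i j k
  define \<rho> where "\<rho> i = D r q (h i)" for i
  have c: "c i j k = C q (e i) (e j) (e k)" for i j k
    unfolding c_def C_def cub_def using X_\<tau>[OF q eD(2)] by (simp add: h_def)
  have n: "n i j = r q * (3 * (if i = 1 then 1 else 0) * (if j = 1 then 1 else 0) - (if i = j then 1 else 0))" for i j
    using E(6)[OF q, of "h i" "h j"] unfolding n_def Xh e(3)[symmetric] by (simp add: eD(1))
  have p1: "p i 1 = 0" for i
  proof -
    have "((\<lambda>x. E x \<bullet> E x) has_derivative (\<lambda>h. E q \<bullet> D E q h + D E q h \<bullet> E q)) (at q)"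
      by (intro has_derivative_inner smooth_on_has_derivative[OF E(1) q])
    then have "((\<lambda>x. 1) has_derivative (\<lambda>h. E q \<bullet> D E q h + D E q h \<bullet> E q)) (at q)"
      by (rule has_derivative_transform_within_open[OF _ P q]) (simp add: E(4))
    from D_eqI[OF this, of "h i"] show ?thesis by (simp add: p_def e(3) inner_commute)
  qed
  have ts: "t i j k = t j i k" for i j k unfolding t_def by (subst X2_sym[OF q]) simp
  have JJ: "J v \<bullet> J w = v \<bullet> w" "J v \<bullet> w = - (v \<bullet> J w)" for v w by (rule inner_J)+
  \<comment> \<open>Under \<open>J\<close> tangential and normal components trade places; hence the
    pairing of \<open>n\<close> with \<open>t\<close> and of \<open>p\<close> with \<open>c\<close>,
    and the sign.\<close>
  have prod: "D E q (h i) \<bullet> J (X2 q (h j) (h k)) = (\<Sum>l\<in>UNIV. n i l * t j k l - p i l * c j k l)" for i j k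
    using unitary_inner[OF un, of "D E q (h i)" "J (X2 q (h j) (h k))"]
    by (simp add: JJ inner_J(3) p_def n_def t_def c_def sum_3)
  have I: "(\<Sum>l\<in>UNIV. n i l * t m k l - p i l * c m k l) - (\<Sum>l\<in>UNIV. n m l * t i k l - p m l * c i k l) =
      \<rho> m * (3 * (e i \<bullet> e 1) * (e k \<bullet> e 1) - e i \<bullet> e k)
      - \<rho> i * (3 * (e m \<bullet> e 1) * (e k \<bullet> e 1) - e m \<bullet> e k)
      + r q * (3 * (p m i - p i m) * (e k \<bullet> e 1)
        + 3 * (e i \<bullet> e 1) * (t m k 1 + p m k) - 3 * (e m \<bullet> e 1) * (t i k 1 + p i k) - t m k i + t i k m)" for m i k
    using axis_field_second_derivative[OF af q, of "h i" "h m" "h k"]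
    unfolding prod Xh e(3)[symmetric] \<rho>_def[symmetric]
    by (simp add: p_def t_def inner_commute)
  have nf: "c 1 1 1 = 2 * r q" "c 1 1 2 = 0" "c 1 1 3 = 0" "c 1 2 2 = - r q" "c 1 2 3 = 0" "c 1 3 3 = - r q"
    "c 2 2 2 = s" "c 2 2 3 = 0" "c 2 3 3 = - s" "c 3 3 3 = 0"
    using e(2) by (simp_all add: c normal_form_def)
  have cs: "c 2 1 k = c 1 2 k" "c 3 1 k = c 1 3 k" "c 3 2 k = c 2 3 k" "c k 2 1 = c k 1 2"
    "c k 3 1 = c k 1 3" "c k 3 2 = c k 2 3" for k
    unfolding c by (rule sym12 sym23)+
  have tsort: "t 2 1 k = t 1 2 k" "t 3 1 k = t 1 3 k" "t 3 2 k = t 2 3 k" for k by (rule ts)+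
  note ss = sum_3 n p1 nf cs tsort eD(1)
  \<comment> \<open>In every instance of \<open>I\<close> the terms with \<open>t\<close> cancel,
    because \<open>n\<close> is the very tensor \<open>r (3 E E - g)\<close> that was
    differentiated.\<close>
  have eqs: "\<rho> 2 = 2 * r q * p 1 2" "\<rho> 3 = 2 * r q * p 1 3" "4 * r q * p 2 3 = 4 * r q * p 3 2"
    "4 * r q * p 2 2 = - \<rho> 1 - s * p 1 2" "4 * r q * p 3 3 = - \<rho> 1 + s * p 1 2" "4 * r q * p 2 3 = s * p 1 3"
    "s * p 2 2 - s * p 3 3 = \<rho> 2" "- s * p 2 3 - s * p 3 2 = \<rho> 3"
    using I[of 1 2 1] I[of 1 3 1] I[of 3 2 1] I[of 2 1 2] I[of 3 1 3] I[of 2 1 3] I[of 3 2 3] I[of 2 3 2]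
    by (simp_all add: ss E(5)[OF q] algebra_simps)
  note pp = codazzi_algebra[OF E(5)[OF q] eqs]
  have DE: "D E q (h i) = (\<Sum>j\<in>UNIV. Complex (p i j) (n i j) *s e j)" for i
    unfolding p_def n_def herm_eq[symmetric] by (rule unitary_expand(1)[OF un])
  have D1: "D E q (h 1) = Complex 0 (2 * r q) *s e 1"
    unfolding DE by (simp add: sum_3 n p1 pp complex_eq_iff flip: zero_complex.code)
  have D2: "D E q (h 2) = Complex (p 2 2) (- r q) *s e 2"
    unfolding DE by (simp add: sum_3 n p1 pp flip: zero_complex.code)
  have D3: "D E q (h 3) = Complex (p 2 2) (- r q) *s e 3"
    unfolding DE by (simp add: sum_3 n p1 pp flip: zero_complex.code)
  have lE: "linear (D E q)" by (rule linear_D[OF E(1) q])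
  show ?thesis
  proof (rule that[of "p 2 2"], rule allI)
    fix v
    define a where "a i = D X q v \<bullet> e i" for i
    have Xv: "D X q v = a 1 *\<^sub>R e 1 + a 2 *\<^sub>R e 2 + a 3 *\<^sub>R e 3"
      using eD(4)[OF DX_T, of v] by (simp add: sum_3 a_def)
    then have "\<tau> q (D X q v) = a 1 *\<^sub>R h 1 + a 2 *\<^sub>R h 2 + a 3 *\<^sub>R h 3"
      by (simp add: h_def linear_add[OF linear_\<tau>[OF q]] linear_cmul[OF linear_\<tau>[OF q]])
    then have v: "v = a 1 *\<^sub>R h 1 + a 2 *\<^sub>R h 2 + a 3 *\<^sub>R h 3" by (simp add: \<tau>_X[OF q])
    have "D E q v = a 1 *\<^sub>R D E q (h 1) + a 2 *\<^sub>R D E q (h 2) + a 3 *\<^sub>R D E q (h 3)"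
      by (subst v) (simp add: linear_add[OF lE] linear_cmul[OF lE])
    also have "\<dots> = Complex (p 2 2) (- r q) *s (a 2 *\<^sub>R e 2 + a 3 *\<^sub>R e 3) + Complex 0 (2 * r q * a 1) *s e 1"
      unfolding D1 D2 D3 by (simp add: vec_eq_iff complex_eq_iff algebra_simps)
    also have "a 2 *\<^sub>R e 2 + a 3 *\<^sub>R e 3 = D X q v - (D X q v \<bullet> E q) *\<^sub>R E q"
      unfolding a_def[symmetric] e(3)[symmetric] by (simp add: Xv)
    finally show "D E q v = Complex (p 2 2) (- r q) *s (D X q v - (D X q v \<bullet> E q) *\<^sub>R E q)
      + Complex 0 (2 * r q * (D X q v \<bullet> E q)) *s E q"
      by (simp add: a_def e(3))
  qed
qed

end

lemma smooth_on_Complex: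
  assumes "open S" "smooth_on S a" "smooth_on S b"
  shows "smooth_on S (\<lambda>x. Complex (a x) (b x))"
proof -
  have "smooth_on S (\<lambda>x. a x *\<^sub>R 1 + b x *\<^sub>R \<i>)"
    using assms by (intro smooth_on_add smooth_on_scaleR smooth_on_const)
  moreover have "a x *\<^sub>R 1 + b x *\<^sub>R \<i> = Complex (a x) (b x)" for x by (simp add: complex_eq_iff)
  ultimately show ?thesis by simp
qed

section \<open>Smoothness of the coefficient \<zeta> and its derivative\<close>

context sl_chart
begin

text \<open>For \<open>\<zeta> = t - \<i> r\<close> the factor
  \<open>cnj \<zeta> - 2 * \<zeta>\<close> is \<open>2 \<i> r - \<zeta>\<close>. Written through
  \<zeta> alone it removes \<open>r\<close> and \<open>t\<close> from what follows, and the
  condition on \<open>Im\<close> records that \<open>r\<close> is nonzero.\<close>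

definition flat_field where
  "flat_field E \<zeta> \<longleftrightarrow> smooth_on P E \<and> smooth_on P \<zeta> \<and>
    (\<forall>q\<in>P. E q \<in> T q \<and> E q \<bullet> E q = 1 \<and> Im (\<zeta> q) \<noteq> 0 \<and>
      (\<forall>v. D E q v = \<zeta> q *s D X q v + ((cnj (\<zeta> q) - 2 * \<zeta> q) * of_real (D X q v \<bullet> E q)) *s E q) \<and>
      (\<forall>v. D \<zeta> q v = (cnj (\<zeta> q) - 2 * \<zeta> q) * \<zeta> q * of_real (D X q v \<bullet> E q)))"

lemma inner_scale_T:
  assumes "q \<in> P" "v \<in> T q" "w \<in> T q"
  shows "v \<bullet> (c *s w) = Re c * (v \<bullet> w)" "(c *s w) \<bullet> v = Re c * (v \<bullet> w)"
  using lagrangian[OF assms] by (simp_all add: scale_eq_scaleR inner_add_right inner_commute[of _ v])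

text \<open>So far the coefficient is known pointwise. The tangential part of \<open>D E\<close> is
  \<open>t\<close> times the projection to a plane, so half of its trace in a smooth frame is a
  smooth formula for \<open>t\<close>.\<close>

lemma axis_field_coefficient:
  assumes af: "axis_field E r"
  obtains t where "smooth_on P t"
    "\<forall>q\<in>P. \<forall>v. D E q v = Complex (t q) (- r q) *s (D X q v - (D X q v \<bullet> E q) *\<^sub>R E q)
      + Complex 0 (2 * r q * (D X q v \<bullet> E q)) *s E q"
proof -
  note E = axis_fieldD[OF af]
  obtain \<theta> where \<theta>: "\<forall>i. smooth_on P (\<theta> i)"
    "\<forall>q\<in>P. \<forall>i j. D X q (\<theta> (i::3) q) \<bullet> D X q (\<theta> j q) = (if i = j then 1 else 0)"
    by (rule orthonormal_frame[OF P X chart_inverse_derivative(2)[OF ch]])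
  define t where "t q = (\<Sum>i\<in>UNIV. D E q (\<theta> i q) \<bullet> D X q (\<theta> i q)) * (1 / 2)" for q
  have st: "smooth_on P t"
    unfolding t_def using \<theta>(1)
    by (intro smooth_on_mult smooth_on_const smooth_on_sum smooth_on_inner smooth_on_deriv_apply P E X) auto
  show ?thesis
  proof (rule that[OF st], rule ballI)
    fix q assume q: "q \<in> P"
    let ?f = "\<lambda>i. D X q (\<theta> i q)"
    have onb: "orthonormal_basis (T q) ?f" by (rule frame_traceless(1)[OF \<theta> q])
    obtain t' where t': "\<forall>v. D E q v = Complex t' (- r q) *s (D X q v - (D X q v \<bullet> E q) *\<^sub>R E q)
      + Complex 0 (2 * r q * (D X q v \<bullet> E q)) *s E q"
      by (rule axis_field_derivative[OF af q])
    have "D E q (\<theta> i q) \<bullet> ?f i = t' * (1 - (E q \<bullet> ?f i) * (?f i \<bullet> E q))" for i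
    proof -
      define w where "w = ?f i - (?f i \<bullet> E q) *\<^sub>R E q"
      have w: "w \<in> T q"
        unfolding w_def by (intro subspace_diff subspace_scale subspace_T q E(3) DX_T)
      have "(Complex t' (- r q) *s w) \<bullet> ?f i = t' * (?f i \<bullet> w)"
        using inner_scale_T(2)[OF q DX_T w] by simp
      moreover have "(Complex 0 (2 * r q * (?f i \<bullet> E q)) *s E q) \<bullet> ?f i = 0"
        using inner_scale_T(2)[OF q DX_T E(3)[OF q]] by simp
      moreover have "?f i \<bullet> w = 1 - (E q \<bullet> ?f i) * (?f i \<bullet> E q)"
        unfolding w_def inner_diff_right by (simp add: orthonormal_basisD(1)[OF onb] inner_commute)
      ultimately show ?thesis
        using t'[rule_format, of "\<theta> i q"] unfolding w_def[symmetric] by (simp add: inner_add_left)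
    qed
    then have "t q = (\<Sum>i\<in>UNIV. t' * (1 - (E q \<bullet> ?f i) * (?f i \<bullet> E q))) * (1 / 2)"
      by (simp add: t_def)
    also have "\<dots> = t' * (3 - E q \<bullet> E q) * (1 / 2)"
      unfolding orthonormal_basis_inner[OF onb E(3)[OF q], of "E q"]
      by (simp add: sum_3 algebra_simps)
    finally have "t q = t'" by (simp add: E(4)[OF q])
    then show "\<forall>v. D E q v = Complex (t q) (- r q) *s (D X q v - (D X q v \<bullet> E q) *\<^sub>R E q)
      + Complex 0 (2 * r q * (D X q v \<bullet> E q)) *s E q" using t' by simp
  qed
qed

lemma flat_field_exists:
  assumes af: "axis_field E r"
  obtains \<zeta> where "flat_field E \<zeta>"
proof -
  note E = axis_fieldD[OF af]
  obtain t where t: "smooth_on P t"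
    "\<forall>q\<in>P. \<forall>v. D E q v = Complex (t q) (- r q) *s (D X q v - (D X q v \<bullet> E q) *\<^sub>R E q)
      + Complex 0 (2 * r q * (D X q v \<bullet> E q)) *s E q"
    by (rule axis_field_coefficient[OF af])
  define \<zeta> where "\<zeta> q = Complex (t q) (- r q)" for q
  define \<mu> where "\<mu> q = cnj (\<zeta> q) - 2 * \<zeta> q" for q
  have s\<zeta>: "smooth_on P \<zeta>"
    unfolding \<zeta>_def by (intro smooth_on_Complex smooth_on_uminus P t E)
  have DE: "D E q v = \<zeta> q *s D X q v + (\<mu> q * of_real (D X q v \<bullet> E q)) *s E q" if q: "q \<in> P" for q v
  proof -
    have \<zeta>': "t q = Re (\<zeta> q)" "r q = - Im (\<zeta> q)" by (simp_all add: \<zeta>_def)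
    show ?thesis
      unfolding t(2)[rule_format, OF q] unfolding \<zeta>' \<mu>_def
      by (simp add: vec_eq_iff complex_eq_iff algebra_simps)
  qed
  have D\<zeta>: "D \<zeta> q v = \<mu> q * \<zeta> q * of_real (D X q v \<bullet> E q)" if q: "q \<in> P" for q v
  proof -
    have dE: "(E has_derivative D E q) (at q)" by (rule smooth_on_has_derivative[OF E(1) q])
    define \<zeta>' where "\<zeta>' = D \<zeta> q"
    have d\<zeta>: "(\<zeta> has_derivative \<zeta>') (at q)"
      unfolding \<zeta>'_def by (rule smooth_on_has_derivative[OF s\<zeta> q])
    define \<mu>' where "\<mu>' k = cnj (\<zeta>' k) - 2 * \<zeta>' k" for k
    have d\<mu>: "(\<mu> has_derivative \<mu>') (at q)"
      unfolding \<mu>_def \<mu>'_def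
      by (intro has_derivative_diff has_derivative_mult_right d\<zeta> bounded_linear.has_derivative[OF bounded_linear_cnj])
    define E2 where "E2 m h = D (\<lambda>x. D E x h) q m" for m h
    have E2: "E2 m h = E2 h m" for m h
      unfolding E2_def by (rule second_derivative_symmetric[OF P E(1) q])
    have dDE: "((\<lambda>x. D E x h) has_derivative (\<lambda>m. E2 m h)) (at q)" for h
      unfolding E2_def by (rule smooth_on_has_derivative[OF smooth_on_deriv[OF E(1)] q])
    have E2eq: "E2 k h = (\<zeta> q *s X2 q k h + \<zeta>' k *s D X q h) +
        ((\<mu> q * of_real (D X q h \<bullet> E q)) *s D E q k +
          (\<mu> q * of_real (D X q h \<bullet> D E q k + X2 q k h \<bullet> E q) + \<mu>' k * of_real (D X q h \<bullet> E q)) *s E q)" for k h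
    proof -
      have "((\<lambda>x. \<zeta> x *s D X x h + (\<mu> x * of_real (D X x h \<bullet> E x)) *s E x) has_derivative
        (\<lambda>k. (\<zeta> q *s X2 q k h + \<zeta>' k *s D X q h) +
        ((\<mu> q * of_real (D X q h \<bullet> E q)) *s D E q k +
          (\<mu> q * of_real (D X q h \<bullet> D E q k + X2 q k h \<bullet> E q) + \<mu>' k * of_real (D X q h \<bullet> E q)) *s E q))) (at q)"
        by (intro has_derivative_add bounded_bilinear.FDERIV[OF bounded_bilinear_scale]
            has_derivative_mult has_derivative_of_real has_derivative_inner d\<zeta> d\<mu> dE DX_deriv q)
      then have "((\<lambda>x. D E x h) has_derivative
        (\<lambda>k. (\<zeta> q *s X2 q k h + \<zeta>' k *s D X q h) +
        ((\<mu> q * of_real (D X q h \<bullet> E q)) *s D E q k +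
          (\<mu> q * of_real (D X q h \<bullet> D E q k + X2 q k h \<bullet> E q) + \<mu>' k * of_real (D X q h \<bullet> E q)) *s E q))) (at q)"
        by (rule has_derivative_transform_within_open[OF _ P q]) (simp add: DE)
      from has_derivative_unique[OF dDE this, THEN fun_cong, of k] show ?thesis .
    qed
    have XE: "D X q h \<bullet> D E q k = Re (\<zeta> q) * (D X q h \<bullet> D X q k) + Re (\<mu> q) * (D X q k \<bullet> E q) * (D X q h \<bullet> E q)" for h k
      unfolding DE[OF q] inner_add_right
      using inner_scale_T(1)[OF q DX_T DX_T] inner_scale_T(1)[OF q DX_T E(3)[OF q]] by simp
    \<comment> \<open>Antisymmetrizing the derivative of the formula for \<open>D E\<close> removes
      the second derivatives of \<open>E\<close> and \<open>X\<close>. The components of this vector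
      equation along \<open>e 2\<close> and \<open>e 3\<close> then determine the derivative of
      \<zeta>.\<close>
    have zero: "\<zeta>' k *s D X q h - \<zeta>' h *s D X q k + (\<mu> q * of_real (D X q h \<bullet> E q)) *s D E q k
        - (\<mu> q * of_real (D X q k \<bullet> E q)) *s D E q h
        + (\<mu>' k * of_real (D X q h \<bullet> E q) - \<mu>' h * of_real (D X q k \<bullet> E q)) *s E q = 0" for h k
    proof -
      have sym: "D X q h \<bullet> D E q k = D X q k \<bullet> D E q h" unfolding XE by (simp add: inner_commute algebra_simps)
      have "E2 k h - E2 h k = 0" using E2[of k h] by simp
      then show ?thesis
        unfolding E2eq X2_sym[OF q, of h k] sym by (simp add: vec_eq_iff algebra_simps)
    qed
    obtain e where e: "orthonormal_basis (T q) e" "e 1 = E q"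
      using af q by (auto simp: axis_field_def)
    note eD = orthonormal_basisD[OF e(1)]
    have un: "herm (e i) (e j) = (if i = j then 1 else 0)" for i j
      by (rule orthonormal_basis_unitary[OF e(1) lagrangian[OF q]])
    define h where "h i = \<tau> q (e i)" for i
    have Xh: "D X q (h i) = e i" for i unfolding h_def by (rule X_\<tau>[OF q eD(2)])
    have z3: "\<zeta>' (h 3) = 0"
      using arg_cong[OF zero[of "h 3" "h 2"], of "\<lambda>v. herm v (e 2)"]
      unfolding Xh e(2)[symmetric] by (simp add: eD(1) herm_left un)
    have z2: "\<zeta>' (h 2) = 0"
      using arg_cong[OF zero[of "h 3" "h 2"], of "\<lambda>v. herm v (e 3)"]
      unfolding Xh e(2)[symmetric] by (simp add: eD(1) herm_left un)
    have "D E q (h 2) = \<zeta> q *s e 2"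
      unfolding DE[OF q] Xh e(2)[symmetric] by (simp add: eD(1))
    then have z1: "\<zeta>' (h 1) = \<mu> q * \<zeta> q"
      using arg_cong[OF zero[of "h 1" "h 2"], of "\<lambda>v. herm v (e 2)"]
      unfolding Xh e(2)[symmetric] by (simp add: eD(1) herm_left un)
    have l\<zeta>: "linear \<zeta>'" using d\<zeta> has_derivative_linear by blast
    define a where "a i = D X q v \<bullet> e i" for i
    have Xv: "D X q v = a 1 *\<^sub>R e 1 + a 2 *\<^sub>R e 2 + a 3 *\<^sub>R e 3"
      using eD(4)[OF DX_T, of v] by (simp add: sum_3 a_def)
    then have "\<tau> q (D X q v) = a 1 *\<^sub>R h 1 + a 2 *\<^sub>R h 2 + a 3 *\<^sub>R h 3"
      by (simp add: h_def linear_add[OF linear_\<tau>[OF q]] linear_cmul[OF linear_\<tau>[OF q]])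
    then have v: "v = a 1 *\<^sub>R h 1 + a 2 *\<^sub>R h 2 + a 3 *\<^sub>R h 3" by (simp add: \<tau>_X[OF q])
    have "\<zeta>' v = a 1 *\<^sub>R \<zeta>' (h 1) + a 2 *\<^sub>R \<zeta>' (h 2) + a 3 *\<^sub>R \<zeta>' (h 3)"
      by (subst v) (simp add: linear_add[OF l\<zeta>] linear_cmul[OF l\<zeta>])
    then show ?thesis
      unfolding \<zeta>'_def[symmetric] by (simp add: z1 z2 z3 a_def e(2) scaleR_conv_of_real mult.commute)
  qed
  have "flat_field E \<zeta>"
    unfolding flat_field_def
  proof (intro conjI ballI allI)
    fix q v assume q: "q \<in> P"
    show "E q \<in> T q" "E q \<bullet> E q = 1" using E(3,4) q by auto
    show "Im (\<zeta> q) \<noteq> 0" using E(5)[OF q] by (simp add: \<zeta>_def)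
    show "D E q v = \<zeta> q *s D X q v + ((cnj (\<zeta> q) - 2 * \<zeta> q) * of_real (D X q v \<bullet> E q)) *s E q"
      using DE[OF q, of v] by (simp add: \<mu>_def)
    show "D \<zeta> q v = (cnj (\<zeta> q) - 2 * \<zeta> q) * \<zeta> q * of_real (D X q v \<bullet> E q)"
      using D\<zeta>[OF q, of v] by (simp add: \<mu>_def)
  qed (use E s\<zeta> in auto)
  then show ?thesis by (rule that)
qed

end

subsection \<open>Special Lagrangian submanifolds over a Legendrian surface\<close>

lemma special_lagrangianI:
  assumes "\<And>p. p \<in> M \<Longrightarrow> \<exists>P (f :: real \<times> complex \<Rightarrow> complex ^ 3) N \<kappa>. chart M P f N \<kappa> \<and> p \<in> N \<and>
    (\<forall>q\<in>P. (\<forall>h k. Im (herm (D f q h) (D f q k)) = 0) \<and>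
      (\<forall>h k l. Im (Upsilon (D f q h) (D f q k) (D f q l)) = 0))"
  shows "special_lagrangian M"
proof -
  have "smooth_submanifold DIM(real \<times> complex) M"
    by (rule chart_imp_submanifold) (use assms in blast)
  moreover have "(\<forall>a\<in>tangent_space M p. \<forall>b\<in>tangent_space M p. kaehler_form a b = 0) \<and>
     (\<forall>a\<in>tangent_space M p. \<forall>b\<in>tangent_space M p. \<forall>c\<in>tangent_space M p. Im (Upsilon a b c) = 0)"
    if p: "p \<in> M" for p
  proof -
    obtain P N \<kappa> and f :: "real \<times> complex \<Rightarrow> complex ^ 3" where c: "chart M P f N \<kappa>" "p \<in> N"
      and f: "\<forall>q\<in>P. (\<forall>h k. Im (herm (D f q h) (D f q k)) = 0) \<and>
        (\<forall>h k l. Im (Upsilon (D f q h) (D f q k) (D f q l)) = 0)"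
      using assms[OF p] by blast
    have q: "\<kappa> p \<in> P" "f (\<kappa> p) = p" using chartD(9,10)[OF c(1) p c(2)] by auto
    have "tangent_space M p = range (D f (\<kappa> p))" using chart_tangent_space[OF c(1) q(1)] q(2) by simp
    then show ?thesis using f q(1) by (auto simp: kaehler_form_herm)
  qed
  ultimately show ?thesis by (simp add: special_lagrangian_def numeral_3_eq_3)
qed

text \<open>Common model for tangent vectors of the cone and of \<open>L_of\<close>: a multiple of
  \<open>u\<close> plus \<open>z\<close> times a vector tangent to the surface.
  \<open>Upsilon\<close> of three of them is \<open>Upsilon u p q\<close> times a real combination
  of the numbers \<open>\<alpha> i * z\<^sup>2\<close>, whose reality also makes
  \<open>\<alpha> i * cnj (\<alpha> j)\<close> real.\<close>

lemma legendrian_tangent_vectors: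
  assumes u: "herm u u = 1" "herm u p = 0" "herm u q = 0" "Im (herm p q) = 0" "Im (Upsilon u p q) = 0"
    and z: "z \<noteq> 0" and \<alpha>: "\<And>i. Im (\<alpha> i * z\<^sup>2) = 0"
    and v: "\<And>i. v i = \<alpha> i *s u + z *s (x i *\<^sub>R p + y i *\<^sub>R q)"
  shows "Im (herm (v i) (v j)) = 0" "Im (Upsilon (v i) (v j) (v k)) = 0"
proof -
  have pq: "herm p u = 0" "herm q u = 0" "herm q p = herm p q" "Im (herm p p) = 0" "Im (herm q q) = 0"
    using u herm_commute[of u p] herm_commute[of u q] herm_commute[of q p]
    by (simp_all add: complex_eq_iff herm_self)
  have "herm (v i) (v j) = \<alpha> i * cnj (\<alpha> j) + z * cnj z *
      (of_real (x i * x j) * herm p p + of_real (x i * y j + y i * x j) * herm p q + of_real (y i * y j) * herm q q)"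
    unfolding v by (simp add: herm_left herm_right u pq algebra_simps)
  moreover have "z * cnj z = of_real ((norm z)\<^sup>2)" by (simp add: complex_norm_square[symmetric])
  moreover have "Im (\<alpha> i * cnj (\<alpha> j)) = 0"
  proof -
    have r: "\<alpha> k * z\<^sup>2 = of_real (Re (\<alpha> k * z\<^sup>2))" for k using \<alpha>[of k] by (simp add: complex_eq_iff)
    have "\<alpha> i * cnj (\<alpha> j) * of_real ((norm (z\<^sup>2))\<^sup>2) = (\<alpha> i * z\<^sup>2) * cnj (\<alpha> j * z\<^sup>2)"
      unfolding complex_norm_square by (simp add: ac_simps)
    also have "\<dots> = of_real (Re (\<alpha> i * z\<^sup>2) * Re (\<alpha> j * z\<^sup>2))"
      by (subst r[of i], subst r[of j]) simp
    finally have "Im (\<alpha> i * cnj (\<alpha> j) * of_real ((norm (z\<^sup>2))\<^sup>2)) = 0" by (metis Im_complex_of_real)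
    then show ?thesis using z by simp
  qed
  ultimately show "Im (herm (v i) (v j)) = 0" using u(4) pq(4,5) by simp
  have "Upsilon (v i) (v j) (v k) =
      (of_real (x j * y k - x k * y j) * (\<alpha> i * z\<^sup>2) - of_real (x i * y k - x k * y i) * (\<alpha> j * z\<^sup>2)
      + of_real (x i * y j - x j * y i) * (\<alpha> k * z\<^sup>2)) * Upsilon u p q"
    unfolding v
    by (simp add: Upsilon_add Upsilon_scale Upsilon_scaleR Upsilon_alternating Upsilon_swap(1)[of p u]
        Upsilon_swap(1)[of q u] Upsilon_swap(1)[of q p] Upsilon_swap(2)[of u q p] Upsilon_swap(2)[of p q u]
        Upsilon_swap(2)[of q p u] power2_eq_square algebra_simps)
  then show "Im (Upsilon (v i) (v j) (v k)) = 0" using \<alpha> u(5) by simp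
qed

text \<open>Supplies a branch of the cube root, through which the curve
  \<open>Im (z ^ 3) = - c\<close> is parametrized by the real part of \<open>z ^ 3\<close>.\<close>

lemma cube_local_inverse:
  assumes "z \<noteq> 0"
  obtains U V g where "open U" "open V" "z \<in> U" "homeomorphism U V (\<lambda>z::complex. z ^ 3) g" "smooth_on V g"
proof -
  have "((\<lambda>z. z ^ 3) has_derivative (\<lambda>h. 3 * z\<^sup>2 * h)) (at z)"
    by (auto intro!: derivative_eq_intros simp: algebra_simps)
  then have "D (\<lambda>z. z ^ 3) z = (\<lambda>h. 3 * z\<^sup>2 * h)" using frechet_derivative_at by metis
  then have "inj (D (\<lambda>z. z ^ 3) z)" using assms by (simp add: inj_def)
  then show ?thesis
    using smooth_inverse_function[OF open_UNIV smooth_on_power[OF open_UNIV smooth_on_id], of z 3] that by (metis UNIV_I)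
qed

text \<open>\<open>Y\<close> is a left inverse of \<open>u\<close> invariant under all nonzero
  complex factors, phases included. One and the same \<open>Y\<close> therefore reads the surface
  parameter off points of the surface, of its cone and of \<open>L_of\<close>.\<close>

locale legendrian =
  fixes B :: "complex set" and u :: "complex \<Rightarrow> complex ^ 3" and N :: "(complex ^ 3) set" and Y
  assumes B: "open B" and u: "smooth_on B u" and norm_u: "b \<in> B \<Longrightarrow> norm (u b) = 1"
    and N: "open N" "0 \<notin> N" and Y: "smooth_on N Y"
    and Y_u: "b \<in> B \<Longrightarrow> u b \<in> N" "b \<in> B \<Longrightarrow> Y (u b) = b"
    and Y_scale: "x \<in> N \<Longrightarrow> c \<noteq> 0 \<Longrightarrow> c *s x \<in> N" "x \<in> N \<Longrightarrow> c \<noteq> 0 \<Longrightarrow> Y (c *s x) = Y x"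
    and leg: "b \<in> B \<Longrightarrow> herm (u b) (D u b h) = 0"
    and lag: "b \<in> B \<Longrightarrow> Im (herm (D u b h) (D u b k)) = 0"
    and spec: "b \<in> B \<Longrightarrow> Im (Upsilon (u b) (D u b h) (D u b k)) = 0"
begin

lemma tangent_vectors:
  assumes b: "b \<in> B" and z: "z \<noteq> 0" and \<alpha>: "\<And>h. Im (\<alpha> h * z\<^sup>2) = 0"
    and v: "\<And>h. v h = \<alpha> h *s u b + z *s D u b (\<beta> h)"
  shows "Im (herm (v h) (v k)) = 0" "Im (Upsilon (v h) (v k) (v l)) = 0"
proof -
  have lin: "linear (D u b)" by (rule linear_D[OF u b])
  have "D u b h = Re h *\<^sub>R D u b 1 + Im h *\<^sub>R D u b \<i>" for h
  proof -
    have "D u b (Re h *\<^sub>R 1 + Im h *\<^sub>R \<i>) = Re h *\<^sub>R D u b 1 + Im h *\<^sub>R D u b \<i>"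
      by (simp only: linear_add[OF lin] linear_cmul[OF lin])
    moreover have "Re h *\<^sub>R 1 + Im h *\<^sub>R \<i> = h" by (simp add: complex_eq_iff)
    ultimately show ?thesis by simp
  qed
  then have v': "v h = \<alpha> h *s u b + z *s (Re (\<beta> h) *\<^sub>R D u b 1 + Im (\<beta> h) *\<^sub>R D u b \<i>)" for h
    unfolding v by metis
  have "herm (u b) (u b) = 1" using norm_u[OF b] by (simp add: herm_self)
  note main = legendrian_tangent_vectors[OF this leg[OF b] leg[OF b] lag[OF b] spec[OF b] z \<alpha> v']
  show "Im (herm (v h) (v k)) = 0" "Im (Upsilon (v h) (v k) (v l)) = 0" by (rule main)+
qed

definition N' where "N' = {x \<in> N. Y x \<in> B}"

lemma N': "open N'" "0 \<notin> N'" "b \<in> B \<Longrightarrow> u b \<in> N'" "x \<in> N' \<Longrightarrow> c \<noteq> 0 \<Longrightarrow> c *s x \<in> N'"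
    "smooth_on N' Y"
  using open_vimage_Int[OF N(1) smooth_on_continuous[OF Y] B] N(2) Y_u Y_scale smooth_on_mono[OF Y, of N']
  by (auto simp: N'_def)

lemma chart_surface: "chart (u ` B) B u N' Y"
  unfolding chart_def using B N' u Y_u by auto

lemma chart_cone:
  "chart (cone_on (u ` B)) ({0<..} \<times> B) (\<lambda>p. fst p *\<^sub>R u (snd p)) N' (\<lambda>x. (norm x, Y x))"
  unfolding chart_def
proof (intro conjI)
  show o: "open ({0::real<..} \<times> B)" using B by (simp add: open_Times)
  show "open N'" by (rule N')
  show "smooth_on ({0<..} \<times> B) (\<lambda>p. fst p *\<^sub>R u (snd p))"
    by (intro smooth_on_scaleR o smooth_on_linear bounded_linear_fst smooth_on_compose[OF o B _ _ u] bounded_linear_snd) auto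
  show "smooth_on N' (\<lambda>x. (norm x, Y x))"
    using N' by (intro smooth_on_Pair smooth_on_norm smooth_on_id) auto
  have r: "r *\<^sub>R x \<in> N' \<longleftrightarrow> x \<in> N'" "Y (r *\<^sub>R u b) = b" if "r > 0" "x \<in> N'" "b \<in> B" for r x b
    using that N'(4)[of x "of_real r"] Y_scale(2)[OF Y_u(1)[OF that(3)], of "of_real r"] Y_u(2)[OF that(3)]
    by (simp_all add: of_real_scale)
  show "(\<lambda>p. fst p *\<^sub>R u (snd p)) ` ({0<..} \<times> B) = cone_on (u ` B) \<inter> N'"
  proof (intro equalityI subsetI)
    fix x assume "x \<in> (\<lambda>p. fst p *\<^sub>R u (snd p)) ` ({0<..} \<times> B)"
    then obtain r b where rb: "r > 0" "b \<in> B" "x = r *\<^sub>R u b" by auto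
    then show "x \<in> cone_on (u ` B) \<inter> N'" using r(1)[OF rb(1) N'(3)[OF rb(2)] rb(2)] N'(3)[OF rb(2)]
      by (auto simp: cone_on_def)
  next
    fix x assume "x \<in> cone_on (u ` B) \<inter> N'"
    then obtain r b where "r > 0" "b \<in> B" "x = r *\<^sub>R u b" by (auto simp: cone_on_def)
    then show "x \<in> (\<lambda>p. fst p *\<^sub>R u (snd p)) ` ({0<..} \<times> B)"
      by (intro image_eqI[of _ _ "(r, b)"]) auto
  qed
  show "\<forall>q\<in>{0<..} \<times> B. (norm (fst q *\<^sub>R u (snd q)), Y (fst q *\<^sub>R u (snd q))) = q"
    using r(2)[OF _ N'(3)] norm_u by auto
qed

text \<open>The cone is the case of the common tangent vector model in which both \<open>z\<close>
  and \<alpha> are real.\<close>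

lemma sl_cone_link_surface: "sl_cone_link (u ` B)"
proof -
  have "smooth_submanifold DIM(complex) (u ` B)"
    by (rule chart_imp_submanifold) (use chart_surface N'(3) in blast)
  moreover have "special_lagrangian (cone_on (u ` B))"
  proof (rule special_lagrangianI)
    fix p assume "p \<in> cone_on (u ` B)"
    then obtain r b where rb: "r > 0" "b \<in> B" "p = r *\<^sub>R u b" by (auto simp: cone_on_def)
    then have "p \<in> N'" using N'(4)[OF N'(3)[OF rb(2)], of "of_real r"] by (simp add: of_real_scale)
    moreover have "(\<forall>h k. Im (herm (D (\<lambda>p. fst p *\<^sub>R u (snd p)) q h) (D (\<lambda>p. fst p *\<^sub>R u (snd p)) q k)) = 0) \<and>
      (\<forall>h k l. Im (Upsilon (D (\<lambda>p. fst p *\<^sub>R u (snd p)) q h) (D (\<lambda>p. fst p *\<^sub>R u (snd p)) q k)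
        (D (\<lambda>p. fst p *\<^sub>R u (snd p)) q l)) = 0)" if q: "q \<in> {0<..} \<times> B" for q
    proof -
      have b: "snd q \<in> B" and r: "fst q > 0" using q by auto
      have "((\<lambda>p. u (snd p)) has_derivative (\<lambda>h. D u (snd q) (snd h))) (at q)"
        by (rule has_derivative_compose[OF bounded_linear_imp_has_derivative[OF bounded_linear_snd]
            smooth_on_has_derivative[OF u b]])
      then have "((\<lambda>p. fst p *\<^sub>R u (snd p)) has_derivative
          (\<lambda>h. fst q *\<^sub>R D u (snd q) (snd h) + fst h *\<^sub>R u (snd q))) (at q)"
        by (rule has_derivative_scaleR[OF bounded_linear_imp_has_derivative[OF bounded_linear_fst]])
      from D_eqI[OF this] have d: "D (\<lambda>p. fst p *\<^sub>R u (snd p)) q h =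
          of_real (fst h) *s u (snd q) + of_real (fst q) *s D u (snd q) (snd h)" for h
        by (simp add: of_real_scale add.commute)
      have "of_real (fst q) \<noteq> (0::complex)" using r by simp
      moreover have "Im (of_real (fst h) * (of_real (fst q))\<^sup>2) = 0" for h :: "real \<times> complex"
        by (metis Im_complex_of_real of_real_mult of_real_power)
      ultimately show ?thesis
        using tangent_vectors[OF b, of "of_real (fst q)" "\<lambda>h. of_real (fst h)" "\<lambda>h. D (\<lambda>p. fst p *\<^sub>R u (snd p)) q h" snd] d
        by blast
    qed
    ultimately show "\<exists>P (f :: real \<times> complex \<Rightarrow> complex ^ 3) N \<kappa>. chart (cone_on (u ` B)) P f N \<kappa> \<and> p \<in> N \<and>
      (\<forall>q\<in>P. (\<forall>h k. Im (herm (D f q h) (D f q k)) = 0) \<and>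
        (\<forall>h k l. Im (Upsilon (D f q h) (D f q k) (D f q l)) = 0))"
      using chart_cone by blast
  qed
  ultimately show ?thesis using norm_u by (auto simp: sl_cone_link_def)
qed

text \<open>For \<open>z = s + \<i> t\<close> the defining cubic polynomial is
  \<open>- Im (z ^ 3)\<close>.\<close>

lemma L_of_iff: "x \<in> L_of (u ` B) c \<longleftrightarrow> (\<exists>z b. b \<in> B \<and> Im (z ^ 3) = - c \<and> x = z *s u b)"
proof -
  have "t ^ 3 - 3 * s\<^sup>2 * t = - Im ((Complex s t) ^ 3)" for s t
    by (simp add: power3_eq_cube power2_eq_square algebra_simps)
  then have "x \<in> L_of (u ` B) c \<longleftrightarrow> (\<exists>s t. \<exists>b\<in>B. - Im ((Complex s t) ^ 3) = c \<and> x = Complex s t *s u b)"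
    unfolding L_of_def by auto
  also have "\<dots> \<longleftrightarrow> (\<exists>z b. b \<in> B \<and> Im (z ^ 3) = - c \<and> x = z *s u b)"
    by (metis complex.exhaust minus_minus)
  finally show ?thesis .
qed

text \<open>The coordinates are the real part of \<open>z ^ 3\<close> and the surface parameter. As
  \<open>u\<close> has unit length, \<open>z\<close> is recovered from \<open>x = z *s u b\<close>
  as \<open>herm x (u b)\<close>; asking it to lie in \<open>U\<close> selects the branch of the
  cube root, and \<open>c \<noteq> 0\<close> keeps it away from 0.\<close>

lemma chart_L_of:
  assumes c: "c \<noteq> 0" and UV: "open U" "open V" "homeomorphism U V (\<lambda>z. z ^ 3) g" and g: "smooth_on V g"
  shows "chart (L_of (u ` B) c) {p. Complex (fst p) (- c) \<in> V \<and> snd p \<in> B}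
    (\<lambda>p. g (Complex (fst p) (- c)) *s u (snd p)) {x \<in> N'. herm x (u (Y x)) \<in> U}
    (\<lambda>x. (Re ((herm x (u (Y x))) ^ 3), Y x))" (is "chart ?L ?P ?f ?N ?k")
  unfolding chart_def
proof (intro conjI)
  have hom: "\<And>z. z \<in> U \<Longrightarrow> g (z ^ 3) = z" "\<And>w. w \<in> V \<Longrightarrow> g w ^ 3 = w" "\<And>z. z \<in> U \<Longrightarrow> z ^ 3 \<in> V"
    "\<And>w. w \<in> V \<Longrightarrow> g w \<in> U"
    using UV(3) by (auto simp: homeomorphism_def)
  have lc: "smooth_on UNIV (\<lambda>p::real \<times> complex. Complex (fst p) (- c))"
    by (intro smooth_on_Complex smooth_on_linear bounded_linear_fst smooth_on_const open_UNIV)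
  have "open {p \<in> UNIV. (Complex (fst p) (- c), snd p) \<in> V \<times> B}"
    using UV B lc by (intro open_vimage_Int open_Times continuous_on_Pair smooth_on_continuous continuous_on_snd) auto
  then show o: "open ?P" by simp
  have sh: "smooth_on N' (\<lambda>x. herm x (u (Y x)))"
    by (intro smooth_on_bilinear[OF bounded_bilinear_herm] N' smooth_on_id smooth_on_compose[OF N'(1) B _ N'(5) u])
      (auto simp: N'_def)
  show oN: "open ?N" by (rule open_vimage_Int[OF N'(1) smooth_on_continuous[OF sh] UV(1)])
  show "smooth_on ?P ?f"
    by (intro smooth_on_bilinear[OF bounded_bilinear_scale] o
        smooth_on_compose[OF o UV(2) _ smooth_on_mono[OF lc] g]
        smooth_on_compose[OF o B _ smooth_on_linear[OF bounded_linear_snd] u]) auto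
  have "?N \<subseteq> N'" by auto
  then show "smooth_on ?N ?k"
    using smooth_on_mono[OF sh] smooth_on_mono[OF N'(5)]
    by (intro smooth_on_Pair oN smooth_on_compose_linear[OF _ bounded_linear_Re] smooth_on_power) auto
  have red: "z *s u b \<in> N'" "Y (z *s u b) = b" "herm (z *s u b) (u b) = z" if "z \<noteq> 0" "b \<in> B" for z b
    using N'(4)[OF N'(3)[OF that(2)] that(1)] Y_scale(2)[OF Y_u(1)[OF that(2)] that(1)] Y_u(2)[OF that(2)]
      norm_u[OF that(2)] by (simp_all add: herm_left herm_self)
  have nz: "z \<noteq> 0" if "Im (z ^ 3) = - c" for z using that c by auto
  show "?f ` ?P = ?L \<inter> ?N"
  proof (intro equalityI subsetI)
    fix x assume "x \<in> ?f ` ?P"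
    then obtain \<tau> b where p: "Complex \<tau> (- c) \<in> V" "b \<in> B" "x = g (Complex \<tau> (- c)) *s u b" by auto
    have z: "Im (g (Complex \<tau> (- c)) ^ 3) = - c" using hom(2)[OF p(1)] by simp
    then show "x \<in> ?L \<inter> ?N"
      using p hom(4)[OF p(1)] red[OF nz[OF z] p(2)] L_of_iff[of x c] by auto
  next
    fix x assume "x \<in> ?L \<inter> ?N"
    then obtain z b where zb: "b \<in> B" "Im (z ^ 3) = - c" "x = z *s u b" "herm x (u (Y x)) \<in> U"
      using L_of_iff[of x c] by auto
    then have "z \<in> U" using red[OF nz[OF zb(2)] zb(1)] by simp
    moreover have "Complex (Re (z ^ 3)) (- c) = z ^ 3" using zb(2) by (simp add: complex_eq_iff)
    ultimately show "x \<in> ?f ` ?P" using hom zb(1,3) by (intro image_eqI[of _ _ "(Re (z ^ 3), b)"]) auto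
  qed
  show "\<forall>q\<in>?P. ?k (?f q) = q"
  proof
    fix q assume "q \<in> ?P"
    then have q: "Complex (fst q) (- c) \<in> V" "snd q \<in> B" by auto
    have z: "Im (g (Complex (fst q) (- c)) ^ 3) = - c" using hom(2)[OF q(1)] by simp
    show "?k (?f q) = q" using red[OF nz[OF z] q(2)] hom(2)[OF q(1)] by (simp add: prod_eq_iff)
  qed
qed

lemma special_lagrangian_L_of:
  assumes c: "c \<noteq> 0"
  shows "special_lagrangian (L_of (u ` B) c)"
proof (rule special_lagrangianI)
  fix p assume "p \<in> L_of (u ` B) c"
  then obtain z b where zb: "b \<in> B" "Im (z ^ 3) = - c" "p = z *s u b" using L_of_iff by blast
  have z: "z \<noteq> 0" using zb(2) c by auto
  obtain U V g where UV: "open U" "open V" "z \<in> U" "homeomorphism U V (\<lambda>z::complex. z ^ 3) g" "smooth_on V g"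
    using cube_local_inverse[OF z] .
  let ?P = "{p. Complex (fst p) (- c) \<in> V \<and> snd p \<in> B}" and ?f = "\<lambda>p. g (Complex (fst p) (- c)) *s u (snd p)"
    and ?N = "{x \<in> N'. herm x (u (Y x)) \<in> U}" and ?k = "\<lambda>x. (Re ((herm x (u (Y x))) ^ 3), Y x)"
  have ch: "chart (L_of (u ` B) c) ?P ?f ?N ?k" by (rule chart_L_of[OF c UV(1,2,4,5)])
  have "p \<in> ?N"
    using N'(4)[OF N'(3)[OF zb(1)] z] Y_scale(2)[OF Y_u(1)[OF zb(1)] z] Y_u(2)[OF zb(1)] norm_u[OF zb(1)] UV(3) zb(3)
    by (simp add: herm_left herm_self)
  moreover have "(\<forall>h k. Im (herm (D ?f q h) (D ?f q k)) = 0) \<and>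
      (\<forall>h k l. Im (Upsilon (D ?f q h) (D ?f q k) (D ?f q l)) = 0)" if q: "q \<in> ?P" for q
  proof -
    have b: "snd q \<in> B" and w: "Complex (fst q) (- c) \<in> V" using q by auto
    define \<zeta> where "\<zeta> p = g (Complex (fst p) (- c))" for p :: "real \<times> complex"
    have oP: "open ?P" by (rule chartD(1)[OF ch])
    have s\<zeta>: "smooth_on ?P \<zeta>"
      unfolding \<zeta>_def
      by (rule smooth_on_compose[OF oP UV(2) _ _ UV(5)], force)
        (intro smooth_on_Complex oP smooth_on_linear bounded_linear_fst smooth_on_const)
    have d\<zeta>: "(\<zeta> has_derivative D \<zeta> q) (at q)" by (rule smooth_on_has_derivative[OF s\<zeta> q])
    have cube: "\<zeta> p ^ 3 = Complex (fst p) (- c)" if "p \<in> ?P" for p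
      using UV(4) that by (simp add: \<zeta>_def homeomorphism_def)
    \<comment> \<open>Differentiating the constant \<open>Im (z ^ 3)\<close> gives the reality of
      \<open>\<alpha> * z\<^sup>2\<close> required by the tangent vector model, with \<alpha> the
      derivative of \<open>z\<close>.\<close>
    have "((\<lambda>p. Im (\<zeta> p ^ 3)) has_derivative (\<lambda>h. Im (of_nat 3 * D \<zeta> q h * \<zeta> q ^ (3 - 1)))) (at q)"
      by (intro bounded_linear.has_derivative[OF bounded_linear_Im] has_derivative_power d\<zeta>)
    then have "((\<lambda>p. - c) has_derivative (\<lambda>h. Im (of_nat 3 * D \<zeta> q h * \<zeta> q ^ (3 - 1)))) (at q)"
      by (rule has_derivative_transform_within_open[OF _ oP q]) (simp only: cube complex.sel)
    have im: "Im (D \<zeta> q h * (\<zeta> q)\<^sup>2) = 0" for h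
      using D_eqI[OF \<open>((\<lambda>p. - c) has_derivative _) _\<close>, of h] by (simp add: mult.assoc)
    have nz: "\<zeta> q \<noteq> 0" using cube[OF q] c by (auto simp: complex_eq_iff)
    have "((\<lambda>p. u (snd p)) has_derivative (\<lambda>h. D u (snd q) (snd h))) (at q)"
      by (rule has_derivative_compose[OF bounded_linear_imp_has_derivative[OF bounded_linear_snd]
          smooth_on_has_derivative[OF u b]])
    from bounded_bilinear.FDERIV[OF bounded_bilinear_scale d\<zeta> this]
    have "((\<lambda>p. \<zeta> p *s u (snd p)) has_derivative (\<lambda>h. \<zeta> q *s D u (snd q) (snd h) + D \<zeta> q h *s u (snd q))) (at q)" .
    from D_eqI[OF this] have d: "D ?f q h = D \<zeta> q h *s u (snd q) + \<zeta> q *s D u (snd q) (snd h)" for h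
      by (simp add: \<zeta>_def[symmetric] add.commute)
    note main = tangent_vectors[where v = "\<lambda>h. D ?f q h" and \<beta> = snd and \<alpha> = "D \<zeta> q", OF b nz im d]
    show ?thesis by (intro conjI allI main)
  qed
  ultimately show "\<exists>P (f :: real \<times> complex \<Rightarrow> complex ^ 3) N \<kappa>. chart (L_of (u ` B) c) P f N \<kappa> \<and> p \<in> N \<and>
      (\<forall>q\<in>P. (\<forall>h k. Im (herm (D f q h) (D f q k)) = 0) \<and>
        (\<forall>h k l. Im (Upsilon (D f q h) (D f q k) (D f q l)) = 0))"
    using ch by blast
qed

end

subsection \<open>The local structure theorem\<close>

lemma constant_on_convex:
  fixes f :: "'a::euclidean_space \<Rightarrow> 'b::euclidean_space"
  assumes "convex S" "open S" "\<And>x. x \<in> S \<Longrightarrow> (f has_derivative (\<lambda>h. 0)) (at x)" "x \<in> S" "y \<in> S"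
  shows "f x = f y"
  using has_derivative_zero_constant[OF assms(1), of f] assms(3-5) has_derivative_at_withinI by metis

lemma openin_translation:
  fixes S :: "'a::real_normed_vector set"
  assumes "openin (top_of_set S) A"
  shows "openin (top_of_set ((+) v ` S)) ((+) v ` A)"
proof -
  obtain O' where "open O'" "A = S \<inter> O'" using assms by (auto simp: openin_open)
  moreover from this have "(+) v ` A = (+) v ` S \<inter> (+) v ` O'" by (simp add: image_Int)
  ultimately show ?thesis using open_translation[of O' v] by (auto simp: openin_open)
qed

context sl_chart
begin

text \<open>\<open>Z\<close> is the cube of the factor \<open>s + i t\<close> and \<open>v0\<close> the vertex of the cone. In the model
  \<open>x = z u\<close>, \<open>z = \<rho> e\<^sup>i\<^sup>\<theta>\<close>, one has \<open>\<zeta>\<^sup>-\<^sup>1 = \<rho> e\<^sup>3\<^sup>i\<^sup>\<theta>\<close> and hence \<open>Z = z\<^sup>3\<close>.\<close>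

lemma flat_field_vertex:
  assumes ff: "flat_field E \<zeta>" and conv: "convex P" and q0: "q0 \<in> P"
  defines "Z \<equiv> \<lambda>q. inverse (cnj (\<zeta> q) * (\<zeta> q)\<^sup>2)"
  obtains v0 c where "c \<noteq> 0" "\<forall>q\<in>P. X q = v0 + inverse (\<zeta> q) *s E q" "\<forall>q\<in>P. Im (Z q) = - c"
    "smooth_on P Z" "\<forall>q\<in>P. \<forall>v. D Z q v = of_real (3 * (D X q v \<bullet> E q) / (norm (\<zeta> q))\<^sup>2)"
proof -
  have E: "smooth_on P E" "smooth_on P \<zeta>" using ff by (auto simp: flat_field_def)
  have nz: "\<zeta> q \<noteq> 0" if "q \<in> P" for q using ff that by (auto simp: flat_field_def)
  have DE: "D E q v = \<zeta> q *s D X q v + ((cnj (\<zeta> q) - 2 * \<zeta> q) * of_real (D X q v \<bullet> E q)) *s E q"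
    and D\<zeta>: "D \<zeta> q v = (cnj (\<zeta> q) - 2 * \<zeta> q) * \<zeta> q * of_real (D X q v \<bullet> E q)" if "q \<in> P" for q v
    using ff that unfolding flat_field_def by blast+
  have dE: "(E has_derivative D E q) (at q)" and d\<zeta>: "(\<zeta> has_derivative D \<zeta> q) (at q)" if "q \<in> P" for q
    using smooth_on_has_derivative E that by auto
  have dX0: "((\<lambda>q. X q - inverse (\<zeta> q) *s E q) has_derivative (\<lambda>h. 0)) (at q)" if q: "q \<in> P" for q
  proof -
    have "((\<lambda>q. X q - inverse (\<zeta> q) *s E q) has_derivative
      (\<lambda>h. D X q h - (inverse (\<zeta> q) *s D E q h + (- (inverse (\<zeta> q) * D \<zeta> q h * inverse (\<zeta> q))) *s E q))) (at q)"
      by (intro has_derivative_diff X_deriv q bounded_bilinear.FDERIV[OF bounded_bilinear_scale]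
          Deriv.has_derivative_inverse[OF nz[OF q] d\<zeta>[OF q]] dE)
    \<comment> \<open>The formula for \<open>D \<zeta>\<close> cancels the multiple of
      \<open>E q\<close> in \<open>D E\<close>, so \<open>inverse (\<zeta> q) *s E q\<close> has the
      same derivative as \<open>X\<close>.\<close>
    moreover have "D X q h - (inverse (\<zeta> q) *s D E q h + (- (inverse (\<zeta> q) * D \<zeta> q h * inverse (\<zeta> q))) *s E q) = 0" for h
      unfolding DE[OF q] D\<zeta>[OF q] using nz[OF q] by (simp add: vec_eq_iff field_simps)
    ultimately show ?thesis by simp
  qed
  define v0 where "v0 = X q0 - inverse (\<zeta> q0) *s E q0"
  have v0: "X q = v0 + inverse (\<zeta> q) *s E q" if "q \<in> P" for q
    using constant_on_convex[OF conv P dX0 that q0] by (simp add: v0_def algebra_simps)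
  have sZ: "smooth_on P Z"
    unfolding Z_def using E nz
    by (intro smooth_on_inverse smooth_on_mult smooth_on_power smooth_on_compose_linear[OF _ bounded_linear_cnj] P) auto
  have DZ: "D Z q v = of_real (3 * (D X q v \<bullet> E q) / (norm (\<zeta> q))\<^sup>2)" if q: "q \<in> P" for q v
  proof -
    let ?n = "cnj (\<zeta> q) * (\<zeta> q)\<^sup>2" and ?a = "complex_of_real (D X q v \<bullet> E q)"
    have n: "?n \<noteq> 0" using nz[OF q] by simp
    have "((\<lambda>q. cnj (\<zeta> q) * (\<zeta> q)\<^sup>2) has_derivative
      (\<lambda>h. cnj (\<zeta> q) * (of_nat 2 * D \<zeta> q h * \<zeta> q ^ (2 - 1)) + cnj (D \<zeta> q h) * (\<zeta> q)\<^sup>2)) (at q)"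
      by (intro has_derivative_mult has_derivative_power bounded_linear.has_derivative[OF bounded_linear_cnj] d\<zeta> q)
    from D_eqI[OF Deriv.has_derivative_inverse[OF n this]]
    have "D Z q v = - (inverse ?n * (cnj (\<zeta> q) * (of_nat 2 * D \<zeta> q v * \<zeta> q ^ (2 - 1)) + cnj (D \<zeta> q v) * (\<zeta> q)\<^sup>2) * inverse ?n)"
      unfolding Z_def .
    \<comment> \<open>With \<open>\<mu> = cnj \<zeta> - 2 * \<zeta>\<close> one has
      \<open>2 * \<mu> + cnj \<mu> = - 3 * \<zeta>\<close>. Hence the combination of one factor
      \<open>cnj \<zeta>\<close> and two factors \<zeta> in \<open>Z\<close>: its derivative becomes
      real.\<close>
    also have "cnj (\<zeta> q) * (of_nat 2 * D \<zeta> q v * \<zeta> q ^ (2 - 1)) + cnj (D \<zeta> q v) * (\<zeta> q)\<^sup>2 = - 3 * \<zeta> q * ?a * ?n"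
      unfolding D\<zeta>[OF q] by (simp add: power2_eq_square algebra_simps)
    also have "- (inverse ?n * (- 3 * \<zeta> q * ?a * ?n) * inverse ?n) = 3 * ?a / (\<zeta> q * cnj (\<zeta> q))"
      using nz[OF q] by (simp add: field_simps power2_eq_square)
    finally show ?thesis by (simp add: complex_norm_square[unfolded of_real_power])
  qed
  have dIm: "((\<lambda>q. Im (Z q)) has_derivative (\<lambda>h. 0)) (at q)" if q: "q \<in> P" for q
    using bounded_linear.has_derivative[OF bounded_linear_Im smooth_on_has_derivative[OF sZ q]]
    unfolding DZ[OF q] by simp
  have "Im (Z q) = - (- Im (Z q0))" if "q \<in> P" for q
    using constant_on_convex[OF conv P dIm that q0] by simp
  moreover have "- Im (Z q0) \<noteq> 0"
  proof
    assume "- Im (Z q0) = 0"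
    then have "Im (inverse (Z q0)) = 0" by simp
    \<comment> \<open>Up to a positive factor the inverse of \<open>Z\<close> is \<zeta>, so a
      nonzero imaginary part of \<zeta> gives a nonzero \<open>c\<close>.\<close>
    moreover have "inverse (Z q0) = of_real ((norm (\<zeta> q0))\<^sup>2) * \<zeta> q0"
      unfolding complex_norm_square by (simp add: Z_def power2_eq_square)
    ultimately show False using ff q0 nz[OF q0] by (auto simp: flat_field_def)
  qed
  ultimately show ?thesis using that[of "- Im (Z q0)" v0] v0 sZ DZ by blast
qed

text \<open>\<open>Re Z\<close> increases along \<open>E\<close>, while
  \<open>u = (X - v0) / z\<close> is constant there and its derivative is injective on the
  complement of \<open>E\<close>. So \<open>Re Z\<close> and a coordinate for the values of
  \<open>u\<close> straighten the chart, and in these coordinates \<open>X\<close> is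
  \<open>v0\<close> plus the parametrization of \<open>L_of\<close>.\<close>

lemma local_structure:
  assumes ff: "flat_field E \<zeta>" and conv: "convex P" and q0: "q0 \<in> P"
  shows "\<exists>U. X q0 \<in> U \<and> openin (top_of_set L) U \<and>
       (\<exists>\<Sigma> c v. sl_cone_link \<Sigma> \<and> special_lagrangian (L_of \<Sigma> c) \<and>
          openin (top_of_set ((+) v ` L_of \<Sigma> c)) U)"
proof -
  define Z where "Z q = inverse (cnj (\<zeta> q) * (\<zeta> q)\<^sup>2)" for q
  obtain v0 c where c: "c \<noteq> 0" and v0: "\<forall>q\<in>P. X q = v0 + inverse (\<zeta> q) *s E q" and ImZ: "\<forall>q\<in>P. Im (Z q) = - c"
    and sZ: "smooth_on P Z" and DZ: "\<forall>q\<in>P. \<forall>v. D Z q v = of_real (3 * (D X q v \<bullet> E q) / (norm (\<zeta> q))\<^sup>2)"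
    unfolding Z_def by (rule flat_field_vertex[OF ff conv q0])
  have E: "smooth_on P E" "smooth_on P \<zeta>" using ff by (auto simp: flat_field_def)
  have nz: "\<zeta> q \<noteq> 0" if "q \<in> P" for q using ff that by (auto simp: flat_field_def)
  have ET: "E q \<in> T q" and EE: "E q \<bullet> E q = 1" if "q \<in> P" for q using ff that by (auto simp: flat_field_def)
  have Z\<zeta>: "Z q * \<zeta> q = inverse (of_real ((norm (\<zeta> q))\<^sup>2))" if "q \<in> P" for q
    unfolding complex_norm_square using nz[OF that] by (simp add: Z_def power2_eq_square field_simps)
  have Z0: "Z q \<noteq> 0" if "q \<in> P" for q using nz[OF that] by (simp add: Z_def)
  obtain z1 where z1: "z1 ^ 3 = Z q0"
  proof -
    have "(exp (Ln (Z q0) / 3)) ^ 3 = Z q0" using Z0[OF q0] by (simp flip: exp_of_nat_mult)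
    then show ?thesis using that by blast
  qed
  have z10: "z1 \<noteq> 0" using z1 Z0[OF q0] by auto
  obtain Uc Vc g where Uc: "open Uc" "open Vc" "z1 \<in> Uc" "homeomorphism Uc Vc (\<lambda>z::complex. z ^ 3) g" "smooth_on Vc g"
    by (rule cube_local_inverse[OF z10])
  have g: "g w ^ 3 = w" if "w \<in> Vc" for w using Uc(4) that by (simp add: homeomorphism_def)
  have gz1: "g (Z q0) = z1" and Z0V: "Z q0 \<in> Vc"
    using Uc(3,4) z1 unfolding homeomorphism_def by force+
  define P1 where "P1 = {q \<in> P. Z q \<in> Vc}"
  have P1: "open P1" unfolding P1_def by (rule open_vimage_Int[OF P smooth_on_continuous[OF sZ] Uc(2)])
  have P1P: "q \<in> P" "Z q \<in> Vc" if "q \<in> P1" for q using that by (auto simp: P1_def)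
  define z where "z q = g (Z q)" for q
  define u where "u q = inverse (z q) *s (X q - v0)" for q
  have z3: "z q ^ 3 = Z q" if "q \<in> P1" for q using g[OF P1P(2)[OF that]] by (simp add: z_def)
  have z0: "z q \<noteq> 0" if "q \<in> P1" for q using z3[OF that] Z0[OF P1P(1)[OF that]] by auto
  have sub: "P1 \<subseteq> P" by (auto simp: P1_def)
  have sz: "smooth_on P1 z"
    unfolding z_def by (rule smooth_on_compose[OF P1 Uc(2) _ smooth_on_mono[OF sZ sub] Uc(5)]) (auto simp: P1_def)
  have su: "smooth_on P1 u"
    unfolding u_def using z0 sz smooth_on_mono[OF X sub]
    by (intro smooth_on_bilinear[OF bounded_bilinear_scale] smooth_on_inverse smooth_on_diff P1 smooth_on_const) auto
  \<comment> \<open>The number \<open>z q * \<zeta> q\<close> has modulus one by the next step, so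
    \<open>u\<close> is \<open>E\<close> multiplied by a phase.\<close>
  have uE: "u q = inverse (z q * \<zeta> q) *s E q" if "q \<in> P1" for q
    using v0 P1P(1)[OF that] by (simp add: u_def mult.commute)
  have nu: "norm (u q) = 1" if q: "q \<in> P1" for q
  proof -
    have "norm (z q) ^ 3 * norm (\<zeta> q) = inverse ((norm (\<zeta> q))\<^sup>2)"
      using arg_cong[OF Z\<zeta>[OF P1P(1)[OF q]], of norm]
      by (simp add: z3[OF q, symmetric] norm_mult norm_power norm_inverse)
    then have "(norm (z q) * norm (\<zeta> q)) ^ 3 = 1"
      using nz[OF P1P(1)[OF q]] by (simp add: power_mult_distrib field_simps power3_eq_cube power2_eq_square)
    then have "norm (z q) * norm (\<zeta> q) = 1"
      using power_eq_imp_eq_base[of "norm (z q) * norm (\<zeta> q)" 3 1] by simp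
    moreover have "norm (E q) = 1" using EE[OF P1P(1)[OF q]] by (simp add: norm_eq_1)
    ultimately show ?thesis unfolding uE[OF q] norm_scale norm_inverse norm_mult by simp
  qed
  have Du: "D u q v = inverse (z q) *s (D X q v - (D X q v \<bullet> E q) *\<^sub>R E q)" if q: "q \<in> P1" for q v
  proof -
    let ?a = "complex_of_real (D X q v \<bullet> E q)"
    have qP: "q \<in> P" using P1P(1)[OF q] .
    have dz: "(z has_derivative D z q) (at q)" by (rule smooth_on_has_derivative[OF sz q])
    have "((\<lambda>q. z q ^ 3) has_derivative (\<lambda>h. of_nat 3 * D z q h * z q ^ (3 - 1))) (at q)"
      by (rule has_derivative_power[OF dz])
    then have "(Z has_derivative (\<lambda>h. of_nat 3 * D z q h * z q ^ (3 - 1))) (at q)"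
      by (rule has_derivative_transform_within_open[OF _ P1 q]) (rule z3)
    from D_eqI[OF this, of v] have "3 * D z q v * (z q)\<^sup>2 = 3 * ?a * inverse (of_real ((norm (\<zeta> q))\<^sup>2))"
      using DZ[rule_format, OF qP, of v] by (simp add: divide_inverse)
    also have "\<dots> = 3 * ?a * (z q ^ 3 * \<zeta> q)" unfolding z3[OF q] Z\<zeta>[OF qP] ..
    \<comment> \<open>Only motion along \<open>E\<close> changes \<open>z\<close>, and this change
      cancels the component of \<open>D X\<close> along \<open>E\<close> in the derivative of
      \<open>u\<close>.\<close>
    finally have dzv: "D z q v = ?a * z q * \<zeta> q"
      using z0[OF q] by (simp add: power2_eq_square power3_eq_cube)
    have "((\<lambda>q. X q - v0) has_derivative (\<lambda>h. D X q h - 0)) (at q)"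
      by (intro has_derivative_diff X_deriv qP has_derivative_const)
    from bounded_bilinear.FDERIV[OF bounded_bilinear_scale Deriv.has_derivative_inverse[OF z0[OF q] dz] this]
    have "(u has_derivative (\<lambda>h. inverse (z q) *s (D X q h - 0) +
        (- (inverse (z q) * D z q h * inverse (z q))) *s (X q - v0))) (at q)"
      unfolding u_def .
    from D_eqI[OF this, of v] show ?thesis
      unfolding dzv using v0[rule_format, OF qP] z0[OF q] nz[OF qP]
      by (simp add: vec_eq_iff field_simps scaleR_conv_of_real[where 'a = complex])
  qed
  have perp: "D X q v - (D X q v \<bullet> E q) *\<^sub>R E q \<in> T q" "herm (E q) (D X q v - (D X q v \<bullet> E q) *\<^sub>R E q) = 0"
    if q: "q \<in> P" for q v
  proof -
    show t: "D X q v - (D X q v \<bullet> E q) *\<^sub>R E q \<in> T q"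
      by (intro subspace_diff subspace_scale subspace_T q ET DX_T)
    show "herm (E q) (D X q v - (D X q v \<bullet> E q) *\<^sub>R E q) = 0"
      using lagrangian[OF q ET[OF q] t] EE[OF q]
      by (simp add: herm_eq complex_eq_iff inner_diff_right inner_commute)
  qed
  have leg: "herm (u q) (D u q v) = 0" if q: "q \<in> P1" for q v
    unfolding Du[OF q] uE[OF q] by (simp only: herm_left(4) herm_right(4) perp(2)[OF P1P(1)[OF q]] mult_zero_right)
  have lag: "Im (herm (D u q v) (D u q w)) = 0" if q: "q \<in> P1" for q v w
  proof -
    have "herm (D u q v) (D u q w) = of_real ((norm (inverse (z q)))\<^sup>2) *
        herm (D X q v - (D X q v \<bullet> E q) *\<^sub>R E q) (D X q w - (D X q w \<bullet> E q) *\<^sub>R E q)"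
      unfolding Du[OF q] herm_left(4) herm_right(4) complex_norm_square by (simp only: ac_simps)
    moreover have "Im (herm (D X q v - (D X q v \<bullet> E q) *\<^sub>R E q) (D X q w - (D X q w \<bullet> E q) *\<^sub>R E q)) = 0"
      unfolding Im_herm by (rule lagrangian[OF P1P(1)[OF q] perp(1)[OF P1P(1)[OF q]] perp(1)[OF P1P(1)[OF q]]])
    ultimately show ?thesis by simp
  qed
  have spec: "Im (Upsilon (u q) (D u q v) (D u q w)) = 0" if q: "q \<in> P1" for q v w
  proof -
    have qP: "q \<in> P" using P1P(1)[OF q] .
    \<comment> \<open>The three factors combine to the inverse of \<open>z ^ 3 * \<zeta>\<close>,
      which is positive. This cancellation of phases is the reason for dividing by a cube root of
      \<open>Z\<close>.\<close>
    have "Upsilon (u q) (D u q v) (D u q w) = inverse (Z q * \<zeta> q) *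
        Upsilon (E q) (D X q v - (D X q v \<bullet> E q) *\<^sub>R E q) (D X q w - (D X q w \<bullet> E q) *\<^sub>R E q)"
      unfolding Du[OF q] uE[OF q] Upsilon_scale z3[OF q, symmetric] by (simp add: power3_eq_cube)
    also have "inverse (Z q * \<zeta> q) = of_real ((norm (\<zeta> q))\<^sup>2)" unfolding Z\<zeta>[OF qP] by simp
    finally show ?thesis using special[OF qP ET[OF qP] perp(1)[OF qP] perp(1)[OF qP]] by simp
  qed
  have z1q: "z q0 = z1" by (simp add: z_def gz1)
  have q01: "q0 \<in> P1" using q0 Z0V by (simp add: P1_def)
  obtain e where e: "orthonormal_basis (T q0) e" "e 1 = E q0"
  proof -
    obtain \<theta> where \<theta>: "\<forall>i. smooth_on P (\<theta> i)"
      "\<forall>q\<in>P. \<forall>i j. D X q (\<theta> (i::3) q) \<bullet> D X q (\<theta> j q) = (if i = j then 1 else 0)"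
      by (rule orthonormal_frame[OF P X chart_inverse_derivative(2)[OF ch]])
    have "norm (E q0) = 1" using EE[OF q0] by (simp add: norm_eq_1)
    then show ?thesis
      using orthonormal_basis_extend[OF frame_traceless(1)[OF \<theta> q0] ET[OF q0]] that by blast
  qed
  define u0 where "u0 = u q0"
  \<comment> \<open>An affine chart of the projective plane around the class of \<open>u0\<close>:
    dividing by \<open>herm x u0\<close> makes \<open>Y\<close> invariant under complex factors. The
    vectors \<open>d 2\<close> and \<open>d 3\<close> are the images of the directions
    \<open>e 2\<close> and \<open>e 3\<close> under the derivative of \<open>u\<close>.\<close>
  define N0 where "N0 = {x. herm x u0 \<noteq> 0}"
  define d where "d j = inverse z1 *s e j" for j
  define y where "y x = inverse (herm x u0) *s x" for x
  define Y where "Y x = Complex (y x \<bullet> d 2) (y x \<bullet> d 3)" for x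
  have h0: "herm u0 u0 = 1" using nu[OF q01] by (simp add: u0_def herm_self)
  have sh: "smooth_on UNIV (\<lambda>x. herm x u0)"
    by (intro smooth_on_bilinear[OF bounded_bilinear_herm] smooth_on_id smooth_on_const open_UNIV)
  have N0: "open N0"
    using open_vimage_Int[OF open_UNIV smooth_on_continuous[OF sh], of "- {0}"] by (simp add: N0_def open_Compl)
  have sY: "smooth_on N0 Y"
    unfolding Y_def y_def
    by (intro smooth_on_Complex smooth_on_inner smooth_on_bilinear[OF bounded_bilinear_scale] smooth_on_inverse
        smooth_on_mono[OF sh] N0 smooth_on_id smooth_on_const) (auto simp: N0_def)
  define P2 where "P2 = {q \<in> P1. u q \<in> N0}"
  have P2: "open P2" unfolding P2_def by (rule open_vimage_Int[OF P1 smooth_on_continuous[OF su] N0])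
  have P2P: "q \<in> P1" "q \<in> P" "u q \<in> N0" if "q \<in> P2" for q using that P1P by (auto simp: P2_def)
  have sub2: "P2 \<subseteq> P1" "P2 \<subseteq> P" using P2P by auto
  have q02: "q0 \<in> P2" using q01 h0 by (simp add: P2_def N0_def u0_def)
  define \<Psi> where "\<Psi> q = (Re (Z q), Y (u q))" for q
  have s\<Psi>: "smooth_on P2 \<Psi>"
    unfolding \<Psi>_def
    by (intro smooth_on_Pair P2 smooth_on_compose_linear[OF P2 bounded_linear_Re] smooth_on_mono[OF sZ sub2(2)]
        smooth_on_compose[OF P2 N0 _ smooth_on_mono[OF su sub2(1)] sY]) (auto simp: P2_def)
  have D\<Psi>: "D \<Psi> q v = (3 * (D X q v \<bullet> E q) / (norm (\<zeta> q))\<^sup>2, D Y (u q) (D u q v))" if q: "q \<in> P2" for q v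
  proof -
    have "(\<Psi> has_derivative (\<lambda>v. (Re (D Z q v), D Y (u q) (D u q v)))) (at q)"
      unfolding \<Psi>_def
      by (intro has_derivative_Pair bounded_linear.has_derivative[OF bounded_linear_Re]
          smooth_on_has_derivative[OF sZ P2P(2)[OF q]]
          has_derivative_compose[OF smooth_on_has_derivative[OF su P2P(1)[OF q]] smooth_on_has_derivative[OF sY P2P(3)[OF q]]])
    from D_eqI[OF this, of v] show ?thesis using DZ[rule_format, OF P2P(2)[OF q], of v] by simp
  qed
  have lin\<Psi>: "linear (D \<Psi> q)" if "q \<in> P2" for q by (rule linear_D[OF s\<Psi> that])
  \<comment> \<open>On vectors Hermitian orthogonal to \<open>u0\<close> the normalizing factor has
    zero derivative, so \<open>Y\<close> acts there as a linear coordinate.\<close>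
  have DY0: "D Y u0 w = Complex (w \<bullet> d 2) (w \<bullet> d 3)" if w: "herm u0 w = 0" for w
  proof -
    have wu: "herm w u0 = 0" using w herm_commute[of u0 w] by simp
    have "((\<lambda>x. herm x u0) has_derivative (\<lambda>w. herm w u0)) (at u0)"
      by (rule bounded_linear_imp_has_derivative[OF bounded_bilinear.bounded_linear_left[OF bounded_bilinear_herm]])
    from Deriv.has_derivative_inverse[OF _ this]
    have "((\<lambda>x. inverse (herm x u0)) has_derivative (\<lambda>w. - herm w u0)) (at u0)" using h0 by simp
    from bounded_bilinear.FDERIV[OF bounded_bilinear_scale this has_derivative_ident]
    have dy: "(y has_derivative (\<lambda>w. w + (- herm w u0) *s u0)) (at u0)"
      unfolding y_def using h0 by simp
    have "((\<lambda>x. (y x \<bullet> d 2) *\<^sub>R 1 + (y x \<bullet> d 3) *\<^sub>R \<i>) has_derivative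
        (\<lambda>w. ((w + (- herm w u0) *s u0) \<bullet> d 2) *\<^sub>R 1 + ((w + (- herm w u0) *s u0) \<bullet> d 3) *\<^sub>R \<i>)) (at u0)"
      by (intro has_derivative_add has_derivative_scaleR_left has_derivative_inner_left dy)
    moreover have "(\<lambda>x. (y x \<bullet> d 2) *\<^sub>R 1 + (y x \<bullet> d 3) *\<^sub>R \<i>) = Y"
      by (simp add: Y_def fun_eq_iff complex_eq_iff)
    ultimately have "(Y has_derivative
        (\<lambda>w. ((w + (- herm w u0) *s u0) \<bullet> d 2) *\<^sub>R 1 + ((w + (- herm w u0) *s u0) \<bullet> d 3) *\<^sub>R \<i>)) (at u0)" by simp
    from D_eqI[OF this, of w] show ?thesis by (simp add: wu complex_eq_iff)
  qed
  have "v = 0" if v: "D \<Psi> q0 v = 0" for v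
  proof -
    have "3 * (D X q0 v \<bullet> E q0) / (norm (\<zeta> q0))\<^sup>2 = 0" and y0: "D Y u0 (D u q0 v) = 0"
      using v D\<Psi>[OF q02, of v] by (simp_all add: u0_def zero_prod_def)
    then have a: "D X q0 v \<bullet> E q0 = 0" using nz[OF q0] by simp
    have sc: "(c *s a) \<bullet> (c *s b) = (norm c)\<^sup>2 * (a \<bullet> b)" for c and a b :: "complex ^ 3"
    proof -
      have "herm (c *s a) (c *s b) = of_real ((norm c)\<^sup>2) * herm a b"
        unfolding herm_left(4) herm_right(4) complex_norm_square by (simp only: ac_simps)
      from arg_cong[OF this, of Re] show ?thesis by (simp add: Re_herm)
    qed
    have "herm u0 (D u q0 v) = 0" unfolding u0_def by (rule leg[OF q01])
    from DY0[OF this] y0 have "Complex (D u q0 v \<bullet> d 2) (D u q0 v \<bullet> d 3) = 0" by simp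
    then have ud: "D u q0 v \<bullet> d 2 = 0" "D u q0 v \<bullet> d 3 = 0" by (simp_all add: complex_eq_iff)
    have ux: "D u q0 v = inverse z1 *s D X q0 v" using Du[OF q01, of v] a by (simp add: z1q)
    have "D X q0 v \<bullet> e 2 = 0" "D X q0 v \<bullet> e 3 = 0"
      using ud z10 unfolding ux d_def sc by simp_all
    then have "D X q0 v = 0"
      using orthonormal_basisD(4)[OF e(1) DX_T, of v] a e(2) by (simp add: sum_3)
    then show "v = 0" using \<tau>_X[OF q0, of v] linear_0[OF linear_\<tau>[OF q0]] by simp
  qed
  then have "inj (D \<Psi> q0)" using linear_injective_0[OF lin\<Psi>[OF q02]] by blast
  then obtain U V G where U: "open U" "U \<subseteq> P2" "q0 \<in> U" and V: "open V" "\<Psi> q0 \<in> V"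
    and hom: "homeomorphism U V \<Psi> G" and sG: "smooth_on V G"
    by (rule smooth_inverse_function[OF P2 s\<Psi> q02])
  have UV: "\<And>q. q \<in> U \<Longrightarrow> \<Psi> q \<in> V" "\<And>p. p \<in> V \<Longrightarrow> G p \<in> U" "\<And>q. q \<in> U \<Longrightarrow> G (\<Psi> q) = q"
    "\<And>p. p \<in> V \<Longrightarrow> \<Psi> (G p) = p"
    using hom by (auto simp: homeomorphism_def)
  have UP: "q \<in> P2" "q \<in> P1" "q \<in> P" if "q \<in> U" for q using that U(2) P2P by blast+
  have dG: "(G has_derivative D G p) (at p)" if "p \<in> V" for p by (rule smooth_on_has_derivative[OF sG that])
  have d\<Psi>: "(\<Psi> has_derivative D \<Psi> q) (at q)" if "q \<in> P2" for q by (rule smooth_on_has_derivative[OF s\<Psi> that])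
  have DGD: "D G (\<Psi> q) (D \<Psi> q v) = v" if q: "q \<in> U" for q v
  proof -
    have "((\<lambda>q. G (\<Psi> q)) has_derivative (\<lambda>v. D G (\<Psi> q) (D \<Psi> q v))) (at q)"
      by (rule has_derivative_compose[OF d\<Psi>[OF UP(1)[OF q]] dG[OF UV(1)[OF q]]])
    then have "((\<lambda>q. q) has_derivative (\<lambda>v. D G (\<Psi> q) (D \<Psi> q v))) (at q)"
      by (rule has_derivative_transform_within_open[OF _ U(1) q]) (rule UV(3))
    from D_eqI[OF this, of v] show ?thesis by simp
  qed
  have DDG: "D \<Psi> (G p) (D G p k) = k" if p: "p \<in> V" for p k
  proof -
    have "((\<lambda>p. \<Psi> (G p)) has_derivative (\<lambda>k. D \<Psi> (G p) (D G p k))) (at p)"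
      by (rule has_derivative_compose[OF dG[OF p] d\<Psi>[OF UP(1)[OF UV(2)[OF p]]]])
    then have "((\<lambda>p. p) has_derivative (\<lambda>k. D \<Psi> (G p) (D G p k))) (at p)"
      by (rule has_derivative_transform_within_open[OF _ V(1) p]) (rule UV(4))
    from D_eqI[OF this, of k] show ?thesis by simp
  qed
  have linu: "linear (D u q)" if "q \<in> P1" for q by (rule linear_D[OF su that])
  \<comment> \<open>\<eta> is the coordinate vector of \<open>E\<close>. Its image under
    \<open>D \<Psi>\<close> spans the first factor, so by injectivity every \<open>v\<close> with
    vanishing second component is a multiple of it, and \<open>D u\<close> annihilates
    \<eta>.\<close>
  have ker: "D u q v = 0" if q: "q \<in> U" and v: "D \<Psi> q v = (w', 0)" for q v w'
  proof -
    define \<eta> where "\<eta> = \<tau> q (E q)"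
    have X\<eta>: "D X q \<eta> = E q" unfolding \<eta>_def by (rule X_\<tau>[OF UP(3)[OF q] ET[OF UP(3)[OF q]]])
    have u\<eta>: "D u q \<eta> = 0"
      unfolding Du[OF UP(2)[OF q]] X\<eta> by (simp add: EE[OF UP(3)[OF q]])
    define \<kappa>' where "\<kappa>' = 3 / (norm (\<zeta> q))\<^sup>2"
    have \<kappa>': "\<kappa>' \<noteq> 0" using nz[OF UP(3)[OF q]] by (simp add: \<kappa>'_def)
    have "linear (D Y (u q))" by (rule linear_D[OF sY P2P(3)[OF UP(1)[OF q]]])
    then have "D \<Psi> q \<eta> = (\<kappa>', 0)"
      unfolding D\<Psi>[OF UP(1)[OF q]] u\<eta> X\<eta> by (simp add: EE[OF UP(3)[OF q]] \<kappa>'_def linear_0)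
    then have "D \<Psi> q v = D \<Psi> q ((w' / \<kappa>') *\<^sub>R \<eta>)"
      using v \<kappa>' by (simp add: linear_cmul[OF lin\<Psi>[OF UP(1)[OF q]]])
    then have "v = (w' / \<kappa>') *\<^sub>R \<eta>" using DGD[OF q] by metis
    then show "D u q v = 0" using u\<eta> by (simp add: linear_cmul[OF linu[OF UP(2)[OF q]]])
  qed
  define w0 where "w0 = Re (Z q0)"
  define y0 where "y0 = Y (u q0)"
  have \<Psi>0: "\<Psi> q0 = (w0, y0)" by (simp add: \<Psi>_def w0_def y0_def)
  \<comment> \<open>A product of balls has convex slices in the first variable, on which a vanishing
    derivative makes \<open>u\<close> constant.\<close>
  obtain \<epsilon> where \<epsilon>: "\<epsilon> > 0" "ball w0 \<epsilon> \<times> ball y0 \<epsilon> \<subseteq> V"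
  proof -
    obtain A1 A2 where A: "open A1" "open A2" "(w0, y0) \<in> A1 \<times> A2" "A1 \<times> A2 \<subseteq> V"
      using open_prod_elim[OF V(1)] V(2) \<Psi>0 by metis
    obtain e1 where e1: "e1 > 0" "ball w0 e1 \<subseteq> A1" using A(1,3) openE by blast
    obtain e2 where e2: "e2 > 0" "ball y0 e2 \<subseteq> A2" using A(2,3) openE by blast
    have "ball w0 (min e1 e2) \<subseteq> A1" "ball y0 (min e1 e2) \<subseteq> A2" using e1(2) e2(2) by auto
    then have "ball w0 (min e1 e2) \<times> ball y0 (min e1 e2) \<subseteq> V" using A(4) by blast
    then show ?thesis using that[of "min e1 e2"] e1(1) e2(1) by simp
  qed
  define I B where "I = ball w0 \<epsilon>" and "B = ball y0 \<epsilon>"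
  have IB: "(w, b) \<in> V" if "w \<in> I" "b \<in> B" for w b using \<epsilon>(2) that by (auto simp: I_def B_def)
  have w0I: "w0 \<in> I" and y0B: "y0 \<in> B" using \<epsilon>(1) by (simp_all add: I_def B_def)
  define uh where "uh b = u (G (w0, b))" for b
  have du: "(u has_derivative D u q) (at q)" if "q \<in> U" for q by (rule smooth_on_has_derivative[OF su UP(2)[OF that]])
  have u_uh: "u (G (w, b)) = uh b" if w: "w \<in> I" and b: "b \<in> B" for w b
    unfolding uh_def
  proof (rule constant_on_convex[where f = "\<lambda>w. u (G (w, b))", OF _ _ _ w w0I])
    show "convex I" "open I" by (simp_all add: I_def)
    fix x assume x: "x \<in> I"
    have "((\<lambda>x. (x, b)) has_derivative (\<lambda>h. (h, 0))) (at x)"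
      by (intro has_derivative_Pair has_derivative_ident has_derivative_const)
    from has_derivative_compose[OF has_derivative_compose[OF this dG[OF IB[OF x b]]] du[OF UV(2)[OF IB[OF x b]]]]
    have "((\<lambda>w. u (G (w, b))) has_derivative (\<lambda>h. D u (G (x, b)) (D G (x, b) (h, 0)))) (at x)" .
    moreover have "D u (G (x, b)) (D G (x, b) (h, 0)) = 0" for h
      by (rule ker[OF UV(2)[OF IB[OF x b]] DDG[OF IB[OF x b]]])
    ultimately show "((\<lambda>w. u (G (w, b))) has_derivative (\<lambda>h. 0)) (at x)" by simp
  qed
  have q: "G (w0, b) \<in> U" "G (w0, b) \<in> P1" if "b \<in> B" for b using UV(2)[OF IB[OF w0I that]] UP by auto
  have Duh: "\<exists>v. D uh b h = D u (G (w0, b)) v" if b: "b \<in> B" for b h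
  proof -
    have "((\<lambda>b. (w0, b)) has_derivative (\<lambda>h. (0, h))) (at b)"
      by (intro has_derivative_Pair has_derivative_ident has_derivative_const)
    from has_derivative_compose[OF has_derivative_compose[OF this dG[OF IB[OF w0I b]]] du[OF q(1)[OF b]]]
    have "(uh has_derivative (\<lambda>h. D u (G (w0, b)) (D G (w0, b) (0, h)))) (at b)" by (simp add: uh_def[abs_def])
    from D_eqI[OF this] show ?thesis by blast
  qed
  interpret legendrian B uh N0 Y
  proof (rule legendrian.intro)
    show oB: "open B" by (simp add: B_def)
    show "smooth_on B uh"
      unfolding uh_def
      by (rule smooth_on_compose[OF oB P1 _ smooth_on_compose[OF oB V(1) _ smooth_on_Pair[OF oB smooth_on_const smooth_on_id] sG] su])
        (use q(2) IB[OF w0I] in auto)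
    show "open N0" by (rule N0)
    show "0 \<notin> N0" by (simp add: N0_def herm_left)
    show "smooth_on N0 Y" by (rule sY)
    fix x :: "complex ^ 3" and k :: complex assume x: "x \<in> N0" "k \<noteq> 0"
    then show "k *s x \<in> N0" by (simp add: N0_def herm_left)
    have "y (k *s x) = y x" using x by (simp add: y_def N0_def herm_left vec_eq_iff field_simps)
    then show "Y (k *s x) = Y x" by (simp add: Y_def)
  next
    fix b assume b: "b \<in> B"
    show "norm (uh b) = 1" unfolding uh_def by (rule nu[OF q(2)[OF b]])
    show "uh b \<in> N0" unfolding uh_def by (rule P2P(3)[OF UP(1)[OF q(1)[OF b]]])
    have "\<Psi> (G (w0, b)) = (w0, b)" by (rule UV(4)[OF IB[OF w0I b]])
    then show "Y (uh b) = b" by (simp add: \<Psi>_def uh_def)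
    fix h k
    obtain v w where "D uh b h = D u (G (w0, b)) v" "D uh b k = D u (G (w0, b)) w" using Duh[OF b] by metis
    then show "herm (uh b) (D uh b h) = 0" "Im (herm (D uh b h) (D uh b k)) = 0"
      "Im (Upsilon (uh b) (D uh b h) (D uh b k)) = 0"
      using leg[OF q(2)[OF b]] lag[OF q(2)[OF b]] spec[OF q(2)[OF b]] by (simp_all add: uh_def)
  qed
  let ?f = "\<lambda>p. g (Complex (fst p) (- c)) *s uh (snd p)"
  note chL = chart_L_of[OF c Uc(1,2,4,5)]
  have oIB: "open (I \<times> B)" by (simp add: I_def B_def open_Times)
  have Zw: "Z (G p) = Complex (fst p) (- c)" if p: "p \<in> I \<times> B" for p
  proof -
    have pV: "p \<in> V" using p IB by (metis mem_Sigma_iff prod.collapse)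
    have "Re (Z (G p)) = fst p" using UV(4)[OF pV] by (simp add: \<Psi>_def prod_eq_iff)
    moreover have "Im (Z (G p)) = - c" using ImZ UP(3)[OF UV(2)[OF pV]] by blast
    ultimately show ?thesis by (simp add: complex_eq_iff)
  qed
  have IBV: "I \<times> B \<subseteq> V" using IB by auto
  have subL: "I \<times> B \<subseteq> {p. Complex (fst p) (- c) \<in> Vc \<and> snd p \<in> B}"
  proof
    fix p assume p: "p \<in> I \<times> B"
    then have "Z (G p) \<in> Vc" using P1P(2)[OF UP(2)[OF UV(2)]] IBV by blast
    then show "p \<in> {p. Complex (fst p) (- c) \<in> Vc \<and> snd p \<in> B}" using Zw[OF p] p by auto
  qed
  have XG: "X (G p) = v0 + ?f p" if p: "p \<in> I \<times> B" for p
  proof -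
    have pV: "p \<in> V" using p IBV by blast
    have q1: "G p \<in> P1" using UP(2)[OF UV(2)[OF pV]] .
    have "uh (snd p) = u (G p)" using u_uh[of "fst p" "snd p"] p by (simp add: mem_Times_iff)
    then have "?f p = z (G p) *s u (G p)" by (simp add: z_def Zw[OF p])
    also have "\<dots> = X (G p) - v0" using z0[OF q1] by (simp add: u_def)
    finally show ?thesis by simp
  qed
  have GI: "G ` (I \<times> B) = {q \<in> U. \<Psi> q \<in> I \<times> B}"
    using UV IBV by (auto simp: image_iff Bex_def subset_eq) (metis UV(3) mem_Sigma_iff prod.collapse)+
  have "open {q \<in> U. \<Psi> q \<in> I \<times> B}"
    using hom U(1) oIB by (intro open_vimage_Int) (auto simp: homeomorphism_def)
  then have oG: "open (G ` (I \<times> B))" using GI by simp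
  have GP: "G ` (I \<times> B) \<subseteq> P" using GI UP by auto
  let ?U = "X ` (G ` (I \<times> B))"
  have "?U = (+) v0 ` (?f ` (I \<times> B))" using XG by (simp add: image_image cong: image_cong)
  moreover have "openin (top_of_set (L_of (uh ` B) c)) (?f ` (I \<times> B))"
    by (rule chart_openin[OF chL oIB subL])
  ultimately have "openin (top_of_set ((+) v0 ` L_of (uh ` B) c)) ?U"
    by (simp add: openin_translation)
  moreover have "openin (top_of_set L) ?U" by (rule chart_openin[OF ch oG GP])
  moreover have "X q0 \<in> ?U"
    using UV(3)[OF U(3)] \<Psi>0 w0I y0B by (metis SigmaI imageI)
  ultimately show ?thesis
    by (intro exI[of _ ?U] exI[of _ "uh ` B"] exI[of _ c] exI[of _ v0] conjI sl_cone_link_surface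
        special_lagrangian_L_of[OF c])
qed

end

theorem theorem5:
  fixes L :: "(complex ^ 3) set"
  assumes "special_lagrangian L" and "connected L"
    and "\<exists>D. dense_open_in D L \<and> (\<forall>x\<in>D. has_Z3_symmetry L x)"
  shows "\<exists>Lstar. dense_open_in Lstar L \<and>
    (\<forall>p\<in>Lstar. \<exists>U. p \<in> U \<and> openin (top_of_set L) U \<and>
       (\<exists>\<Sigma> c v. sl_cone_link \<Sigma> \<and> special_lagrangian (L_of \<Sigma> c) \<and>
          openin (top_of_set ((+) v ` L_of \<Sigma> c)) U))"
proof -
  \<comment> \<open>The given dense open set itself serves as \<open>Lstar\<close>.\<close>
  obtain S where S: "dense_open_in S L" "\<forall>x\<in>S. has_Z3_symmetry L x" using assms(3) by blast
  obtain A where A: "open A" "S = L \<inter> A" using S(1) by (auto simp: dense_open_in_def openin_open)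
  have "\<exists>U. p \<in> U \<and> openin (top_of_set L) U \<and>
       (\<exists>\<Sigma> c v. sl_cone_link \<Sigma> \<and> special_lagrangian (L_of \<Sigma> c) \<and>
          openin (top_of_set ((+) v ` L_of \<Sigma> c)) U)" if p: "p \<in> S" for p
  proof -
    have "smooth_submanifold DIM(real \<times> complex) L"
      using assms(1) by (simp add: special_lagrangian_def numeral_3_eq_3)
    moreover have pL: "p \<in> L" "p \<in> A" using p A(2) by auto
    ultimately obtain P N \<kappa> and X :: "real \<times> complex \<Rightarrow> complex ^ 3" where ch: "chart L P X N \<kappa>" "p \<in> N"
      using submanifold_imp_chart by metis
    define q where "q = \<kappa> p"
    have q: "q \<in> P" "X q = p" using chartD(9,10)[OF ch(1) pL(1) ch(2)] by (simp_all add: q_def)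
    have "open {x \<in> P. X x \<in> A}"
      by (rule open_vimage_Int[OF chartD(1)[OF ch(1)] smooth_on_continuous[OF chartD(3)[OF ch(1)]] A(1)])
    \<comment> \<open>Shrinking to a ball gives the convexity used in the constancy arguments and
      ensures that every point of the chart has the symmetry.\<close>
    then obtain \<epsilon> where \<epsilon>: "\<epsilon> > 0" "ball q \<epsilon> \<subseteq> {x \<in> P. X x \<in> A}"
      using q pL(2) openE[of "{x \<in> P. X x \<in> A}" q] by auto
    have "ball q \<epsilon> \<subseteq> P" using \<epsilon>(2) by blast
    then interpret sl_chart L "ball q \<epsilon>" X "{x \<in> N. \<kappa> x \<in> ball q \<epsilon>}" \<kappa>
      by (rule sl_chart.intro[OF assms(1) chart_restrict[OF ch(1) open_ball]])
    have "has_Z3_symmetry L (X x)" if "x \<in> ball q \<epsilon>" for x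
      using that \<epsilon>(2) S(2) A(2) chartD(7)[OF ch(1)] by blast
    then obtain E r where "smooth_on (ball q \<epsilon>) E" "smooth_on (ball q \<epsilon>) r"
      "\<forall>x\<in>ball q \<epsilon>. \<exists>e s. orthonormal_basis (T x) e \<and> symmetric_cubic.normal_form (C x) e (r x) s \<and> e 1 = E x \<and> r x \<noteq> 0"
      using Z3_axis_field by metis
    then have "axis_field E r" by (simp add: axis_field_def)
    then obtain \<zeta> where ff: "flat_field E \<zeta>" by (rule flat_field_exists)
    show ?thesis using local_structure[OF ff convex_ball, of q] \<epsilon>(1) q(2) by simp
  qed
  then show ?thesis using S(1) by blast
qed

end
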